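(* Let $1<p<\infty$. Then there is a metric $d$ on $\mathbf{R}^2$, biLipschitz equivalent to the Euclidean metric, and a $p$-admissible measure $d\mu=w\,dx$, such that the following hold for $X=(\mathbf{R}^2,d,\mu)$: (a) The strong comparison principle fails for $p$-harmonic functions in the punctured unit disc $\Omega=\{x\in\mathbf{R}^2:0<|x|<1\}$; that is, there are $p$-harmonic functions $u$ and $v$ in $\Omega$ (with respect to $X$) such that $u\ge v$ in $\Omega$, but neither $u>v$ everywhere in $\Omega$ nor $u\equiv v$ in $\Omega$. (b) The theory for $2$-harmonic functions is nonlinear: there are $2$-harmonic functions $u$ and $v$ in the punctured unit disc $\{x\in\mathbf{R}^2:0<|x|<1\}$ (with respect to $X$) such that $u+v$ is not $2$-harmonic.
   Context: Conventions. $|x|$ is the Euclidean norm on $\mathbf{R}^2$ and $dx$ is Lebesgue measure; a weight $w$ is a nonnegative locally integrable function. A metric $d$ on $\mathbf{R}^2$ is biLipschitz equivalent to the Euclidean metric if there is $C\ge1$ with $C^{-1}|x-y|\le d(x,y)\le C|x-y|$ for all $x,y$. The measure $d\mu=w\,dx$ (or the weight $w$) is called $p$-admissible if $\mu$ is doubling and supports a $p$-Poincaré inequality on $\mathbf{R}^2$. Here $\mu$ is doubling if there is $C_\mu\ge1$ with $\mu(2B)\le C_\mu\mu(B)$ for every ball $B$, where $\lambda B(x,r)=B(x,\lambda r)$; and $\mu$ supports a $p$-Poincaré inequality if there are $C_{\rm PI}>0$ and $\lambda\ge1$ such that for all balls $B=B(x,r)$, all integrable $u$ and all upper gradients $g$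 of $u$, $\frac{1}{\mu(B)}\int_B|u-u_B|\,d\mu\le C_{\rm PI}\,r\bigl(\frac{1}{\mu(\lambda B)}\int_{\lambda B}g^p\,d\mu\bigr)^{1/p}$, where $u_B=\frac1{\mu(B)}\int_B u\,d\mu$. Definitions for a metric measure space $X=(X,d,\mu)$ and an exponent $1<q<\infty$. A Borel function $g:X\to[0,\infty]$ is an upper gradient of $u:X\to[-\infty,\infty]$ if for every nonconstant rectifiable curve $\gamma:[0,l_\gamma]\to X$, $|u(\gamma(0))-u(\gamma(l_\gamma))|\le\int_\gamma g\,ds$, where the left-hand side is $\infty$ if at least one of the terms is infinite. A measurable $g:X\to[0,\infty]$ is a $q$-weak upper gradient of $u$ if this holds for all nonconstant rectifiable curves outside a family $\Gamma$ of zero $q$-modulus (i.e. there is a nonnegative Borel $\rho\in L^q(X)$ with $\int_\gamma\rho\,ds=\infty$ for all $\gamma\in\Gamma$). If $u$ has an upper gradient in $L^q_{\rm loc}(X)$, then $g_u$ denotes its (a.e. unique) minimal $q$-weak upper gradient: $g_u\le g$ a.e. for every $q$-weak upper gradient $g\in L^q_{\rm loc}(X)$ of $u$. $\|u\|_{N^{1,q}(X)}=\bigl(\int_X|u|^q\,d\mu+\inf_g\int_X g^q\,d\mu\bigr)^{1/q}$, the infimum being over all upper gradients $g$ of $u$; $N^{1,q}(X)$ is the set of (everywhere defined, measurable) functions with finite norm. For open $\Omega$, $N^{1,q}(\Omega)$ is defined by considering $(\Omega,d|_\Omega,\mu|_\Omega)$ as a metric space; $u\in N^{1,q}_{\rm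 loc}(\Omega)$ if each $x\in\Omega$ has a ball $B(x,r_x)\subset\Omega$ with $u\in N^{1,q}(B(x,r_x))$. $N^{1,q}_0(\Omega)=\{f|_\Omega:f\in N^{1,q}(X),\ f=0\text{ on }X\setminus\Omega\}$. A function $u$ is $q$-harmonic in an open set $\Omega$ if it is continuous (and real-valued), $u\in N^{1,q}_{\rm loc}(\Omega)$ and $\int_{\varphi\ne0}g_u^q\,d\mu\le\int_{\varphi\ne0}g_{u+\varphi}^q\,d\mu$ for all $\varphi\in N^{1,q}_0(\Omega)$. In the claim this is used with $q=p$ in (a) and $q=2$ in (b). *)

theory Defs
  imports "HOL-Analysis.Analysis"
begin

text \<open>
  A metric measure space is given by a metric \<open>m\<close> of type \<open>'a metric\<close>, with underlying set
  \<open>mspace m\<close>, and a measure \<open>\<mu>\<close>.  An open subset \<open>\<Omega>\<close>, viewed as a metric measure space in its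
  own right, is \<open>submetric m \<Omega>\<close> with \<open>restrict_space \<mu> \<Omega>\<close>.  Functions on \<open>\<Omega>\<close> are represented by
  total functions whose values outside \<open>\<Omega>\<close> never matter.
\<close>

text \<open>Power with an exponent \<open>a > 0\<close>, so that \<open>\<infinity>\<close> is sent to \<open>\<infinity>\<close> and \<open>0\<close> to \<open>0\<close>.\<close>

definition ennpowr :: "ennreal \<Rightarrow> real \<Rightarrow> ennreal" where
  "ennpowr x a = (if x = \<infinity> then \<infinity> else ennreal (enn2real x powr a))"

definition metric_borel :: "'a metric \<Rightarrow> 'a measure" where
  "metric_borel m = sigma (mspace m) {U. openin (mtopology_of m) U}"


subsection \<open>Curves\<close>

definition curve_length :: "'a metric \<Rightarrow> (real \<Rightarrow> 'a) \<Rightarrow> real \<Rightarrow> real \<Rightarrow> ennreal" where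
  "curve_length m \<gamma> a b =
     (SUP ts \<in> {ts. sorted ts \<and> set ts \<subseteq> {a..b}}.
        \<Sum>i<length ts - 1. ennreal (mdist m (\<gamma> (ts ! i)) (\<gamma> (ts ! Suc i))))"

text \<open>
  The nonconstant rectifiable curves \<open>\<gamma> : [0, l] \<rightarrow> X\<close>, as pairs \<open>(l, \<gamma>)\<close>.  All of them are
  parametrized by arc length; a curve is nonconstant iff its length \<open>l\<close> is positive.
\<close>

definition rect_curves :: "'a metric \<Rightarrow> (real \<times> (real \<Rightarrow> 'a)) set" where
  "rect_curves m = {(l, \<gamma>). 0 < l \<and>
     continuous_map (top_of_set {0..l}) (mtopology_of m) \<gamma> \<and>
     (\<forall>t\<in>{0..l}. curve_length m \<gamma> 0 t = ennreal t)}"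

definition curve_integral :: "real \<times> (real \<Rightarrow> 'a) \<Rightarrow> ('a \<Rightarrow> ennreal) \<Rightarrow> ennreal" where
  "curve_integral c g = (case c of (l, \<gamma>) \<Rightarrow> \<integral>\<^sup>+t\<in>{0..l}. g (\<gamma> t) \<partial>lebesgue)"


subsection \<open>Upper gradients\<close>

definition ug_inequality ::
    "('a \<Rightarrow> ereal) \<Rightarrow> ('a \<Rightarrow> ennreal) \<Rightarrow> real \<times> (real \<Rightarrow> 'a) \<Rightarrow> bool" where
  "ug_inequality u g c = (case c of (l, \<gamma>) \<Rightarrow>
     (if \<bar>u (\<gamma> 0)\<bar> = \<infinity> \<or> \<bar>u (\<gamma> l)\<bar> = \<infinity> then \<infinity> else e2ennreal \<bar>u (\<gamma> 0) - u (\<gamma> l)\<bar>)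
       \<le> curve_integral (l, \<gamma>) g)"

definition upper_gradient :: "'a metric \<Rightarrow> ('a \<Rightarrow> ereal) \<Rightarrow> ('a \<Rightarrow> ennreal) \<Rightarrow> bool" where
  "upper_gradient m u g \<longleftrightarrow>
     g \<in> borel_measurable (metric_borel m) \<and> (\<forall>c\<in>rect_curves m. ug_inequality u g c)"

definition zero_modulus ::
    "real \<Rightarrow> 'a metric \<Rightarrow> 'a measure \<Rightarrow> (real \<times> (real \<Rightarrow> 'a)) set \<Rightarrow> bool" where
  "zero_modulus q m \<mu> \<Gamma> \<longleftrightarrow>
     \<Gamma> \<subseteq> rect_curves m \<and>
     (\<exists>\<rho>\<in>borel_measurable (metric_borel m).
        (\<integral>\<^sup>+x. ennpowr (\<rho> x) q \<partial>\<mu>) < \<infinity> \<and> (\<forall>c\<in>\<Gamma>. curve_integral c \<rho> = \<infinity>))"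

definition weak_upper_gradient ::
    "real \<Rightarrow> 'a metric \<Rightarrow> 'a measure \<Rightarrow> ('a \<Rightarrow> ereal) \<Rightarrow> ('a \<Rightarrow> ennreal) \<Rightarrow> bool" where
  "weak_upper_gradient q m \<mu> u g \<longleftrightarrow>
     g \<in> borel_measurable \<mu> \<and>
     (\<exists>\<Gamma>. zero_modulus q m \<mu> \<Gamma> \<and> (\<forall>c\<in>rect_curves m - \<Gamma>. ug_inequality u g c))"

definition Lq_loc :: "real \<Rightarrow> 'a metric \<Rightarrow> 'a measure \<Rightarrow> ('a \<Rightarrow> ennreal) set" where
  "Lq_loc q m \<mu> = {g \<in> borel_measurable \<mu>.
     \<forall>x\<in>mspace m. \<exists>r>0. (\<integral>\<^sup>+y\<in>mball_of m x r. ennpowr (g y) q \<partial>\<mu>) < \<infinity>}"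

definition is_minimal_wug ::
    "real \<Rightarrow> 'a metric \<Rightarrow> 'a measure \<Rightarrow> ('a \<Rightarrow> ereal) \<Rightarrow> ('a \<Rightarrow> ennreal) \<Rightarrow> bool" where
  "is_minimal_wug q m \<mu> u g \<longleftrightarrow>
     weak_upper_gradient q m \<mu> u g \<and> g \<in> Lq_loc q m \<mu> \<and>
     (\<forall>h. weak_upper_gradient q m \<mu> u h \<and> h \<in> Lq_loc q m \<mu> \<longrightarrow> (AE x in \<mu>. g x \<le> h x))"

text \<open>
  The minimal \<open>q\<close>-weak upper gradient is unique only up to \<open>\<mu>\<close>-null sets; a representative is
  chosen.  It is meaningful for functions that have an upper gradient in \<open>Lq_loc q m \<mu>\<close>.
\<close>

definition min_wug ::
    "real \<Rightarrow> 'a metric \<Rightarrow> 'a measure \<Rightarrow> ('a \<Rightarrow> ereal) \<Rightarrow> 'a \<Rightarrow> ennreal" where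
  "min_wug q m \<mu> u = (SOME g. is_minimal_wug q m \<mu> u g)"


subsection \<open>Newtonian spaces\<close>

definition newtonian_norm ::
    "real \<Rightarrow> 'a metric \<Rightarrow> 'a measure \<Rightarrow> ('a \<Rightarrow> ereal) \<Rightarrow> ennreal" where
  "newtonian_norm q m \<mu> u =
     ennpowr ((\<integral>\<^sup>+x. ennpowr (e2ennreal \<bar>u x\<bar>) q \<partial>\<mu>) +
              (INF g\<in>{g. upper_gradient m u g}. \<integral>\<^sup>+x. ennpowr (g x) q \<partial>\<mu>)) (1 / q)"

definition newtonian :: "real \<Rightarrow> 'a metric \<Rightarrow> 'a measure \<Rightarrow> ('a \<Rightarrow> ereal) set" where
  "newtonian q m \<mu> = {u \<in> borel_measurable \<mu>. newtonian_norm q m \<mu> u < \<infinity>}"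

definition newtonian_loc ::
    "real \<Rightarrow> 'a metric \<Rightarrow> 'a measure \<Rightarrow> 'a set \<Rightarrow> ('a \<Rightarrow> ereal) set" where
  "newtonian_loc q m \<mu> \<Omega> = {u. \<forall>x\<in>\<Omega>. \<exists>r>0. mball_of m x r \<subseteq> \<Omega> \<and>
     u \<in> newtonian q (submetric m (mball_of m x r)) (restrict_space \<mu> (mball_of m x r))}"

definition newtonian_zero ::
    "real \<Rightarrow> 'a metric \<Rightarrow> 'a measure \<Rightarrow> 'a set \<Rightarrow> ('a \<Rightarrow> ereal) set" where
  "newtonian_zero q m \<mu> \<Omega> =
     {\<phi>. \<exists>f\<in>newtonian q m \<mu>. (\<forall>x\<in>mspace m - \<Omega>. f x = 0) \<and> (\<forall>x\<in>\<Omega>. \<phi> x = f x)}"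


subsection \<open>Harmonic functions\<close>

text \<open>The set \<open>\<Omega>\<close> is meant to be open; minimal weak upper gradients are taken with respect to \<open>\<Omega>\<close>.\<close>

definition q_harmonic ::
    "real \<Rightarrow> 'a metric \<Rightarrow> 'a measure \<Rightarrow> 'a set \<Rightarrow> ('a \<Rightarrow> real) \<Rightarrow> bool" where
  "q_harmonic q m \<mu> \<Omega> u \<longleftrightarrow>
     continuous_map (subtopology (mtopology_of m) \<Omega>) euclideanreal u \<and>
     (\<lambda>x. ereal (u x)) \<in> newtonian_loc q m \<mu> \<Omega> \<and>
     (\<forall>\<phi>\<in>newtonian_zero q m \<mu> \<Omega>.
        (\<integral>\<^sup>+x\<in>{x\<in>\<Omega>. \<phi> x \<noteq> 0}.
            ennpowr (min_wug q (submetric m \<Omega>) (restrict_space \<mu> \<Omega>) (\<lambda>x. ereal (u x)) x) q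
          \<partial>restrict_space \<mu> \<Omega>)
        \<le> (\<integral>\<^sup>+x\<in>{x\<in>\<Omega>. \<phi> x \<noteq> 0}.
            ennpowr (min_wug q (submetric m \<Omega>) (restrict_space \<mu> \<Omega>) (\<lambda>x. ereal (u x) + \<phi> x) x) q
          \<partial>restrict_space \<mu> \<Omega>))"


subsection \<open>Admissible weights and biLipschitz equivalent metrics\<close>

text \<open>
  The standing convention that balls have positive and finite measure, which is implicit in
  the division by the measure of a ball, is part of the definition; it excludes the zero measure.
\<close>

definition doubling :: "'a metric \<Rightarrow> 'a measure \<Rightarrow> bool" where
  "doubling m \<mu> \<longleftrightarrow>
     (\<forall>x\<in>mspace m. \<forall>r>0. 0 < emeasure \<mu> (mball_of m x r) \<and> emeasure \<mu> (mball_of m x r) < \<infinity>) \<and>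
     (\<exists>C\<ge>1. \<forall>x\<in>mspace m. \<forall>r>0.
        emeasure \<mu> (mball_of m x (2 * r)) \<le> ennreal C * emeasure \<mu> (mball_of m x r))"

text \<open>
  Integrable functions may be extended real-valued; they are finite almost everywhere, so
  passing through \<open>real_of_ereal\<close> in the mean value is harmless.
\<close>

definition mean_value :: "'a measure \<Rightarrow> 'a set \<Rightarrow> ('a \<Rightarrow> ereal) \<Rightarrow> real" where
  "mean_value \<mu> B u = (LINT x:B|\<mu>. real_of_ereal (u x)) / measure \<mu> B"

definition supports_poincare :: "real \<Rightarrow> 'a metric \<Rightarrow> 'a measure \<Rightarrow> bool" where
  "supports_poincare p m \<mu> \<longleftrightarrow>
     (\<exists>C>0. \<exists>\<Lambda>\<ge>1. \<forall>x\<in>mspace m. \<forall>r>0. \<forall>u g.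
        u \<in> borel_measurable \<mu> \<and> (\<integral>\<^sup>+y. e2ennreal \<bar>u y\<bar> \<partial>\<mu>) < \<infinity> \<and> upper_gradient m u g \<longrightarrow>
        (\<integral>\<^sup>+y\<in>mball_of m x r. e2ennreal \<bar>u y - ereal (mean_value \<mu> (mball_of m x r) u)\<bar> \<partial>\<mu>)
            / emeasure \<mu> (mball_of m x r)
        \<le> ennreal (C * r) *
           ennpowr ((\<integral>\<^sup>+y\<in>mball_of m x (\<Lambda> * r). ennpowr (g y) p \<partial>\<mu>)
             / emeasure \<mu> (mball_of m x (\<Lambda> * r))) (1 / p))"

definition weight :: "('a::euclidean_space \<Rightarrow> real) \<Rightarrow> bool" where
  "weight w \<longleftrightarrow> (\<forall>x. 0 \<le> w x) \<and> w \<in> borel_measurable lebesgue \<and>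
     (\<forall>K. compact K \<longrightarrow> set_integrable lebesgue K w)"

definition weighted_measure :: "('a::euclidean_space \<Rightarrow> real) \<Rightarrow> 'a measure" where
  "weighted_measure w = density lebesgue (\<lambda>x. ennreal (w x))"

text \<open>Admissibility of a weight is understood with respect to the Euclidean metric.\<close>

definition p_admissible :: "real \<Rightarrow> ('a::euclidean_space \<Rightarrow> real) \<Rightarrow> bool" where
  "p_admissible p w \<longleftrightarrow> weight w \<and>
     doubling euclidean_metric (weighted_measure w) \<and>
     supports_poincare p euclidean_metric (weighted_measure w)"

definition biLipschitz_euclidean :: "('a::euclidean_space) metric \<Rightarrow> bool" where
  "biLipschitz_euclidean m \<longleftrightarrow> mspace m = UNIV \<and>
     (\<exists>C\<ge>1. \<forall>x y. norm (x - y) / C \<le> mdist m x y \<and> mdist m x y \<le> C * norm (x - y))"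

definition punctured_disc :: "(real ^ 2) set" where
  "punctured_disc = {x. 0 < norm x \<and> norm x < 1}"

end

theory Submission
  imports Defs
begin

text \<open>
  The example is the plane with Lebesgue measure and the taxicab metric
  \<open>d(x, y) = |x\<^sub>1 - y\<^sub>1| + |x\<^sub>2 - y\<^sub>2|\<close>.  The minimal upper gradient of a smooth function \<open>u\<close> is then the
  dual norm \<open>max |\<partial>\<^sub>1u| |\<partial>\<^sub>2u|\<close> of its gradient, which is not strictly convex: while \<open>|\<partial>\<^sub>1u| = 1\<close>, the
  other derivative may vary freely in \<open>[-1, 1]\<close> at no cost.  Hence every function \<open>\<plusminus>x\<^sub>1 + h(x\<^sub>2)\<close> with
  \<open>h\<close> a 1-Lipschitz function is \<open>q\<close>-harmonic for all \<open>q > 1\<close>.  Its minimal upper gradient is at most \<open>1\<close>,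
  and on each horizontal line the function is affine with slope \<open>\<plusminus>1\<close>, so that a perturbation that
  vanishes at the boundary cannot push the mean of an upper gradient on the line below \<open>1\<close>; this is
  \<open>harmonic_affine_plus_Lipschitz\<close>.  For (a), \<open>x\<^sub>1 + |x\<^sub>2|\<close> lies above \<open>x\<^sub>1\<close> and touches it exactly on the
  line \<open>x\<^sub>2 = 0\<close>.  For (b), \<open>x\<^sub>1 + |x\<^sub>2|\<close> and \<open>-x\<^sub>1\<close> have the sum \<open>|x\<^sub>2|\<close>, whose energy drops when the bottom of
  its valley is filled up; this is \<open>abs_second_coordinate_not_harmonic\<close>.

  Three general facts carry these computations over to weak upper gradients.  First, a minimal
  weak upper gradient exists (\<open>minimal_wug_exists\<close>): weak upper gradients are stable under minima
  and decreasing limits, so a minimizing sequence for the energy can be chosen decreasing.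
  Stability under minima is a statement about functions of one variable
  (\<open>variation_bound_min\<close>).  Secondly, by Fubini, a weak upper gradient is an upper gradient on
  almost every line parallel to an axis (\<open>wug_on_lines\<close>).  Thirdly, mean values over lines turn
  into bounds for \<open>\<integral>g\<^sup>q\<close> through the inequality of Bernoulli (\<open>measure_le_energy\<close>), which is used
  wherever one might expect the inequality of Hoelder.

  Lebesgue measure supports a Poincare inequality because two points of a square are joined by a
  horizontal and a vertical segment inside it, and averaging over the square turns the integrals
  along these segments into integrals over the square (\<open>poincare_ball\<close>).
\<close>

section \<open>Powers of extended nonnegative numbers\<close>

lemma ennpowr_ennreal: "0 \<le> x \<Longrightarrow> ennpowr (ennreal x) a = ennreal (x powr a)"
  by (simp add: ennpowr_def)

lemma ennpowr_top [simp]: "ennpowr top a = top"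
  by (simp add: ennpowr_def)

lemma ennpowr_0 [simp]: "ennpowr 0 a = 0"
  by (simp add: ennpowr_def)

lemma ennpowr_1 [simp]: "ennpowr 1 a = 1"
  by (simp add: ennpowr_def)

lemma ennpowr_mono: "0 \<le> a \<Longrightarrow> x \<le> y \<Longrightarrow> ennpowr x a \<le> ennpowr y a"
  by (cases x; cases y) (auto simp: ennpowr_ennreal powr_mono2 top_unique)

lemma ennpowr_eq_top_iff [simp]: "ennpowr x a = top \<longleftrightarrow> x = top"
  by (cases x) (auto simp: ennpowr_ennreal)

lemma ennpowr_less_top_iff [simp]: "ennpowr x a < top \<longleftrightarrow> x < top"
  using ennpowr_eq_top_iff[of x a] by (metis less_top)

lemma ennpowr_eq_0_iff [simp]: "ennpowr x a = 0 \<longleftrightarrow> x = 0"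
  by (cases x) (auto simp: ennpowr_ennreal)

lemma ennpowr_mult: "ennpowr (ennreal c * x) a = ennreal (c powr a) * ennpowr x a" if "0 < c"
  using that
  by (cases x) (auto simp: ennpowr_ennreal ennreal_mult[symmetric] powr_mult ennreal_mult_top)

lemma ennpowr_powr: "0 < a \<Longrightarrow> ennpowr (ennpowr x a) (1 / a) = x"
  by (cases x) (auto simp: ennpowr_ennreal powr_powr)

lemma measurable_ennpowr [measurable]: "(\<lambda>x. ennpowr x a) \<in> borel_measurable borel"
  unfolding ennpowr_def by measurable

abbreviation energy :: "real \<Rightarrow> 'a measure \<Rightarrow> ('a \<Rightarrow> ennreal) \<Rightarrow> ennreal" where
  "energy q M g \<equiv> (\<integral>\<^sup>+x. ennpowr (g x) q \<partial>M)"

text \<open>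
  The graph of the power lies above its tangent at \<open>1\<close>.  Integrated over a set, this turns a lower
  bound for the mean of a function into one for the mean of its power.
\<close>

lemma ennpowr_bernoulli:
  assumes "1 < a"
  shows "ennreal a * x \<le> ennpowr x a + ennreal (a - 1)"
proof (cases x)
  case (real r)
  have "a * r \<le> r powr a + (a - 1)"
  proof (cases "r = 0")
    case False
    have "r * 1 \<le> r powr a / a + 1 powr (a / (a - 1)) / (a / (a - 1))"
      using assms real False by (intro Youngs_inequality) (auto simp: field_simps)
    then have "a * r \<le> a * (r powr a / a + (a - 1) / a)"
      using assms by (intro mult_left_mono) auto
    also have "\<dots> = r powr a + (a - 1)"
      using assms by (simp add: field_simps)
    finally show ?thesis .
  qed (use assms in simp)
  then show ?thesis
    using real assms by (simp add: ennpowr_ennreal ennreal_mult[symmetric] ennreal_plus[symmetric] del: ennreal_plus)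
qed (use assms in simp)

lemma ennpowr_add_le:
  assumes "0 < a"
  shows "ennpowr (x + y) a \<le> ennreal (2 powr a) * (ennpowr x a + ennpowr y a)"
proof -
  have "x + y \<le> ennreal 2 * max x y"
    by (metis add_mono ennreal_numeral max.cobounded1 max.cobounded2 mult_2 zero_le_numeral)
  then have "ennpowr (x + y) a \<le> ennreal (2 powr a) * ennpowr (max x y) a"
    by (metis assms ennpowr_mono ennpowr_mult less_eq_real_def zero_less_numeral)
  also have "ennpowr (max x y) a \<le> ennpowr x a + ennpowr y a"
    by (simp add: max_def)
  finally show ?thesis by (simp add: mult_left_mono)
qed


section \<open>Functions of one variable controlled by an integral\<close>

abbreviation interval_integral :: "real \<Rightarrow> real \<Rightarrow> (real \<Rightarrow> ennreal) \<Rightarrow> ennreal" where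
  "interval_integral a b g \<equiv> (\<integral>\<^sup>+x\<in>{a..b}. g x \<partial>lborel)"

text \<open>
  The upper gradient inequality seen along a curve: \<open>f\<close> stands for the values of a function on the
  curve and \<open>g\<close> for those of the gradient, and every subinterval of \<open>I\<close> is a subcurve.
\<close>

definition variation_bound :: "(real \<Rightarrow> real) \<Rightarrow> (real \<Rightarrow> ennreal) \<Rightarrow> real set \<Rightarrow> bool" where
  "variation_bound f g I \<longleftrightarrow>
     (\<forall>s t. s \<le> t \<and> {s..t} \<subseteq> I \<longrightarrow> ennreal \<bar>f s - f t\<bar> \<le> interval_integral s t g)"

lemma variation_boundD:
  "variation_bound f g I \<Longrightarrow> s \<le> t \<Longrightarrow> {s..t} \<subseteq> I \<Longrightarrow> ennreal \<bar>f s - f t\<bar> \<le> interval_integral s t g"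
  by (auto simp: variation_bound_def)

lemma nn_integral_interval_split:
  fixes g :: "real \<Rightarrow> ennreal"
  assumes [measurable]: "g \<in> borel_measurable borel" and "a \<le> b" "b \<le> c"
  shows "interval_integral a c g = interval_integral a b g + interval_integral b c g"
proof -
  have "interval_integral a c g = (\<integral>\<^sup>+x. g x * indicator {a..b} x + g x * indicator {b..c} x \<partial>lborel)"
    by (intro nn_integral_cong_AE, use AE_lborel_singleton[of b] in eventually_elim)
      (use assms(2,3) in \<open>auto split: split_indicator\<close>)
  also have "\<dots> = interval_integral a b g + interval_integral b c g"
    by (intro nn_integral_add) auto
  finally show ?thesis .
qed

text \<open>
  Triangle inequality over a partition of mesh \<open>d\<close>.  The point is that the bound is only
  required on short intervals, where it may be obtained in different ways.
\<close>

lemma variation_bound_partition: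
  fixes G :: "real \<Rightarrow> ennreal"
  assumes [measurable]: "G \<in> borel_measurable borel" and "0 < d" "a \<le> b"
    and short: "\<And>s t. a \<le> s \<Longrightarrow> s \<le> t \<Longrightarrow> t \<le> b \<Longrightarrow> t - s \<le> d \<Longrightarrow>
                  ennreal \<bar>f s - f t\<bar> \<le> interval_integral s t G"
  shows "ennreal \<bar>f a - f b\<bar> \<le> interval_integral a b G"
proof -
  have "ennreal \<bar>f a - f t\<bar> \<le> interval_integral a t G" if "a \<le> t" "t \<le> b" "t \<le> a + real n * d" for n t
    using that
  proof (induction n arbitrary: t)
    case 0
    then show ?case by simp
  next
    case (Suc n)
    show ?case
    proof (cases "t \<le> a + real n * d")
      case True
      then show ?thesis using Suc by blast
    next
      case False
      define s where "s = a + real n * d"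
      have s: "a \<le> s" "s \<le> t" "t - s \<le> d"
        using False Suc.prems \<open>0 < d\<close> by (auto simp: s_def algebra_simps)
      have "ennreal \<bar>f a - f t\<bar> \<le> ennreal \<bar>f a - f s\<bar> + ennreal \<bar>f s - f t\<bar>"
        by (simp flip: ennreal_plus)
      also have "\<dots> \<le> interval_integral a s G + interval_integral s t G"
        using s Suc.prems by (intro add_mono Suc.IH short) (auto simp: s_def)
      also have "\<dots> = interval_integral a t G"
        using s by (intro nn_integral_interval_split[symmetric]) auto
      finally show ?thesis .
    qed
  qed
  moreover obtain n where "b \<le> a + real n * d"
    using real_arch_simple[of "(b - a) / d"] \<open>0 < d\<close> by (auto simp: field_simps)
  ultimately show ?thesis using \<open>a \<le> b\<close> by blast
qed

text \<open>
  Let \<open>K n\<close> be the set of points at distance at least \<open>1 / (n + 1)\<close> from the complement of \<open>U\<close>.  An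
  interval of a sufficiently fine partition either meets \<open>K n\<close>, and then lies in \<open>U\<close>, where \<open>g2\<close>
  is a bound, or it misses \<open>K n\<close> and is controlled by the integral of \<open>g1\<close> off \<open>K n\<close>.  The sets
  \<open>K n\<close> increase to \<open>U\<close>, and since \<open>g1\<close> is integrable, its integral off \<open>K n\<close> decreases to the one
  off \<open>U\<close>.
\<close>

lemma variation_bound_open:
  fixes g1 g2 :: "real \<Rightarrow> ennreal"
  assumes [measurable]: "g1 \<in> borel_measurable borel" "g2 \<in> borel_measurable borel"
    and "open U" and "a \<le> b"
    and f1: "variation_bound f g1 {a..b}" and f2: "variation_bound f g2 ({a..b} \<inter> U)"
    and fin: "interval_integral a b g1 < \<infinity>"
  shows "ennreal \<bar>f a - f b\<bar> \<le> (\<integral>\<^sup>+x\<in>{a..b}. (if x \<in> U then g2 x else g1 x) \<partial>lborel)"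
proof -
  have [measurable]: "U \<in> sets borel" using \<open>open U\<close> by (rule borel_open)
  define K where "K n = - (\<Union>y\<in>-U. ball y (1 / Suc n))" for n :: nat
  have [measurable]: "K n \<in> sets borel" for n
    unfolding K_def by (intro borel_closed closed_Compl open_UN ballI open_ball)
  define G where "G n x = g2 x * indicator U x + g1 x * indicator (- K n) x" for n x
  have [measurable]: "G n \<in> borel_measurable borel" for n
    unfolding G_def by measurable
  have KO: "K n \<subseteq> U" for n by (force simp: K_def)
  have K_mono: "K m \<subseteq> K n" if "m \<le> n" for m n
  proof -
    have "1 / real (Suc n) \<le> 1 / real (Suc m)" using that by (simp add: field_simps)
    then show ?thesis by (force simp: K_def)
  qed
  have K_ex: "\<exists>n. x \<in> K n" if xU: "x \<in> U" for x
  proof -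
    obtain e where e: "0 < e" "ball x e \<subseteq> U" by (rule openE[OF \<open>open U\<close> xU])
    obtain n where n: "1 / Suc n < e" using e(1) by (rule nat_approx_posE)
    have "x \<notin> ball y (1 / Suc n)" if "y \<notin> U" for y
    proof
      assume "x \<in> ball y (1 / Suc n)"
      then have "y \<in> ball x e" using n by (simp add: dist_commute)
      then show False using e(2) that by blast
    qed
    then have "x \<in> K n" unfolding K_def by blast
    then show ?thesis ..
  qed
  have *: "ennreal \<bar>f a - f b\<bar> \<le> (\<integral>\<^sup>+x\<in>{a..b}. G n x \<partial>lborel)" for n
  proof (rule variation_bound_partition[where d = "1 / (2 * real (Suc n))"])
    fix s t assume st: "a \<le> s" "s \<le> t" "t \<le> b" "t - s \<le> 1 / (2 * real (Suc n))"
    have st': "t - s < 1 / Suc n"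
      using st(4) by (rule le_less_trans) (simp add: field_simps)
    show "ennreal \<bar>f s - f t\<bar> \<le> (\<integral>\<^sup>+x\<in>{s..t}. G n x \<partial>lborel)"
    proof (cases "{s..t} \<inter> K n = {}")
      case True
      have "ennreal \<bar>f s - f t\<bar> \<le> interval_integral s t g1"
        using f1 st by (intro variation_boundD) auto
      also have "\<dots> \<le> (\<integral>\<^sup>+x\<in>{s..t}. G n x \<partial>lborel)"
        using True by (intro nn_integral_mono) (auto simp: G_def split: split_indicator)
      finally show ?thesis .
    next
      case False
      then obtain z where z: "z \<in> {s..t}" "z \<in> K n" by blast
      have sub: "{s..t} \<subseteq> U"
      proof (rule ccontr)
        assume "\<not> {s..t} \<subseteq> U"
        then obtain y where y: "y \<in> {s..t}" "y \<notin> U" by blast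
        then have "z \<in> ball y (1 / Suc n)" using z st' by (auto simp: dist_real_def)
        then show False using y z by (auto simp: K_def)
      qed
      have "ennreal \<bar>f s - f t\<bar> \<le> interval_integral s t g2"
        using st sub by (intro variation_boundD[OF f2]) auto
      also have "\<dots> \<le> (\<integral>\<^sup>+x\<in>{s..t}. G n x \<partial>lborel)"
        using sub by (intro nn_integral_mono) (auto simp: G_def split: split_indicator)
      finally show ?thesis .
    qed
  qed (use \<open>a \<le> b\<close> in auto)
  define R where "R = (\<integral>\<^sup>+x. g1 x * indicator (- U) x * indicator {a..b} x \<partial>lborel)"
  have lim: "(INF n. \<integral>\<^sup>+x. g1 x * indicator (- K n) x * indicator {a..b} x \<partial>lborel) = R"
  proof -
    have "(INF n. \<integral>\<^sup>+x. g1 x * indicator (- K n) x * indicator {a..b} x \<partial>lborel)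
        = (\<integral>\<^sup>+x. (INF n. g1 x * indicator (- K n) x * indicator {a..b} x) \<partial>lborel)"
    proof (rule nn_integral_monotone_convergence_INF_decseq[symmetric])
      show "decseq (\<lambda>n x. g1 x * indicator (- K n) x * indicator {a..b} x)"
        unfolding decseq_def by (auto simp: le_fun_def dest!: K_mono split: split_indicator)
      have "(\<integral>\<^sup>+x. g1 x * indicator (- K 0) x * indicator {a..b} x \<partial>lborel) \<le> interval_integral a b g1"
        by (intro nn_integral_mono) (auto split: split_indicator)
      then show "(\<integral>\<^sup>+x. g1 x * indicator (- K 0) x * indicator {a..b} x \<partial>lborel) < \<infinity>"
        using fin by (rule le_less_trans)
    qed measurable
    also have "\<dots> = R"
      unfolding R_def
    proof (intro nn_integral_cong)
      fix x
      show "(INF n. g1 x * indicator (- K n) x * indicator {a..b} x) = g1 x * indicator (- U) x * indicator {a..b} x"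
      proof (cases "x \<in> U")
        case True
        then obtain n where "x \<in> K n" using K_ex by blast
        then have "(INF n. g1 x * indicator (- K n) x * indicator {a..b} x) \<le> 0"
          by (intro INF_lower2[of n]) auto
        then show ?thesis using True by simp
      next
        case False
        then have "x \<notin> K n" for n using KO by blast
        then show ?thesis using False by simp
      qed
    qed
    finally show ?thesis .
  qed
  have "ennreal \<bar>f a - f b\<bar> \<le> (INF n. (\<integral>\<^sup>+x. g2 x * indicator U x * indicator {a..b} x \<partial>lborel)
      + (\<integral>\<^sup>+x. g1 x * indicator (- K n) x * indicator {a..b} x \<partial>lborel))"
  proof (rule INF_greatest)
    fix n
    show "ennreal \<bar>f a - f b\<bar> \<le> (\<integral>\<^sup>+x. g2 x * indicator U x * indicator {a..b} x \<partial>lborel)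
      + (\<integral>\<^sup>+x. g1 x * indicator (- K n) x * indicator {a..b} x \<partial>lborel)"
      using *[of n] by (subst nn_integral_add[symmetric]) (auto simp: G_def distrib_right)
  qed
  also have "\<dots> = (\<integral>\<^sup>+x. g2 x * indicator U x * indicator {a..b} x \<partial>lborel) + R"
    unfolding lim[symmetric] by (rule INF_ennreal_const_add)
  also have "\<dots> = (\<integral>\<^sup>+x\<in>{a..b}. (if x \<in> U then g2 x else g1 x) \<partial>lborel)"
    unfolding R_def by (subst nn_integral_add[symmetric]) (auto intro!: nn_integral_cong split: split_indicator)
  finally show ?thesis .
qed

text \<open>
  By outer regularity there are open sets that contain \<open>{x. g2 x < g1 x}\<close> and on which \<open>g2\<close> has
  almost the same integral; \<open>variation_bound_open\<close> applies to each of them.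
\<close>

lemma variation_bound_min:
  fixes g1 g2 :: "real \<Rightarrow> ennreal"
  assumes [measurable]: "g1 \<in> borel_measurable borel" "g2 \<in> borel_measurable borel"
    and "a \<le> b"
    and f1: "variation_bound f g1 {a..b}" and f2: "variation_bound f g2 {a..b}"
    and fin1: "interval_integral a b g1 < \<infinity>" and fin2: "interval_integral a b g2 < \<infinity>"
  shows "ennreal \<bar>f a - f b\<bar> \<le> (\<integral>\<^sup>+x\<in>{a..b}. min (g1 x) (g2 x) \<partial>lborel)"
proof -
  define E where "E = {x. g2 x < g1 x}"
  have [measurable]: "E \<in> sets borel" unfolding E_def by measurable
  define N where "N = density lborel (\<lambda>x. g2 x * indicator {a..b} x)"
  have N: "emeasure N A = (\<integral>\<^sup>+x. g2 x * indicator A x * indicator {a..b} x \<partial>lborel)" if [measurable]: "A \<in> sets borel" for A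
    unfolding N_def by (subst emeasure_density) (auto simp: mult_ac)
  have reg: "emeasure N E = (INF V\<in>{V. E \<subseteq> V \<and> open V}. emeasure N V)"
    using fin2 N[of UNIV] by (intro outer_regular) (auto simp: N_def)
  define R where "R = (\<integral>\<^sup>+x. g1 x * indicator (- E) x * indicator {a..b} x \<partial>lborel)"
  have "ennreal \<bar>f a - f b\<bar> \<le> R + emeasure N V" if "E \<subseteq> V" "open V" for V
  proof -
    have [measurable]: "V \<in> sets borel" using that(2) by (rule borel_open)
    have "variation_bound f g2 ({a..b} \<inter> V)" using f2 by (auto simp: variation_bound_def)
    then have "ennreal \<bar>f a - f b\<bar> \<le> (\<integral>\<^sup>+x\<in>{a..b}. (if x \<in> V then g2 x else g1 x) \<partial>lborel)"
      using f1 fin1 that \<open>a \<le> b\<close> by (intro variation_bound_open) auto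
    also have "\<dots> \<le> (\<integral>\<^sup>+x. g1 x * indicator (- E) x * indicator {a..b} x + g2 x * indicator V x * indicator {a..b} x \<partial>lborel)"
      using that(1) by (intro nn_integral_mono) (auto split: split_indicator)
    also have "\<dots> = R + emeasure N V"
      unfolding R_def by (subst N) (auto intro!: nn_integral_add)
    finally show ?thesis .
  qed
  note le = this
  have "emeasure N ` {V. E \<subseteq> V \<and> open V} \<noteq> {}" by blast
  from ennreal_Inf_countable_INF[OF this] obtain e :: "nat \<Rightarrow> ennreal"
    where e: "range e \<subseteq> emeasure N ` {V. E \<subseteq> V \<and> open V}" "emeasure N E = (INF n. e n)"
    unfolding reg by blast
  have "ennreal \<bar>f a - f b\<bar> \<le> (INF n. R + e n)"
  proof (rule INF_greatest)
    fix n
    obtain V where "E \<subseteq> V" "open V" "e n = emeasure N V" using e(1) by blast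
    then show "ennreal \<bar>f a - f b\<bar> \<le> R + e n" using le by simp
  qed
  also have "\<dots> = R + emeasure N E"
    unfolding e(2) by (rule INF_ennreal_const_add)
  also have "\<dots> = (\<integral>\<^sup>+x\<in>{a..b}. min (g1 x) (g2 x) \<partial>lborel)"
    unfolding R_def
    by (subst N) (auto simp: E_def min_def nn_integral_add[symmetric] intro!: nn_integral_cong split: split_indicator)
  finally show ?thesis .
qed

text \<open>
  If \<open>f\<close> has zeros between \<open>s\<close> and \<open>t\<close>, only the parts before the first and after the last zero
  contribute to the increment, and there \<open>f\<close> does not vanish.
\<close>

lemma variation_bound_nonzero:
  fixes g :: "real \<Rightarrow> ennreal"
  assumes [measurable]: "g \<in> borel_measurable borel"
    and cont: "continuous_on {a..b} f" and f: "variation_bound f g {a..b}"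
  shows "variation_bound f (\<lambda>x. g x * indicator {x. f x \<noteq> 0} x) {a..b}"
  unfolding variation_bound_def
proof (intro allI impI, elim conjE)
  fix s t assume st: "s \<le> t" "{s..t} \<subseteq> {a..b}"
  define Z where "Z = {x\<in>{s..t}. f x = 0}"
  show "ennreal \<bar>f s - f t\<bar> \<le> (\<integral>\<^sup>+x\<in>{s..t}. g x * indicator {x. f x \<noteq> 0} x \<partial>lborel)"
  proof (cases "Z = {}")
    case True
    have "ennreal \<bar>f s - f t\<bar> \<le> interval_integral s t g"
      using f st by (intro variation_boundD) auto
    also have "\<dots> = (\<integral>\<^sup>+x\<in>{s..t}. g x * indicator {x. f x \<noteq> 0} x \<partial>lborel)"
      using True by (intro nn_integral_cong) (auto simp: Z_def split: split_indicator)
    finally show ?thesis .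
  next
    case False
    have "compact Z"
    proof -
      have "closed Z"
        unfolding Z_def using continuous_on_subset[OF cont st(2)]
        by (intro continuous_closed_preimage_constant) auto
      moreover have "bounded Z" by (rule bounded_subset[OF bounded_closed_interval[of s t]]) (auto simp: Z_def)
      ultimately show ?thesis by (simp add: compact_eq_bounded_closed)
    qed
    then obtain c d where c: "c \<in> Z" "\<And>x. x \<in> Z \<Longrightarrow> c \<le> x" and d: "d \<in> Z" "\<And>x. x \<in> Z \<Longrightarrow> x \<le> d"
      using compact_attains_inf[of Z] compact_attains_sup[of Z] False by metis
    have cd: "s \<le> c" "c \<le> d" "d \<le> t" "f c = 0" "f d = 0"
      using c d by (auto simp: Z_def)
    have "ennreal \<bar>f s - f t\<bar> \<le> ennreal \<bar>f s - f c\<bar> + ennreal \<bar>f d - f t\<bar>"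
      using cd by (simp flip: ennreal_plus)
    also have "\<dots> \<le> interval_integral s c g + interval_integral d t g"
      using cd st by (intro add_mono variation_boundD[OF f]) auto
    also have "\<dots> = (\<integral>\<^sup>+x. g x * indicator {s..c} x + g x * indicator {d..t} x \<partial>lborel)"
      by (intro nn_integral_add[symmetric]) auto
    also have "\<dots> \<le> (\<integral>\<^sup>+x\<in>{s..t}. g x * indicator {x. f x \<noteq> 0} x \<partial>lborel)"
    proof (intro nn_integral_mono_AE, use AE_lborel_singleton[of c] AE_lborel_singleton[of d] in eventually_elim)
      fix x assume x: "x \<noteq> c" "x \<noteq> d"
      have "f x \<noteq> 0" if "x \<in> {s..c} \<or> x \<in> {d..t}"
      proof
        assume "f x = 0"
        then have "x \<in> Z" using that cd by (auto simp: Z_def)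
        then show False using c(2)[of x] d(2)[of x] x that by auto
      qed
      then show "g x * indicator {s..c} x + g x * indicator {d..t} x \<le> g x * indicator {x. f x \<noteq> 0} x * indicator {s..t} x"
        using cd x by (auto split: split_indicator)
    qed
    finally show ?thesis .
  qed
qed

lemma variation_bound_continuous:
  fixes g :: "real \<Rightarrow> ennreal"
  assumes [measurable]: "g \<in> borel_measurable borel"
    and f: "variation_bound f g {a..b}" and fin: "interval_integral a b g < \<infinity>"
  shows "continuous_on {a..b} f"
  unfolding continuous_on_sequentially
proof (intro allI ballI impI, elim conjE)
  fix X s assume s: "s \<in> {a..b}" and X: "\<forall>n. X n \<in> {a..b}" "X \<longlonglongrightarrow> s"
  define J where "J n = {min s (X n)..max s (X n)}" for n
  have le: "ennreal \<bar>f (X n) - f s\<bar> \<le> (\<integral>\<^sup>+x\<in>J n. g x \<partial>lborel)" for n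
    using variation_boundD[OF f, of "min s (X n)" "max s (X n)"] s X(1)
    by (auto simp: J_def min_def max_def abs_minus_commute split: if_splits)
  have "(\<lambda>n. \<integral>\<^sup>+x. g x * indicator {a..b} x * indicator (J n) x \<partial>lborel) \<longlonglongrightarrow> (\<integral>\<^sup>+x. 0 \<partial>(lborel :: real measure))"
  proof (rule nn_integral_dominated_convergence[where w = "\<lambda>x. g x * indicator {a..b} x"])
    show "AE x in lborel. (\<lambda>n. g x * indicator {a..b} x * indicator (J n) x) \<longlonglongrightarrow> 0"
      using AE_lborel_singleton[of s]
    proof eventually_elim
      case (elim x)
      have "\<forall>\<^sub>F n in sequentially. \<bar>X n - s\<bar> < \<bar>x - s\<bar>"
        using X(2) elim by (auto simp: tendsto_iff dist_real_def dest: spec[of _ "\<bar>x - s\<bar>"])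
      then have "\<forall>\<^sub>F n in sequentially. g x * indicator {a..b} x * indicator (J n) x = 0"
        by eventually_elim (auto simp: J_def split: split_indicator)
      then show ?case by (rule tendsto_eventually)
    qed
    show "AE x in lborel. g x * indicator {a..b} x * indicator (J n) x \<le> g x * indicator {a..b} x" for n
      by (auto split: split_indicator)
  qed (use fin in \<open>auto simp: J_def\<close>)
  also have "(\<lambda>n. \<integral>\<^sup>+x. g x * indicator {a..b} x * indicator (J n) x \<partial>lborel) = (\<lambda>n. \<integral>\<^sup>+x\<in>J n. g x \<partial>lborel)"
  proof (intro ext nn_integral_cong)
    fix n x
    have "J n \<subseteq> {a..b}" using s X(1) by (auto simp: J_def min_def max_def)
    then show "g x * indicator {a..b} x * indicator (J n) x = g x * indicator (J n) x"
      by (auto split: split_indicator)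
  qed
  finally have lim: "(\<lambda>n. \<integral>\<^sup>+x\<in>J n. g x \<partial>lborel) \<longlonglongrightarrow> ennreal 0" by simp
  have "(\<lambda>n. ennreal \<bar>f (X n) - f s\<bar>) \<longlonglongrightarrow> ennreal 0"
    by (rule tendsto_sandwich[OF _ _ tendsto_const lim]) (auto intro!: always_eventually le)
  then have "(\<lambda>n. \<bar>f (X n) - f s\<bar>) \<longlonglongrightarrow> 0"
    by (subst (asm) tendsto_ennreal_iff) auto
  then show "(f \<circ> X) \<longlonglongrightarrow> f s"
    by (simp add: o_def LIM_zero_iff tendsto_rabs_zero_iff)
qed

text \<open>
  The one-dimensional core of harmonicity.  Here \<open>\<sigma> * t\<close> is the candidate on a line, \<open>f\<close> is a
  perturbation vanishing at both ends, and \<open>g\<close> is an upper gradient of their sum where \<open>f\<close> is not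
  zero.  Where \<open>f\<close> vanishes, \<open>1\<close> is an upper gradient of the sum, by \<open>variation_bound_nonzero\<close>.  The
  total increment is \<open>\<plusminus>(b - a)\<close>, and the zero set accounts for at most its own length.
\<close>

lemma length_le_integral_nonzero:
  fixes g h :: "real \<Rightarrow> ennreal"
  assumes [measurable]: "g \<in> borel_measurable borel" "h \<in> borel_measurable borel"
    and "a \<le> b" and cont: "continuous_on {a..b} f" and f: "variation_bound f h {a..b}"
    and fin: "interval_integral a b h < \<infinity>" and ends: "f a = 0" "f b = 0"
    and \<sigma>: "\<bar>\<sigma>\<bar> = 1"
    and g: "variation_bound (\<lambda>t. \<sigma> * t + f t) g {t\<in>{a..b}. f t \<noteq> 0}"
  shows "(\<integral>\<^sup>+x. indicator {t\<in>{a..b}. f t \<noteq> 0} x \<partial>lborel) \<le> (\<integral>\<^sup>+x\<in>{t\<in>{a..b}. f t \<noteq> 0}. g x \<partial>lborel)"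
proof -
  define V where "V = {t\<in>{a..b}. f t \<noteq> 0}"
  have V: "V = {a<..<b} \<inter> f -` (- {0})"
    using ends by (auto simp: V_def order.order_iff_strict)
  have "continuous_on {a<..<b} f"
    by (rule continuous_on_subset[OF cont]) auto
  then have "open V"
    unfolding V
    by (intro continuous_open_preimage) auto
  then have [measurable]: "V \<in> sets borel" by (rule borel_open)
  define h1 where "h1 x = 1 + h x * indicator V x" for x
  have [measurable]: "h1 \<in> borel_measurable borel" unfolding h1_def by measurable
  have len: "(\<integral>\<^sup>+x\<in>{s..t}. 1 \<partial>lborel) = ennreal (t - s)" if "s \<le> t" for s t :: real
    using that by simp
  have f': "variation_bound (\<lambda>t. \<sigma> * t + f t) h1 {a..b}"
    unfolding variation_bound_def
  proof (intro allI impI, elim conjE)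
    fix s t assume st: "s \<le> t" "{s..t} \<subseteq> {a..b}"
    have "\<bar>\<sigma> * s + f s - (\<sigma> * t + f t)\<bar> \<le> \<bar>\<sigma> * (t - s)\<bar> + \<bar>f s - f t\<bar>"
      by (simp add: algebra_simps)
    then have "ennreal \<bar>\<sigma> * s + f s - (\<sigma> * t + f t)\<bar> \<le> ennreal (t - s) + ennreal \<bar>f s - f t\<bar>"
      using st \<sigma> by (simp add: abs_mult flip: ennreal_plus)
    also have "\<dots> \<le> (\<integral>\<^sup>+x\<in>{s..t}. 1 \<partial>lborel) + (\<integral>\<^sup>+x\<in>{s..t}. h x * indicator {x. f x \<noteq> 0} x \<partial>lborel)"
      using st variation_bound_nonzero[OF _ cont f] by (intro add_mono variation_boundD) (auto simp: len)
    also have "\<dots> = (\<integral>\<^sup>+x\<in>{s..t}. 1 \<partial>lborel) + (\<integral>\<^sup>+x\<in>{s..t}. h x * indicator V x \<partial>lborel)"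
      using st by (intro arg_cong2[where f = "(+)"] nn_integral_cong refl) (auto simp: V_def split: split_indicator)
    also have "\<dots> = interval_integral s t h1"
      by (subst nn_integral_add[symmetric]) (auto simp: h1_def distrib_right)
    finally show "ennreal \<bar>\<sigma> * s + f s - (\<sigma> * t + f t)\<bar> \<le> interval_integral s t h1" .
  qed
  have "interval_integral a b h1 \<le> (\<integral>\<^sup>+x\<in>{a..b}. 1 \<partial>lborel) + interval_integral a b h"
    by (subst nn_integral_add[symmetric]) (auto simp: h1_def intro!: nn_integral_mono split: split_indicator)
  also have "\<dots> < \<infinity>" using fin \<open>a \<le> b\<close> by (simp add: len)
  finally have fin': "interval_integral a b h1 < \<infinity>" .
  have Vab: "V \<subseteq> {a..b}" and "{a..b} \<inter> V = V" by (auto simp: V_def)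
  have "(\<integral>\<^sup>+x. indicator V x \<partial>lborel) + (\<integral>\<^sup>+x. indicator ({a..b} - V) x \<partial>lborel) = (\<integral>\<^sup>+x. indicator {a..b} x \<partial>lborel)"
    using Vab by (subst nn_integral_add[symmetric])
      (auto simp del: nn_integral_indicator intro!: nn_integral_cong split: split_indicator)
  also have "\<dots> = ennreal \<bar>\<sigma> * a + f a - (\<sigma> * b + f b)\<bar>"
    using ends \<sigma> \<open>a \<le> b\<close> by (simp add: abs_mult flip: right_diff_distrib)
  also have "\<dots> \<le> (\<integral>\<^sup>+x\<in>{a..b}. (if x \<in> V then g x else h1 x) \<partial>lborel)"
    using f' g fin' \<open>open V\<close> \<open>a \<le> b\<close> \<open>{a..b} \<inter> V = V\<close>
    by (intro variation_bound_open[where f = "\<lambda>t. \<sigma> * t + f t"]) (auto simp: V_def)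
  also have "\<dots> = (\<integral>\<^sup>+x\<in>V. g x \<partial>lborel) + (\<integral>\<^sup>+x. indicator ({a..b} - V) x \<partial>lborel)"
    using Vab by (subst nn_integral_add[symmetric])
      (auto simp: h1_def simp del: nn_integral_indicator intro!: nn_integral_cong split: split_indicator)
  finally have "(\<integral>\<^sup>+x. indicator V x \<partial>lborel) + (\<integral>\<^sup>+x. indicator ({a..b} - V) x \<partial>lborel)
     \<le> (\<integral>\<^sup>+x\<in>V. g x \<partial>lborel) + (\<integral>\<^sup>+x. indicator ({a..b} - V) x \<partial>lborel)" .
  moreover have "(\<integral>\<^sup>+x. indicator ({a..b} - V) x \<partial>lborel) < \<infinity>"
  proof -
    have "(\<integral>\<^sup>+x. indicator ({a..b} - V) x \<partial>lborel) \<le> (\<integral>\<^sup>+x. indicator {a..b} x \<partial>lborel)"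
      by (intro nn_integral_mono) (auto split: split_indicator)
    also have "\<dots> < \<infinity>" using \<open>a \<le> b\<close> by simp
    finally show ?thesis .
  qed
  ultimately show ?thesis
    unfolding V_def[symmetric] by (metis add.commute ennreal_add_left_cancel_le less_irrefl)
qed


section \<open>Length of curves\<close>

text \<open>The sum that occurs in \<open>curve_length\<close>, in a form suited to induction on the list of times.\<close>

definition polygon_length :: "'a metric \<Rightarrow> (real \<Rightarrow> 'a) \<Rightarrow> real list \<Rightarrow> ennreal" where
  "polygon_length m \<gamma> ts = (\<Sum>i<length ts - 1. ennreal (mdist m (\<gamma> (ts ! i)) (\<gamma> (ts ! Suc i))))"

lemma polygon_length_Nil [simp]: "polygon_length m \<gamma> [] = 0"
  by (simp add: polygon_length_def)

lemma polygon_length_single [simp]: "polygon_length m \<gamma> [t] = 0"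
  by (simp add: polygon_length_def)

lemma polygon_length_Cons [simp]:
  "polygon_length m \<gamma> (s # t # ts) = ennreal (mdist m (\<gamma> s) (\<gamma> t)) + polygon_length m \<gamma> (t # ts)"
  by (simp add: polygon_length_def sum.lessThan_Suc_shift del: sum.lessThan_Suc sum_ennreal)

lemma polygon_length_append:
  "polygon_length m \<gamma> (xs @ t # ys) = polygon_length m \<gamma> (xs @ [t]) + polygon_length m \<gamma> (t # ys)"
proof (induction xs)
  case (Cons x xs)
  then show ?case by (cases xs) (auto simp: add.assoc)
qed simp

lemma polygon_length_append_ge:
  "polygon_length m \<gamma> xs + polygon_length m \<gamma> ys \<le> polygon_length m \<gamma> (xs @ ys)"
proof (induction xs)
  case (Cons x xs)
  show ?case
  proof (cases xs)
    case Nil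
    then show ?thesis by (cases ys) auto
  next
    case (Cons z zs)
    then show ?thesis using Cons.IH by (auto simp: add.assoc intro: add_left_mono)
  qed
qed simp

lemma polygon_length_insert:
  assumes "\<gamma> ` (set (xs @ t # ys)) \<subseteq> mspace m"
  shows "polygon_length m \<gamma> (xs @ ys) \<le> polygon_length m \<gamma> (xs @ [t]) + polygon_length m \<gamma> (t # ys)"
  using assms
proof (induction xs)
  case Nil
  then show ?case by (cases ys) auto
next
  case (Cons x xs)
  interpret Metric_space "mspace m" "mdist m" by (rule Metric_space_mspace_mdist)
  show ?case
  proof (cases xs)
    case Nil
    show ?thesis
    proof (cases ys)
      case (Cons y zs)
      have "mdist m (\<gamma> x) (\<gamma> y) \<le> mdist m (\<gamma> x) (\<gamma> t) + mdist m (\<gamma> t) (\<gamma> y)"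
        using Cons.prems Nil Cons by (intro triangle) auto
      then show ?thesis using Nil Cons
        by (auto simp: add.assoc[symmetric] simp flip: ennreal_plus intro!: add_right_mono)
    qed (use Nil in auto)
  next
    case (Cons z zs)
    then show ?thesis using Cons.IH Cons.prems by (auto simp: add.assoc intro: add_left_mono)
  qed
qed

lemma curve_length_alt:
  "curve_length m \<gamma> a b = (SUP ts\<in>{ts. sorted ts \<and> set ts \<subseteq> {a..b}}. polygon_length m \<gamma> ts)"
  by (simp add: curve_length_def polygon_length_def)

lemma polygon_length_le_curve_length:
  "sorted ts \<Longrightarrow> set ts \<subseteq> {a..b} \<Longrightarrow> polygon_length m \<gamma> ts \<le> curve_length m \<gamma> a b"
  unfolding curve_length_alt by (rule SUP_upper) auto

lemma mdist_le_curve_length: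
  "a \<le> b \<Longrightarrow> ennreal (mdist m (\<gamma> a) (\<gamma> b)) \<le> curve_length m \<gamma> a b"
  using polygon_length_le_curve_length[of "[a, b]"] by auto

lemma curve_length_superadditive:
  "curve_length m \<gamma> a s + curve_length m \<gamma> s b \<le> curve_length m \<gamma> a b"
  if "a \<le> s" "s \<le> b"
proof -
  have *: "polygon_length m \<gamma> xs + polygon_length m \<gamma> ys \<le> curve_length m \<gamma> a b"
    if "sorted xs" "set xs \<subseteq> {a..s}" "sorted ys" "set ys \<subseteq> {s..b}" for xs ys
    using that \<open>a \<le> s\<close> \<open>s \<le> b\<close>
    by (intro order_trans[OF polygon_length_append_ge] polygon_length_le_curve_length)
      (force simp: sorted_append)+
  have ne: "{ts. sorted ts \<and> set ts \<subseteq> {a..b}} \<noteq> {}" for a b :: real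
    by (auto intro!: exI[of _ "[]"])
  have "curve_length m \<gamma> a s + polygon_length m \<gamma> ys \<le> curve_length m \<gamma> a b"
    if "sorted ys" "set ys \<subseteq> {s..b}" for ys
    unfolding curve_length_alt[of _ _ a s]
    by (subst ennreal_SUP_add_left[OF ne, symmetric]) (auto intro!: SUP_least * that)
  then show ?thesis
    unfolding curve_length_alt[of _ _ s b]
    by (subst ennreal_SUP_add_right[OF ne]) (auto intro!: SUP_least)
qed

lemma curve_length_subadditive:
  assumes "a \<le> s" "s \<le> b" and \<gamma>: "\<gamma> ` {a..b} \<subseteq> mspace m"
  shows "curve_length m \<gamma> a b \<le> curve_length m \<gamma> a s + curve_length m \<gamma> s b"
  unfolding curve_length_alt[of _ _ a b]
proof (rule SUP_least, clarify)
  fix ts assume ts: "sorted ts" "set ts \<subseteq> {a..b}"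
  define xs ys where "xs = takeWhile (\<lambda>t. t \<le> s) ts" and "ys = dropWhile (\<lambda>t. t \<le> s) ts"
  have eq: "ts = xs @ ys" by (simp add: xs_def ys_def)
  have sorted: "sorted xs" "sorted ys" using ts(1) unfolding eq by (auto simp: sorted_append)
  have xs: "t \<le> s" if "t \<in> set xs" for t
    using that by (auto simp: xs_def dest: set_takeWhileD)
  have ys: "s \<le> t" if "t \<in> set ys" for t
  proof (cases ys)
    case (Cons y zs)
    then have "\<not> y \<le> s" unfolding ys_def by (metis dropWhile_eq_Cons_conv)
    then show ?thesis using that sorted(2) Cons by auto
  qed (use that in auto)
  have "polygon_length m \<gamma> ts \<le> polygon_length m \<gamma> (xs @ [s]) + polygon_length m \<gamma> (s # ys)"
    unfolding eq using ts(2) assms eq by (intro polygon_length_insert) auto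
  also have "\<dots> \<le> curve_length m \<gamma> a s + curve_length m \<gamma> s b"
    using ts(2) sorted xs ys assms eq
    by (intro add_mono polygon_length_le_curve_length) (auto simp: sorted_append)
  finally show "polygon_length m \<gamma> ts \<le> curve_length m \<gamma> a s + curve_length m \<gamma> s b" .
qed

lemma curve_length_shift:
  "curve_length m (\<lambda>t. \<gamma> (c + t)) a b = curve_length m \<gamma> (c + a) (c + b)"
proof -
  have shift: "polygon_length m (\<lambda>t. \<gamma> (c + t)) ts = polygon_length m \<gamma> (map ((+) c) ts)" for c ts and \<gamma> :: "real \<Rightarrow> 'a"
    by (induction ts rule: induct_list012) auto
  have le: "curve_length m (\<lambda>t. \<gamma> (c + t)) a b \<le> curve_length m \<gamma> (c + a) (c + b)" for c a b and \<gamma> :: "real \<Rightarrow> 'a"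
    unfolding curve_length_alt[of _ _ a b]
  proof (rule SUP_least, clarify)
    fix ts assume "sorted ts" "set ts \<subseteq> {a..b}"
    then have "sorted (map ((+) c) ts)" "set (map ((+) c) ts) \<subseteq> {c + a..c + b}"
      by (auto simp: sorted_map)
    then show "polygon_length m (\<lambda>t. \<gamma> (c + t)) ts \<le> curve_length m \<gamma> (c + a) (c + b)"
      unfolding shift by (rule polygon_length_le_curve_length)
  qed
  show ?thesis
    using le[of \<gamma> c a b] le[of "\<lambda>t. \<gamma> (c + t)" "- c" "c + a" "c + b"] by (simp add: algebra_simps)
qed


section \<open>Rectifiable curves\<close>

lemma rect_curvesD:
  assumes "(l, \<gamma>) \<in> rect_curves m"
  shows "0 < l" "\<And>t. t \<in> {0..l} \<Longrightarrow> \<gamma> t \<in> mspace m"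
    "continuous_map (top_of_set {0..l}) (mtopology_of m) \<gamma>"
    "\<And>t. t \<in> {0..l} \<Longrightarrow> curve_length m \<gamma> 0 t = ennreal t"
  using assms continuous_map_funspace[of "top_of_set {0..l}" "mtopology_of m" \<gamma>]
  by (auto simp: rect_curves_def)

lemma rect_curves_submetric:
  assumes "c \<in> rect_curves (submetric m S)"
  shows "c \<in> rect_curves m"
  using assms
  by (auto simp: rect_curves_def curve_length_def mtopology_of_submetric continuous_map_in_subtopology)

text \<open>Length is additive, so a parametrization by arc length remains one on every subinterval.\<close>

lemma rect_curve_length:
  assumes "(l, \<gamma>) \<in> rect_curves m" "0 \<le> s" "s \<le> t" "t \<le> l"
  shows "curve_length m \<gamma> s t = ennreal (t - s)"
proof -
  note c = rect_curvesD[OF assms(1)]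
  have 1: "curve_length m \<gamma> 0 s = ennreal s" "curve_length m \<gamma> 0 t = ennreal s + ennreal (t - s)"
    using c(4)[of s] c(4)[of t] assms by (simp_all flip: ennreal_plus)
  have "\<gamma> ` {0..t} \<subseteq> mspace m" using c(2) assms by auto
  then have "ennreal s + curve_length m \<gamma> s t = ennreal s + ennreal (t - s)"
    using curve_length_superadditive[of 0 s t m \<gamma>] curve_length_subadditive[of 0 s t \<gamma> m] assms 1
    by (simp add: order_antisym)
  then show ?thesis
    by (simp add: ennreal_add_left_cancel)
qed

lemma rect_curve_Lipschitz:
  assumes "(l, \<gamma>) \<in> rect_curves m" "0 \<le> s" "s \<le> t" "t \<le> l"
  shows "mdist m (\<gamma> s) (\<gamma> t) \<le> t - s"
  using mdist_le_curve_length[of s t m \<gamma>] rect_curve_length[OF assms] assms by simp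

lemma rect_curve_subcurve:
  assumes "(l, \<gamma>) \<in> rect_curves m" "0 \<le> s" "s < t" "t \<le> l"
  shows "(t - s, \<lambda>r. \<gamma> (s + r)) \<in> rect_curves m"
proof -
  have "continuous_map (top_of_set {0..t - s}) (mtopology_of m) (\<gamma> \<circ> (\<lambda>r. s + r))"
    by (rule continuous_map_compose[OF _ rect_curvesD(3)[OF assms(1)]])
      (use assms in \<open>auto intro!: continuous_intros\<close>)
  moreover have "curve_length m (\<lambda>r. \<gamma> (s + r)) 0 r = ennreal r" if "r \<in> {0..t - s}" for r
    using rect_curve_length[OF assms(1), of s "s + r"] that assms by (simp add: curve_length_shift)
  ultimately show ?thesis
    using assms by (simp add: rect_curves_def o_def)
qed

text \<open>Along a shortest path the sums that define the length telescope.\<close>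

lemma geodesic_rect_curve:
  assumes "0 < l" and "\<And>t. t \<in> {0..l} \<Longrightarrow> \<gamma> t \<in> mspace m"
    and "\<And>s t. 0 \<le> s \<Longrightarrow> s \<le> t \<Longrightarrow> t \<le> l \<Longrightarrow> mdist m (\<gamma> s) (\<gamma> t) = t - s"
    and "continuous_map (top_of_set {0..l}) (mtopology_of m) \<gamma>"
  shows "(l, \<gamma>) \<in> rect_curves m"
proof -
  have *: "polygon_length m \<gamma> (x # ts) = ennreal (last (x # ts) - x)"
    if "sorted (x # ts)" "set (x # ts) \<subseteq> {0..l}" for x ts
    using that
  proof (induction ts arbitrary: x)
    case (Cons y ts)
    have "y \<le> last (y # ts)" using Cons.prems by (auto simp: last_in_set)
    moreover have "polygon_length m \<gamma> (y # ts) = ennreal (last (y # ts) - y)"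
      using Cons.prems by (intro Cons.IH) auto
    ultimately show ?case using assms(3)[of x y] Cons.prems
      by (simp flip: ennreal_plus del: last.simps add: last_ConsR)
  qed simp
  have "curve_length m \<gamma> 0 t = ennreal t" if t: "t \<in> {0..l}" for t
  proof (rule antisym)
    show "curve_length m \<gamma> 0 t \<le> ennreal t"
      unfolding curve_length_alt
    proof (rule SUP_least, clarify)
      fix ts assume ts: "sorted ts" "set ts \<subseteq> {0..t}"
      show "polygon_length m \<gamma> ts \<le> ennreal t"
      proof (cases ts)
        case (Cons x xs)
        have "last ts \<in> set ts" "x \<in> set ts" using Cons by auto
        then have "last (x # xs) \<le> t" "0 \<le> x" "set (x # xs) \<subseteq> {0..l}" "sorted (x # xs)"
          using ts t Cons by auto
        then show ?thesis using *[of x xs] Cons by (auto intro!: ennreal_leI simp del: last.simps)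
      qed auto
    qed
    show "ennreal t \<le> curve_length m \<gamma> 0 t"
      using mdist_le_curve_length[of 0 t m \<gamma>] assms(3)[of 0 t] t by simp
  qed
  then show ?thesis using assms by (simp add: rect_curves_def)
qed


section \<open>Weak upper gradients and their minimal element\<close>

lemma curve_integral_eq:
  "curve_integral (l, \<gamma>) g = (\<integral>\<^sup>+t\<in>{0..l}. g (\<gamma> t) \<partial>lborel)"
  by (simp add: curve_integral_def nn_integral_completion)

lemma curve_integral_mono:
  "(\<And>x. x \<in> \<gamma> ` {0..l} \<Longrightarrow> g x \<le> h x) \<Longrightarrow> curve_integral (l, \<gamma>) g \<le> curve_integral (l, \<gamma>) h"
  unfolding curve_integral_eq by (intro nn_integral_mono) (auto split: split_indicator)

lemma ug_inequality_mono:
  "ug_inequality u g c \<Longrightarrow> curve_integral c g \<le> curve_integral c h \<Longrightarrow> ug_inequality u h c"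
  by (auto simp: ug_inequality_def split: prod.splits intro: order_trans)

lemma ug_inequality_finite:
  assumes "ug_inequality u g (l, \<gamma>)" "curve_integral (l, \<gamma>) g < \<infinity>"
  shows "\<bar>u (\<gamma> 0)\<bar> \<noteq> \<infinity>" "\<bar>u (\<gamma> l)\<bar> \<noteq> \<infinity>"
    "ennreal \<bar>real_of_ereal (u (\<gamma> 0)) - real_of_ereal (u (\<gamma> l))\<bar> \<le> curve_integral (l, \<gamma>) g"
proof -
  show 1: "\<bar>u (\<gamma> 0)\<bar> \<noteq> \<infinity>" and 2: "\<bar>u (\<gamma> l)\<bar> \<noteq> \<infinity>"
    using assms by (auto simp: ug_inequality_def top_unique split: if_splits)
  show "ennreal \<bar>real_of_ereal (u (\<gamma> 0)) - real_of_ereal (u (\<gamma> l))\<bar> \<le> curve_integral (l, \<gamma>) g"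
    using assms(1) 1 2 by (cases "u (\<gamma> 0)"; cases "u (\<gamma> l)") (auto simp: ug_inequality_def)
qed

lemma ug_inequalityI:
  assumes "\<bar>u (\<gamma> 0)\<bar> \<noteq> \<infinity>" "\<bar>u (\<gamma> l)\<bar> \<noteq> \<infinity>"
    "ennreal \<bar>real_of_ereal (u (\<gamma> 0)) - real_of_ereal (u (\<gamma> l))\<bar> \<le> curve_integral (l, \<gamma>) g"
  shows "ug_inequality u g (l, \<gamma>)"
  using assms by (cases "u (\<gamma> 0)"; cases "u (\<gamma> l)") (auto simp: ug_inequality_def)

text \<open>
  An open set of Euclidean space with Lebesgue measure and a metric that may differ from the
  Euclidean one but induces the same topology, hence the same Borel sets and continuous curves.
\<close>

locale domain_space =
  fixes m :: "'a::euclidean_space metric" and \<Omega> :: "'a set" and q :: real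
  assumes open_\<Omega>: "open \<Omega>" and mtopology: "mtopology_of m = top_of_set \<Omega>" and q_pos: "0 < q"
begin

abbreviation \<mu> :: "'a measure" where "\<mu> \<equiv> restrict_space lebesgue \<Omega>"

lemma mspace: "mspace m = \<Omega>"
  using arg_cong[OF mtopology, of topspace] by simp

lemma sets_\<Omega> [measurable]: "\<Omega> \<in> sets borel"
  using open_\<Omega> by (rule borel_open)

lemma space_\<mu>: "space \<mu> = \<Omega>"
  by (simp add: space_restrict_space)

lemma sets_metric_borel: "sets (metric_borel m) = sets (restrict_space borel \<Omega>)"
proof -
  have eq: "sets (metric_borel m) = sigma_sets \<Omega> {U. openin (top_of_set \<Omega>) U}"
    unfolding metric_borel_def mspace mtopology by (rule sets_measure_of) (auto dest: openin_imp_subset)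
  have "A \<in> sets borel" if "A \<in> sigma_sets \<Omega> {U. openin (top_of_set \<Omega>) U}" for A
    using that
  proof induction
    case (Basic a)
    then show ?case using open_\<Omega> by (auto simp: openin_open_eq)
  qed auto
  moreover have "A \<inter> \<Omega> \<in> sigma_sets \<Omega> {U. openin (top_of_set \<Omega>) U}" if "A \<in> sigma_sets UNIV {S. open S}" for A
    using that
  proof induction
    case (Basic a)
    then show ?case by (intro sigma_sets.Basic) (auto simp: openin_open)
  next
    case (Compl a)
    have "(UNIV - a) \<inter> \<Omega> = \<Omega> - (a \<inter> \<Omega>)" by auto
    then show ?case using Compl by (metis sigma_sets.Compl)
  next
    case (Union a)
    have "\<Union> (range a) \<inter> \<Omega> = (\<Union>i. a i \<inter> \<Omega>)" by auto
    then show ?case using Union by (metis sigma_sets.Union)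
  qed (simp add: sigma_sets.Empty)
  moreover have "A \<subseteq> \<Omega>" if "A \<in> sigma_sets \<Omega> {U. openin (top_of_set \<Omega>) U}" for A
    using sigma_sets_into_sp[OF _ that] by (auto dest: openin_imp_subset)
  ultimately show ?thesis
    unfolding eq by (auto simp: sets_restrict_space_iff sets_borel[symmetric] Int_absorb2)
      (metis Int_absorb2 sets_borel)+
qed

lemma borel_iff:
  fixes g :: "'a \<Rightarrow> ennreal"
  shows "g \<in> borel_measurable (metric_borel m) \<longleftrightarrow> (\<lambda>x. g x * indicator \<Omega> x) \<in> borel_measurable borel"
  by (simp add: borel_measurable_restrict_space_iff_ennreal[symmetric] cong: measurable_cong_sets[OF sets_metric_borel refl])

lemma \<mu>_iff:
  fixes g :: "'a \<Rightarrow> ennreal"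
  shows "g \<in> borel_measurable \<mu> \<longleftrightarrow> (\<lambda>x. g x * indicator \<Omega> x) \<in> borel_measurable lebesgue"
  by (simp add: borel_measurable_restrict_space_iff_ennreal)

lemma borel_imp_\<mu>:
  fixes g :: "'a \<Rightarrow> ennreal"
  shows "g \<in> borel_measurable (metric_borel m) \<Longrightarrow> g \<in> borel_measurable \<mu>"
  unfolding borel_iff \<mu>_iff by (rule measurable_completion) simp

lemma \<mu>_integral: "(\<integral>\<^sup>+x. g x \<partial>\<mu>) = (\<integral>\<^sup>+x\<in>\<Omega>. g x \<partial>lborel)"
  by (simp add: nn_integral_restrict_space nn_integral_completion)

lemma rect_curve_in: "(l, \<gamma>) \<in> rect_curves m \<Longrightarrow> t \<in> {0..l} \<Longrightarrow> \<gamma> t \<in> \<Omega>"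
  using rect_curvesD(2) mspace by blast

lemma rect_curve_continuous: "(l, \<gamma>) \<in> rect_curves m \<Longrightarrow> continuous_on {0..l} \<gamma>"
  using rect_curvesD(3) by (force simp: mtopology continuous_map_in_subtopology)

lemma trace_measurable [measurable]:
  fixes g :: "'a \<Rightarrow> ennreal"
  assumes c: "(l, \<gamma>) \<in> rect_curves m" and g: "g \<in> borel_measurable (metric_borel m)"
  shows "(\<lambda>t. g (\<gamma> t) * indicator {0..l} t) \<in> borel_measurable borel"
proof -
  have [measurable]: "(\<lambda>x. g x * indicator \<Omega> x) \<in> borel_measurable borel"
    using g by (simp add: borel_iff)
  have [measurable]: "(\<lambda>t. indicator {0..l} t *\<^sub>R \<gamma> t) \<in> borel_measurable borel"
    by (intro borel_measurable_continuous_on_indicator rect_curve_continuous[OF c]) auto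
  have "(\<lambda>t. (\<lambda>x. g x * indicator \<Omega> x) (indicator {0..l} t *\<^sub>R \<gamma> t) * indicator {0..l} t) \<in> borel_measurable borel"
    by measurable
  also have "(\<lambda>t. (\<lambda>x. g x * indicator \<Omega> x) (indicator {0..l} t *\<^sub>R \<gamma> t) * indicator {0..l} t)
      = (\<lambda>t. g (\<gamma> t) * indicator {0..l} t)"
    using rect_curve_in[OF c] by (auto simp: fun_eq_iff split: split_indicator)
  finally show ?thesis .
qed

lemma curve_integral_subcurve:
  fixes g :: "'a \<Rightarrow> ennreal"
  assumes c: "(l, \<gamma>) \<in> rect_curves m" and g: "g \<in> borel_measurable (metric_borel m)"
    and st: "0 \<le> s" "s \<le> t" "t \<le> l"
  shows "curve_integral (t - s, \<lambda>r. \<gamma> (s + r)) g = (\<integral>\<^sup>+r\<in>{s..t}. g (\<gamma> r) \<partial>lborel)"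
proof -
  have [measurable]: "(\<lambda>t. g (\<gamma> t) * indicator {0..l} t) \<in> borel_measurable borel"
    using c g by (rule trace_measurable)
  have "(\<integral>\<^sup>+r\<in>{s..t}. g (\<gamma> r) \<partial>lborel) = (\<integral>\<^sup>+r. (g (\<gamma> r) * indicator {0..l} r) * indicator {s..t} r \<partial>lborel)"
    using st by (intro nn_integral_cong) (auto split: split_indicator)
  also have "\<dots> = (\<integral>\<^sup>+r. (g (\<gamma> (s + 1 * r)) * indicator {0..l} (s + 1 * r)) * indicator {s..t} (s + 1 * r) \<partial>lborel)"
    by (subst nn_integral_real_affine[of _ 1 s]) auto
  also have "\<dots> = curve_integral (t - s, \<lambda>r. \<gamma> (s + r)) g"
    unfolding curve_integral_eq using st by (intro nn_integral_cong) (auto split: split_indicator)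
  finally show ?thesis by simp
qed

lemma curve_integral_subcurve_le:
  fixes g :: "'a \<Rightarrow> ennreal"
  assumes "(l, \<gamma>) \<in> rect_curves m" "g \<in> borel_measurable (metric_borel m)" "0 \<le> s" "s \<le> t" "t \<le> l"
  shows "curve_integral (t - s, \<lambda>r. \<gamma> (s + r)) g \<le> curve_integral (l, \<gamma>) g"
  unfolding curve_integral_subcurve[OF assms] unfolding curve_integral_eq
  using assms by (intro nn_integral_mono) (auto split: split_indicator)


subsection \<open>Exceptional families\<close>

text \<open>
  An exceptional family is contained in the family of all curves with infinite integral of some
  such \<open>\<rho>\<close>.  Working with \<open>\<rho>\<close> makes subcurves easy to handle: if a curve is not exceptional for \<open>\<rho>\<close>,
  then none of its subcurves is.
\<close>

definition density_function :: "('a \<Rightarrow> ennreal) \<Rightarrow> bool" where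
  "density_function \<rho> \<longleftrightarrow> \<rho> \<in> borel_measurable (metric_borel m) \<and> energy q \<mu> \<rho> < \<infinity>"

lemma weak_upper_gradient_iff:
  "weak_upper_gradient q m \<mu> u g \<longleftrightarrow> g \<in> borel_measurable \<mu> \<and>
     (\<exists>\<rho>. density_function \<rho> \<and> (\<forall>c\<in>rect_curves m. curve_integral c \<rho> < \<infinity> \<longrightarrow> ug_inequality u g c))"
  (is "?L \<longleftrightarrow> ?R")
proof
  assume ?L
  then obtain \<Gamma> \<rho> where g: "g \<in> borel_measurable \<mu>" and \<rho>: "density_function \<rho>" "\<forall>c\<in>\<Gamma>. curve_integral c \<rho> = \<infinity>"
    and ug: "\<forall>c\<in>rect_curves m - \<Gamma>. ug_inequality u g c"
    by (auto simp: weak_upper_gradient_def zero_modulus_def density_function_def)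
  then have "ug_inequality u g c" if "c \<in> rect_curves m" "curve_integral c \<rho> < \<infinity>" for c
    using that by (metis DiffI less_irrefl)
  then show ?R using g \<rho> by blast
next
  assume ?R
  then obtain \<rho> where g: "g \<in> borel_measurable \<mu>" and \<rho>: "density_function \<rho>"
    and ug: "\<And>c. c\<in>rect_curves m \<Longrightarrow> curve_integral c \<rho> < \<infinity> \<Longrightarrow> ug_inequality u g c" by blast
  have "zero_modulus q m \<mu> {c\<in>rect_curves m. curve_integral c \<rho> = \<infinity>}"
    using \<rho> by (auto simp: zero_modulus_def density_function_def)
  moreover have "\<forall>c\<in>rect_curves m - {c\<in>rect_curves m. curve_integral c \<rho> = \<infinity>}. ug_inequality u g c"
    using ug by (auto simp: less_top)
  ultimately show ?L using g by (auto simp: weak_upper_gradient_def)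
qed

text \<open>
  The weighted sum \<open>\<Sum>i. d i * \<rho> i ^ q\<close> has finite integral for suitable positive weights, and its
  \<open>q\<close>-th root dominates a positive multiple of each \<open>\<rho> i\<close>.  So countably many exceptional families
  are subsumed under a single one.
\<close>

lemma density_function_countable:
  assumes "\<And>i::nat. density_function (\<rho> i)"
  obtains \<rho>' where "density_function \<rho>'"
    "\<And>c i. c \<in> rect_curves m \<Longrightarrow> curve_integral c \<rho>' < \<infinity> \<Longrightarrow> curve_integral c (\<rho> i) < \<infinity>"
proof -
  define I where "I i = (\<integral>\<^sup>+x. ennpowr (\<rho> i x) q \<partial>\<mu>)" for i
  have meas: "\<rho> i \<in> borel_measurable (metric_borel m)" and I_fin: "I i < \<infinity>" for i
    using assms by (auto simp: density_function_def I_def)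
  note [measurable] = meas borel_imp_\<mu>[OF meas]
  \<comment> \<open>The \<open>1\<close> keeps the weight positive and bounded also when \<open>\<rho> i\<close> has zero energy.\<close>
  define d where "d i = (1 / 2) ^ i / (1 + enn2real (I i))" for i
  have d_pos: "0 < d i" for i by (simp add: d_def add_pos_nonneg)
  define \<rho>' where "\<rho>' x = ennpowr (\<Sum>i. ennreal (d i) * ennpowr (\<rho> i x) q) (1 / q)" for x
  have [measurable]: "\<rho>' \<in> borel_measurable (metric_borel m)"
    unfolding \<rho>'_def by measurable
  have "energy q \<mu> \<rho>' = (\<integral>\<^sup>+x. (\<Sum>i. ennreal (d i) * ennpowr (\<rho> i x) q) \<partial>\<mu>)"
    unfolding \<rho>'_def using ennpowr_powr[of "1 / q"] q_pos by simp
  also have "\<dots> = (\<Sum>i. \<integral>\<^sup>+x. ennreal (d i) * ennpowr (\<rho> i x) q \<partial>\<mu>)"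
    by (rule nn_integral_suminf) measurable
  also have "\<dots> = (\<Sum>i. ennreal (d i) * I i)"
    unfolding I_def by (intro suminf_cong nn_integral_cmult) measurable
  also have "\<dots> \<le> (\<Sum>i. ennreal ((1 / 2) ^ i))"
  proof (intro suminf_le allI)
    fix i
    have "ennreal (d i) * I i = ennreal (d i * enn2real (I i))"
      using I_fin[of i] d_pos[of i] by (simp add: ennreal_mult less_imp_le)
    also have "\<dots> \<le> ennreal ((1 / 2) ^ i)"
    proof (rule ennreal_leI)
      have "enn2real (I i) / (1 + enn2real (I i)) \<le> 1"
        by (simp add: add_pos_nonneg)
      then show "d i * enn2real (I i) \<le> (1 / 2) ^ i"
        unfolding d_def using mult_left_mono[of "enn2real (I i) / (1 + enn2real (I i))" 1 "(1 / 2) ^ i"] by simp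
    qed
    finally show "ennreal (d i) * I i \<le> ennreal ((1 / 2) ^ i)" .
  qed auto
  also have "\<dots> = ennreal 2"
    using suminf_geometric[of "1 / 2 :: real"] summable_geometric[of "1 / 2 :: real"]
    by (subst suminf_ennreal2) auto
  also have "\<dots> < \<infinity>" by simp
  finally have "density_function \<rho>'" by (simp add: density_function_def)
  moreover have "curve_integral c (\<rho> i) < \<infinity>" if c: "c \<in> rect_curves m" and fin: "curve_integral c \<rho>' < \<infinity>" for c i
  proof -
    obtain l \<gamma> where lg: "c = (l, \<gamma>)" by (cases c)
    note cc = c[unfolded lg]
    define e where "e = d i powr (1 / q)"
    have e: "0 < e" using d_pos[of i] by (simp add: e_def)
    have "ennreal e * \<rho> i x \<le> \<rho>' x" for x
    proof -
      have "ennreal e * \<rho> i x = ennpowr (ennreal (d i) * ennpowr (\<rho> i x) q) (1 / q)"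
        unfolding e_def ennpowr_mult[OF d_pos] using q_pos by (simp add: ennpowr_powr)
      also have "\<dots> \<le> \<rho>' x"
        unfolding \<rho>'_def using q_pos sum_le_suminf[of "\<lambda>i. ennreal (d i) * ennpowr (\<rho> i x) q" "{i}"]
        by (intro ennpowr_mono) auto
      finally show ?thesis .
    qed
    then have "curve_integral c (\<lambda>x. ennreal e * \<rho> i x) \<le> curve_integral c \<rho>'"
      unfolding lg by (intro curve_integral_mono) auto
    moreover have "curve_integral c (\<lambda>x. ennreal e * \<rho> i x) = ennreal e * curve_integral c (\<rho> i)"
      unfolding lg curve_integral_eq
      using trace_measurable[OF cc meas[of i]]
      by (subst nn_integral_cmult[symmetric]) (auto simp: mult.assoc)
    ultimately have "ennreal e * curve_integral c (\<rho> i) < \<infinity>" using fin by (simp add: le_less_trans)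
    then show ?thesis using e by (auto simp: ennreal_mult_less_top)
  qed
  ultimately show ?thesis using that by blast
qed

lemma density_function_two:
  assumes "density_function \<rho>1" "density_function \<rho>2"
  obtains \<rho> where "density_function \<rho>"
    "\<And>c. c \<in> rect_curves m \<Longrightarrow> curve_integral c \<rho> < \<infinity> \<Longrightarrow> curve_integral c \<rho>1 < \<infinity> \<and> curve_integral c \<rho>2 < \<infinity>"
proof -
  have "density_function (if i = 0 then \<rho>1 else \<rho>2)" for i :: nat using assms by auto
  from density_function_countable[of "\<lambda>i. if i = 0 then \<rho>1 else \<rho>2", OF this] obtain \<rho> where
    \<rho>: "density_function \<rho>" "\<And>c i. c \<in> rect_curves m \<Longrightarrow> curve_integral c \<rho> < \<infinity> \<Longrightarrow>
      curve_integral c (if (i::nat) = 0 then \<rho>1 else \<rho>2) < \<infinity>" by blast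
  then show ?thesis using that \<rho>(2)[of _ 0] \<rho>(2)[of _ 1] by auto
qed

text \<open>
  The function that is \<open>\<infinity>\<close> on a Borel null set and \<open>0\<close> elsewhere has zero energy.  Therefore almost
  every curve spends no time in a given null set, and changing a function there does not affect
  its integral along almost every curve.
\<close>

lemma borel_representative:
  assumes h: "h \<in> borel_measurable \<mu>"
  obtains h' \<rho> where "h' \<in> borel_measurable (metric_borel m)" "density_function \<rho>" "AE x in \<mu>. h x = h' x"
    "\<And>c. c \<in> rect_curves m \<Longrightarrow> curve_integral c \<rho> < \<infinity> \<Longrightarrow> curve_integral c h = curve_integral c h'"
proof -
  have "(\<lambda>x. h x * indicator \<Omega> x) \<in> borel_measurable (completion lborel)"
    using h by (simp add: \<mu>_iff)
  from completion_ex_borel_measurable[OF this] obtain h' where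
    h': "h' \<in> borel_measurable borel" "AE x in lborel. h x * indicator \<Omega> x = h' x" by auto
  note [measurable] = h'(1)
  from h'(2) obtain N where N: "N \<in> null_sets lborel" "{x. h x * indicator \<Omega> x \<noteq> h' x} \<subseteq> N"
    by (auto simp: eventually_ae_filter)
  have [measurable]: "N \<in> sets borel" using N(1) by (auto dest: null_setsD2)
  define \<rho> :: "'a \<Rightarrow> ennreal" where "\<rho> x = (if x \<in> N then top else 0)" for x
  have 1: "h' \<in> borel_measurable (metric_borel m)" unfolding borel_iff by measurable
  have \<rho>_borel: "\<rho> \<in> borel_measurable (metric_borel m)" unfolding borel_iff \<rho>_def by measurable
  have "energy q \<mu> \<rho> = (\<integral>\<^sup>+x. 0 \<partial>(lborel :: 'a measure))"
    unfolding \<mu>_integral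
  proof (rule nn_integral_cong_AE)
    show "AE x in lborel. ennpowr (\<rho> x) q * indicator \<Omega> x = 0"
      using AE_not_in[OF N(1)] by eventually_elim (simp add: \<rho>_def)
  qed
  then have 2: "density_function \<rho>" using \<rho>_borel by (simp add: density_function_def)
  have "AE x in lebesgue. x \<in> \<Omega> \<longrightarrow> h x = h' x"
    using AE_completion[OF h'(2)] by eventually_elim auto
  then have 3: "AE x in \<mu>. h x = h' x"
    by (subst AE_restrict_space_iff) auto
  have 4: "curve_integral c h = curve_integral c h'" if c: "c \<in> rect_curves m" and fin: "curve_integral c \<rho> < \<infinity>" for c
  proof -
    obtain l \<gamma> where lg: "c = (l, \<gamma>)" by (cases c)
    note cc = c[unfolded lg]
    have "AE t in lborel. \<rho> (\<gamma> t) * indicator {0..l} t \<noteq> \<infinity>"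
      using fin trace_measurable[OF cc \<rho>_borel] unfolding lg curve_integral_eq
      by (intro nn_integral_noteq_infinite) auto
    then show ?thesis unfolding lg curve_integral_eq
    proof (intro nn_integral_cong_AE, eventually_elim)
      case (elim t)
      show ?case
      proof (cases "t \<in> {0..l}")
        case True
        then have "\<gamma> t \<notin> N" using elim by (auto simp: \<rho>_def)
        then have "h (\<gamma> t) * indicator \<Omega> (\<gamma> t) = h' (\<gamma> t)" using N(2) by blast
        then show ?thesis using rect_curve_in[OF cc True] by simp
      qed simp
    qed
  qed
  show ?thesis by (rule that[OF 1 2 3 4])
qed

lemma openin_ball: "x \<in> \<Omega> \<Longrightarrow> openin (top_of_set \<Omega>) (mball_of m x r)"
  using Metric_space.openin_mball[OF Metric_space_mspace_mdist, of m x r]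
  unfolding mtopology[symmetric] mball_of_def mtopology_of_def by simp

text \<open>
  Countably many balls of finite energy cover the domain, and a curve, being compact, is contained
  in the union of finitely many of them.
\<close>

lemma Lq_loc_curve_integrable:
  assumes h: "h \<in> borel_measurable (metric_borel m)" and loc: "h \<in> Lq_loc q m \<mu>"
  obtains \<rho> where "density_function \<rho>"
    "\<And>c. c \<in> rect_curves m \<Longrightarrow> curve_integral c \<rho> < \<infinity> \<Longrightarrow> curve_integral c h < \<infinity>"
proof (cases "\<Omega> = {}")
  case True
  then have "rect_curves m = {}"
    using rect_curvesD(1,2) mspace by fastforce
  moreover have "density_function (\<lambda>_. 0)" by (simp add: density_function_def)
  ultimately show ?thesis using that by blast
next
  case False
  have "\<forall>x\<in>\<Omega>. \<exists>r>0. (\<integral>\<^sup>+y\<in>mball_of m x r. ennpowr (h y) q \<partial>\<mu>) < \<infinity>"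
    using loc by (simp add: Lq_loc_def mspace)
  then obtain r where r: "\<And>x. x \<in> \<Omega> \<Longrightarrow> 0 < r x" "\<And>x. x \<in> \<Omega> \<Longrightarrow> (\<integral>\<^sup>+y\<in>mball_of m x (r x). ennpowr (h y) q \<partial>\<mu>) < \<infinity>"
    by metis
  define F where "F = (\<lambda>x. mball_of m x (r x)) ` \<Omega>"
  have opn: "open S" if "S \<in> F" for S
    using that openin_ball open_\<Omega> by (auto simp: F_def openin_open_eq)
  have UF: "\<Union>F = \<Omega>"
  proof
    have "x \<in> mball_of m x (r x)" if "x \<in> \<Omega>" for x
      using r(1)[OF that] that Metric_space.centre_in_mball_iff[OF Metric_space_mspace_mdist[of m]]
      unfolding mball_of_def by (simp add: mspace)
    then show "\<Omega> \<subseteq> \<Union>F" unfolding F_def by blast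
  qed (auto simp: F_def mspace)
  obtain F' where F': "F' \<subseteq> F" "countable F'" "\<Union>F' = \<Omega>"
    using Lindelof[of F] opn UF by metis
  then have "F' \<noteq> {}" using False by auto
  define B where "B = from_nat_into F'"
  have B: "B i \<in> F" for i using from_nat_into[OF \<open>F' \<noteq> {}\<close>] F'(1) by (auto simp: B_def)
  have UB: "(\<Union>i. B i) = \<Omega>" using F' range_from_nat_into[OF \<open>F' \<noteq> {}\<close> F'(2)] by (simp add: B_def)
  have [measurable]: "B i \<in> sets borel" for i using opn[OF B] by (rule borel_open)
  define \<rho> where "\<rho> i x = h x * indicator (B i) x" for i x
  have h': "(\<lambda>x. h x * indicator \<Omega> x) \<in> borel_measurable borel" using h by (simp add: borel_iff)
  have \<rho>_borel: "\<rho> i \<in> borel_measurable (metric_borel m)" for i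
  proof -
    have "(\<lambda>x. (h x * indicator \<Omega> x) * indicator (B i) x) \<in> borel_measurable borel"
      using h' by measurable
    then show ?thesis unfolding borel_iff \<rho>_def by (simp add: mult_ac)
  qed
  have "density_function (\<rho> i)" for i
  proof -
    obtain x where x: "x \<in> \<Omega>" "B i = mball_of m x (r x)" using B[of i] by (auto simp: F_def)
    have "(\<integral>\<^sup>+y. ennpowr (\<rho> i y) q \<partial>\<mu>) = (\<integral>\<^sup>+y\<in>mball_of m x (r x). ennpowr (h y) q \<partial>\<mu>)"
      unfolding \<rho>_def x(2) by (intro nn_integral_cong) (auto split: split_indicator)
    then show ?thesis using r(2)[OF x(1)] \<rho>_borel by (simp add: density_function_def)
  qed
  from density_function_countable[of \<rho>, OF this] obtain \<rho>' where
    \<rho>': "density_function \<rho>'" "\<And>c i. c \<in> rect_curves m \<Longrightarrow> curve_integral c \<rho>' < \<infinity> \<Longrightarrow> curve_integral c (\<rho> i) < \<infinity>" by blast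
  have "curve_integral c h < \<infinity>" if c: "c \<in> rect_curves m" and fin: "curve_integral c \<rho>' < \<infinity>" for c
  proof -
    obtain l \<gamma> where lg: "c = (l, \<gamma>)" by (cases c)
    note cc = c[unfolded lg]
    have "compact (\<gamma> ` {0..l})"
      by (intro compact_continuous_image rect_curve_continuous[OF cc]) auto
    moreover have "\<gamma> ` {0..l} \<subseteq> (\<Union>i. B i)" using rect_curve_in[OF cc] UB by auto
    ultimately obtain J where J: "finite J" "\<gamma> ` {0..l} \<subseteq> (\<Union>i\<in>J. B i)"
      using opn[OF B] by (metis compactE_image)
    have "curve_integral c h \<le> (\<integral>\<^sup>+t. (\<Sum>i\<in>J. \<rho> i (\<gamma> t) * indicator {0..l} t) \<partial>lborel)"
      unfolding lg curve_integral_eq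
    proof (intro nn_integral_mono)
      fix t
      show "h (\<gamma> t) * indicator {0..l} t \<le> (\<Sum>i\<in>J. \<rho> i (\<gamma> t) * indicator {0..l} t)"
      proof (cases "t \<in> {0..l}")
        case True
        then obtain i where i: "i \<in> J" "\<gamma> t \<in> B i" using J(2) by blast
        have "h (\<gamma> t) * indicator {0..l} t = \<rho> i (\<gamma> t) * indicator {0..l} t" using i by (simp add: \<rho>_def)
        also have "\<dots> \<le> (\<Sum>i\<in>J. \<rho> i (\<gamma> t) * indicator {0..l} t)"
          using J(1) i(1) by (intro member_le_sum) auto
        finally show ?thesis .
      qed simp
    qed
    also have "\<dots> = (\<Sum>i\<in>J. curve_integral c (\<rho> i))"
      unfolding lg curve_integral_eq using trace_measurable[OF cc \<rho>_borel] by (intro nn_integral_sum) auto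
    also have "\<dots> < \<infinity>" using J(1) \<rho>'(2)[OF c fin] by simp
    finally show ?thesis .
  qed
  then show ?thesis using that \<rho>'(1) by blast
qed

lemma variation_bound_along_curve:
  assumes c: "(l, \<gamma>) \<in> rect_curves m" and g: "g \<in> borel_measurable (metric_borel m)"
    and ug: "\<And>s t. 0 \<le> s \<Longrightarrow> s < t \<Longrightarrow> t \<le> l \<Longrightarrow> ug_inequality u g (t - s, \<lambda>r. \<gamma> (s + r))"
    and fin: "curve_integral (l, \<gamma>) g < \<infinity>"
  shows "variation_bound (\<lambda>t. real_of_ereal (u (\<gamma> t))) (\<lambda>t. g (\<gamma> t) * indicator {0..l} t) {0..l}"
  unfolding variation_bound_def
proof (intro allI impI, elim conjE)
  fix s t :: real assume "s \<le> t" "{s..t} \<subseteq> {0..l}"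
  then have st: "0 \<le> s" "s \<le> t" "t \<le> l" by auto
  show "ennreal \<bar>real_of_ereal (u (\<gamma> s)) - real_of_ereal (u (\<gamma> t))\<bar>
      \<le> (\<integral>\<^sup>+x\<in>{s..t}. g (\<gamma> x) * indicator {0..l} x \<partial>lborel)"
  proof (cases "s = t")
    case False
    have "curve_integral (t - s, \<lambda>r. \<gamma> (s + r)) g < \<infinity>"
      using curve_integral_subcurve_le[OF c g st] fin by (rule le_less_trans)
    then have "ennreal \<bar>real_of_ereal (u (\<gamma> (s + 0))) - real_of_ereal (u (\<gamma> (s + (t - s))))\<bar>
        \<le> curve_integral (t - s, \<lambda>r. \<gamma> (s + r)) g"
      using False st ug[of s t] by (intro ug_inequality_finite(3)) auto
    also have "\<dots> = (\<integral>\<^sup>+x\<in>{s..t}. g (\<gamma> x) \<partial>lborel)"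
      by (rule curve_integral_subcurve[OF c g st])
    also have "\<dots> = (\<integral>\<^sup>+x\<in>{s..t}. g (\<gamma> x) * indicator {0..l} x \<partial>lborel)"
      using st by (intro nn_integral_cong) (auto split: split_indicator)
    finally show ?thesis by simp
  qed simp
qed

text \<open>
  Integrability along almost every curve is what the one-dimensional lemmas need.  It is
  automatic for gradients in \<open>Lq_loc\<close>, and it survives minima and decreasing limits.
\<close>

definition integrable_wug :: "('a \<Rightarrow> ereal) \<Rightarrow> ('a \<Rightarrow> ennreal) \<Rightarrow> bool" where
  "integrable_wug u g \<longleftrightarrow> g \<in> borel_measurable (metric_borel m) \<and>
     (\<exists>\<rho>. density_function \<rho> \<and> (\<forall>c\<in>rect_curves m. curve_integral c \<rho> < \<infinity> \<longrightarrow>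
        ug_inequality u g c \<and> curve_integral c g < \<infinity>))"

lemma integrable_wug_imp_wug: "integrable_wug u g \<Longrightarrow> weak_upper_gradient q m \<mu> u g"
  unfolding integrable_wug_def weak_upper_gradient_iff using borel_imp_\<mu> by blast

lemma integrable_wug_representative:
  assumes h: "weak_upper_gradient q m \<mu> u h" "h \<in> Lq_loc q m \<mu>"
  obtains h' where "integrable_wug u h'" "AE x in \<mu>. h x = h' x"
proof -
  from h(1) obtain \<rho>1 where h\<mu>: "h \<in> borel_measurable \<mu>" and \<rho>1: "density_function \<rho>1"
    and ug: "\<And>c. c\<in>rect_curves m \<Longrightarrow> curve_integral c \<rho>1 < \<infinity> \<Longrightarrow> ug_inequality u h c"
    unfolding weak_upper_gradient_iff by blast
  obtain h' \<rho>2 where h': "h' \<in> borel_measurable (metric_borel m)" and \<rho>2: "density_function \<rho>2"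
    and ae: "AE x in \<mu>. h x = h' x"
    and eq: "\<And>c. c \<in> rect_curves m \<Longrightarrow> curve_integral c \<rho>2 < \<infinity> \<Longrightarrow> curve_integral c h = curve_integral c h'"
    using borel_representative[OF h\<mu>] by blast
  have "h' \<in> Lq_loc q m \<mu>"
  proof -
    have "(\<integral>\<^sup>+y\<in>B. ennpowr (h' y) q \<partial>\<mu>) = (\<integral>\<^sup>+y\<in>B. ennpowr (h y) q \<partial>\<mu>)" for B
      using ae by (intro nn_integral_cong_AE) (auto elim!: eventually_mono)
    then show ?thesis using h(2) borel_imp_\<mu>[OF h'] by (simp add: Lq_loc_def)
  qed
  from Lq_loc_curve_integrable[OF h' this] obtain \<rho>3 where \<rho>3: "density_function \<rho>3"
    "\<And>c. c \<in> rect_curves m \<Longrightarrow> curve_integral c \<rho>3 < \<infinity> \<Longrightarrow> curve_integral c h' < \<infinity>" by blast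
  obtain \<rho>4 where \<rho>4: "density_function \<rho>4"
    "\<And>c. c \<in> rect_curves m \<Longrightarrow> curve_integral c \<rho>4 < \<infinity> \<Longrightarrow> curve_integral c \<rho>1 < \<infinity> \<and> curve_integral c \<rho>2 < \<infinity>"
    using density_function_two[OF \<rho>1 \<rho>2] by blast
  obtain \<rho> where \<rho>: "density_function \<rho>"
    "\<And>c. c \<in> rect_curves m \<Longrightarrow> curve_integral c \<rho> < \<infinity> \<Longrightarrow> curve_integral c \<rho>4 < \<infinity> \<and> curve_integral c \<rho>3 < \<infinity>"
    using density_function_two[OF \<rho>4(1) \<rho>3(1)] by blast
  have "ug_inequality u h' c \<and> curve_integral c h' < \<infinity>"
    if c: "c \<in> rect_curves m" "curve_integral c \<rho> < \<infinity>" for c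
    using \<rho>(2)[OF c] \<rho>4(2)[OF c(1)] \<rho>3(2)[OF c(1)] ug[OF c(1)] eq[OF c(1)]
    by (auto intro: ug_inequality_mono)
  then have "integrable_wug u h'" unfolding integrable_wug_def using h' \<rho>(1) by blast
  then show ?thesis using that ae by blast
qed

text \<open>
  On a curve without exceptional subcurves both gradients bound the increments of \<open>u\<close> over all
  subintervals, so \<open>variation_bound_min\<close> applies.
\<close>

lemma integrable_wug_min:
  assumes g: "integrable_wug u g" and h: "integrable_wug u h"
  shows "integrable_wug u (\<lambda>x. min (g x) (h x))"
proof -
  have gh: "g \<in> borel_measurable (metric_borel m)" "h \<in> borel_measurable (metric_borel m)"
    using g h by (auto simp: integrable_wug_def)
  note [measurable] = gh
  obtain \<rho>1 where \<rho>1: "density_function \<rho>1"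
    and g_ug: "\<And>c. c\<in>rect_curves m \<Longrightarrow> curve_integral c \<rho>1 < \<infinity> \<Longrightarrow> ug_inequality u g c \<and> curve_integral c g < \<infinity>"
    using g unfolding integrable_wug_def by blast
  obtain \<rho>2 where \<rho>2: "density_function \<rho>2"
    and h_ug: "\<And>c. c\<in>rect_curves m \<Longrightarrow> curve_integral c \<rho>2 < \<infinity> \<Longrightarrow> ug_inequality u h c \<and> curve_integral c h < \<infinity>"
    using h unfolding integrable_wug_def by blast
  obtain \<rho> where \<rho>: "density_function \<rho>"
    "\<And>c. c \<in> rect_curves m \<Longrightarrow> curve_integral c \<rho> < \<infinity> \<Longrightarrow> curve_integral c \<rho>1 < \<infinity> \<and> curve_integral c \<rho>2 < \<infinity>"
    using density_function_two[OF \<rho>1 \<rho>2] by blast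
  have "ug_inequality u (\<lambda>x. min (g x) (h x)) c \<and> curve_integral c (\<lambda>x. min (g x) (h x)) < \<infinity>"
    if c: "c \<in> rect_curves m" and fin: "curve_integral c \<rho> < \<infinity>" for c
  proof -
    obtain l \<gamma> where lg: "c = (l, \<gamma>)" by (cases c)
    note cc = c[unfolded lg]
    have l: "0 < l" using rect_curvesD(1)[OF cc] .
    have fin12: "curve_integral c g < \<infinity>" "curve_integral c h < \<infinity>" and ug: "ug_inequality u g c"
      using \<rho>(2)[OF c fin] g_ug[OF c] h_ug[OF c] by auto
    have sub: "ug_inequality u g (t - s, \<lambda>r. \<gamma> (s + r)) \<and> ug_inequality u h (t - s, \<lambda>r. \<gamma> (s + r))"
      if st: "0 \<le> s" "s < t" "t \<le> l" for s t
    proof -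
      have "\<rho> \<in> borel_measurable (metric_borel m)" using \<rho>(1) by (simp add: density_function_def)
      then have "curve_integral (t - s, \<lambda>r. \<gamma> (s + r)) \<rho> < \<infinity>"
        using curve_integral_subcurve_le[OF cc, of \<rho> s t] st fin unfolding lg by (simp add: le_less_trans)
      then show ?thesis
        using \<rho>(2)[OF rect_curve_subcurve[OF cc st]] g_ug[OF rect_curve_subcurve[OF cc st]]
          h_ug[OF rect_curve_subcurve[OF cc st]] by blast
    qed
    define f where "f t = real_of_ereal (u (\<gamma> t))" for t
    define G where "G t = g (\<gamma> t) * indicator {0..l} t" for t
    define H where "H t = h (\<gamma> t) * indicator {0..l} t" for t
    have [measurable]: "G \<in> borel_measurable borel" "H \<in> borel_measurable borel"
      unfolding G_def H_def by (rule trace_measurable[OF cc gh(1)] trace_measurable[OF cc gh(2)])+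
    have "variation_bound f G {0..l}" "variation_bound f H {0..l}"
      unfolding f_def G_def H_def using variation_bound_along_curve[OF cc] gh sub fin12 lg by auto
    moreover have G_eq: "interval_integral 0 l G = curve_integral c g"
      unfolding lg curve_integral_eq G_def by (intro nn_integral_cong) (auto split: split_indicator)
    moreover have "interval_integral 0 l H = curve_integral c h"
      unfolding lg curve_integral_eq H_def by (intro nn_integral_cong) (auto split: split_indicator)
    ultimately have "ennreal \<bar>f 0 - f l\<bar> \<le> (\<integral>\<^sup>+x\<in>{0..l}. min (G x) (H x) \<partial>lborel)"
      using fin12 l by (intro variation_bound_min) auto
    also have "\<dots> = curve_integral c (\<lambda>x. min (g x) (h x))"
      unfolding lg curve_integral_eq G_def H_def by (intro nn_integral_cong) (auto split: split_indicator)
    finally have *: "ennreal \<bar>f 0 - f l\<bar> \<le> curve_integral c (\<lambda>x. min (g x) (h x))" .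
    have "ug_inequality u (\<lambda>x. min (g x) (h x)) c"
      using * ug_inequality_finite(1,2)[OF ug[unfolded lg] fin12(1)[unfolded lg]]
      unfolding lg f_def by (intro ug_inequalityI)
    moreover have "curve_integral c (\<lambda>x. min (g x) (h x)) \<le> curve_integral c g"
      unfolding lg by (intro curve_integral_mono) auto
    ultimately show ?thesis using fin12(1) by (auto intro: le_less_trans)
  qed
  then show ?thesis unfolding integrable_wug_def using \<rho>(1) by (auto intro!: exI[of _ \<rho>])
qed

text \<open>Monotone convergence along each curve outside a common exceptional family.\<close>

lemma integrable_wug_INF:
  assumes g: "\<And>n::nat. integrable_wug u (g n)" and dec: "\<And>x. decseq (\<lambda>n. g n x)"
  shows "integrable_wug u (\<lambda>x. INF n. g n x)"
proof -
  have gm: "g n \<in> borel_measurable (metric_borel m)" for n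
    using g by (auto simp: integrable_wug_def)
  note [measurable] = gm
  obtain \<rho>0 where \<rho>0: "\<And>n. density_function (\<rho>0 n)"
    and ug0: "\<And>n c. c\<in>rect_curves m \<Longrightarrow> curve_integral c (\<rho>0 n) < \<infinity> \<Longrightarrow> ug_inequality u (g n) c \<and> curve_integral c (g n) < \<infinity>"
    using g unfolding integrable_wug_def by metis
  obtain \<rho> where \<rho>: "density_function \<rho>"
    "\<And>c i. c \<in> rect_curves m \<Longrightarrow> curve_integral c \<rho> < \<infinity> \<Longrightarrow> curve_integral c (\<rho>0 i) < \<infinity>"
    using density_function_countable[of \<rho>0, OF \<rho>0] by blast
  have "ug_inequality u (\<lambda>x. INF n. g n x) c \<and> curve_integral c (\<lambda>x. INF n. g n x) < \<infinity>"
    if c: "c \<in> rect_curves m" and fin: "curve_integral c \<rho> < \<infinity>" for c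
  proof -
    obtain l \<gamma> where lg: "c = (l, \<gamma>)" by (cases c)
    note cc = c[unfolded lg]
    have ug: "ug_inequality u (g n) (l, \<gamma>)" and gfin: "curve_integral (l, \<gamma>) (g n) < \<infinity>" for n
      using ug0[OF c \<rho>(2)[OF c fin]] lg by auto
    have "curve_integral c (\<lambda>x. INF n. g n x) = (\<integral>\<^sup>+t. (INF n. g n (\<gamma> t) * indicator {0..l} t) \<partial>lborel)"
      unfolding lg curve_integral_eq by (intro nn_integral_cong) (auto split: split_indicator)
    also have "\<dots> = (INF n. curve_integral (l, \<gamma>) (g n))"
      unfolding curve_integral_eq
    proof (rule nn_integral_monotone_convergence_INF_decseq)
      show "decseq (\<lambda>n t. g n (\<gamma> t) * indicator {0..l} t)"
        using dec unfolding decseq_def by (auto simp: le_fun_def split: split_indicator)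
      show "(\<lambda>t. g n (\<gamma> t) * indicator {0..l} t) \<in> borel_measurable lborel" for n
        using trace_measurable[OF cc gm] by simp
      show "(\<integral>\<^sup>+t. g 0 (\<gamma> t) * indicator {0..l} t \<partial>lborel) < \<infinity>"
        using gfin[of 0] unfolding curve_integral_eq .
    qed
    finally have eq: "curve_integral c (\<lambda>x. INF n. g n x) = (INF n. curve_integral (l, \<gamma>) (g n))" .
    have "ug_inequality u (\<lambda>x. INF n. g n x) c"
      unfolding lg
    proof (rule ug_inequalityI)
      show "\<bar>u (\<gamma> 0)\<bar> \<noteq> \<infinity>" "\<bar>u (\<gamma> l)\<bar> \<noteq> \<infinity>" using ug_inequality_finite[OF ug gfin] by auto
      show "ennreal \<bar>real_of_ereal (u (\<gamma> 0)) - real_of_ereal (u (\<gamma> l))\<bar> \<le> curve_integral (l, \<gamma>) (\<lambda>x. INF n. g n x)"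
        unfolding eq[unfolded lg] using ug_inequality_finite(3)[OF ug gfin] by (rule INF_greatest)
    qed
    moreover have "curve_integral c (\<lambda>x. INF n. g n x) < \<infinity>"
      unfolding eq using gfin[of 0] by (auto intro: INF_lower2 le_less_trans)
    ultimately show ?thesis by blast
  qed
  then show ?thesis unfolding integrable_wug_def using \<rho>(1) by (auto intro!: exI[of _ \<rho>])
qed

text \<open>
  Let \<open>G\<close> be the limit of a minimizing sequence for the energy that is made decreasing by taking
  minima.  For a competitor \<open>k\<close>, the minimum of \<open>G\<close> and \<open>k\<close> is again admissible, so its energy is not
  less than that of \<open>G\<close>; being at most \<open>G\<close>, it equals \<open>G\<close> almost everywhere.
\<close>

theorem minimal_wug_exists:
  assumes g0: "weak_upper_gradient q m \<mu> u g0" and fin: "energy q \<mu> g0 < \<infinity>"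
  shows "\<exists>g. is_minimal_wug q m \<mu> u g"
proof -
  define E where "E g = energy q \<mu> g" for g
  have Lq: "g \<in> Lq_loc q m \<mu>" if "E g < \<infinity>" "g \<in> borel_measurable \<mu>" for g
  proof -
    have "(\<integral>\<^sup>+y\<in>B. ennpowr (g y) q \<partial>\<mu>) < \<infinity>" for B
      using that(1) by (rule le_less_trans[rotated]) (auto simp: E_def intro!: nn_integral_mono split: split_indicator)
    then show ?thesis using that(2) by (auto simp: Lq_loc_def intro: exI[of _ 1])
  qed
  have E_mono: "E g \<le> E h" if "\<And>x. g x \<le> h x" for g h
    unfolding E_def using that q_pos by (intro nn_integral_mono ennpowr_mono) auto
  have "g0 \<in> borel_measurable \<mu>" using g0 by (simp add: weak_upper_gradient_iff)
  with g0 fin obtain g1 where g1: "integrable_wug u g1" "AE x in \<mu>. g0 x = g1 x"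
    using Lq[of g0] integrable_wug_representative unfolding E_def by blast
  have "E g1 = E g0"
    unfolding E_def using g1(2) by (intro nn_integral_cong_AE) (auto elim!: eventually_mono)
  then have g1_fin: "E g1 < \<infinity>" using fin by (simp add: E_def)
  define I where "I = (INF g\<in>{g. integrable_wug u g}. E g)"
  have I_fin: "I < \<infinity>" using g1 g1_fin unfolding I_def by (auto intro: INF_lower2 le_less_trans)
  have "E ` {g. integrable_wug u g} \<noteq> {}" using g1 by blast
  from ennreal_Inf_countable_INF[OF this] obtain e :: "nat \<Rightarrow> ennreal"
    where e: "range e \<subseteq> E ` {g. integrable_wug u g}" "I = (INF n. e n)"
    unfolding I_def by blast
  have "\<forall>n. \<exists>h. integrable_wug u h \<and> e n = E h" using e(1) by blast
  then obtain h where h: "\<And>n. integrable_wug u (h n)" "\<And>n. e n = E (h n)" by metis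
  define g where "g = rec_nat (h 0) (\<lambda>n k x. min (k x) (h (Suc n) x))"
  have g_Suc: "g (Suc n) = (\<lambda>x. min (g n x) (h (Suc n) x))" and g_0: "g 0 = h 0" for n
    by (simp_all add: g_def)
  have g_wug: "integrable_wug u (g n)" for n
    by (induction n) (auto simp: g_Suc g_0 h integrable_wug_min)
  have dec: "decseq (\<lambda>n. g n x)" for x
    by (intro decseq_SucI) (simp add: g_Suc)
  have gh: "g n x \<le> h n x" for n x by (cases n) (auto simp: g_Suc g_0)
  define G where "G x = (INF n. g n x)" for x
  have G: "integrable_wug u G" unfolding G_def by (rule integrable_wug_INF[OF g_wug dec])
  have "E G \<le> e n" for n
    unfolding h(2) by (intro E_mono) (auto simp: G_def intro: INF_lower2 gh)
  then have EG: "E G \<le> I" unfolding e(2) by (intro INF_greatest)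
  have [measurable]: "G \<in> borel_measurable \<mu>"
    using borel_imp_\<mu>[of G] G unfolding integrable_wug_def by blast
  have "is_minimal_wug q m \<mu> u G"
    unfolding is_minimal_wug_def
  proof (intro conjI allI impI, goal_cases)
    case 1
    show ?case using G by (rule integrable_wug_imp_wug)
  next
    case 2
    show ?case using EG I_fin by (intro Lq) (auto intro: le_less_trans)
  next
    case (3 k)
    then obtain k' where k': "integrable_wug u k'" "AE x in \<mu>. k x = k' x"
      using integrable_wug_representative by blast
    define j where "j x = min (G x) (k' x)" for x
    have j: "integrable_wug u j" unfolding j_def by (rule integrable_wug_min[OF G k'(1)])
    have [measurable]: "j \<in> borel_measurable \<mu>"
      using borel_imp_\<mu>[of j] j unfolding integrable_wug_def by blast
    have "I \<le> E j" unfolding I_def using j by (intro INF_lower) auto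
    moreover have jG: "E j \<le> E G" by (rule E_mono) (simp add: j_def)
    ultimately have eq: "E j = E G" "E j \<noteq> \<infinity>" using EG I_fin by (auto simp: top_unique)
    have "(\<integral>\<^sup>+x. ennpowr (G x) q - ennpowr (j x) q \<partial>\<mu>) = E G - E j"
      unfolding E_def
    proof (rule nn_integral_diff)
      show "integral\<^sup>N \<mu> (\<lambda>x. ennpowr (j x) q) \<noteq> \<infinity>" using eq(2) by (simp add: E_def)
      show "AE x in \<mu>. ennpowr (j x) q \<le> ennpowr (G x) q"
        using q_pos by (intro AE_I2 ennpowr_mono) (auto simp: j_def)
    qed measurable
    also have "\<dots> = 0" using eq by (simp add: diff_eq_0_ennreal less_top)
    finally have "AE x in \<mu>. ennpowr (G x) q - ennpowr (j x) q = 0"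
      by (subst (asm) nn_integral_0_iff_AE) measurable
    with k'(2) show ?case
    proof eventually_elim
      case (elim x)
      then have "ennpowr (G x) q \<le> ennpowr (j x) q" by (intro ennreal_minus_eq_0)
      then have "ennpowr (ennpowr (G x) q) (1 / q) \<le> ennpowr (ennpowr (j x) q) (1 / q)"
        by (rule ennpowr_mono[rotated]) (use q_pos in simp)
      then have "G x \<le> j x" unfolding ennpowr_powr[OF q_pos] .
      then show ?case using elim(1) by (simp add: j_def)
    qed
  qed
  then show ?thesis by blast
qed

lemma min_wug_minimal:
  assumes "weak_upper_gradient q m \<mu> u g0" "energy q \<mu> g0 < \<infinity>"
  shows "is_minimal_wug q m \<mu> u (min_wug q m \<mu> u)"
  unfolding min_wug_def by (rule someI_ex[OF minimal_wug_exists[OF assms]])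

end


section \<open>The plane foliated by lines parallel to an axis\<close>

text \<open>
  The point with \<open>i\<close>-th coordinate \<open>t\<close> and other coordinate \<open>y\<close>.  For fixed \<open>y\<close> it runs through a line
  parallel to the \<open>i\<close>-th axis, and both directions are treated at once.
\<close>

definition plane_point :: "2 \<Rightarrow> real \<Rightarrow> real \<Rightarrow> real ^ 2" where
  "plane_point i t y = (\<chi> k. if k = i then t else y)"

lemma plane_point_nth: "plane_point i t y $ k = (if k = i then t else y)"
  by (simp add: plane_point_def)

abbreviation line_integral :: "2 \<Rightarrow> real \<Rightarrow> real \<Rightarrow> real \<Rightarrow> (real ^ 2 \<Rightarrow> ennreal) \<Rightarrow> ennreal" where
  "line_integral i y a b g \<equiv> (\<integral>\<^sup>+t\<in>{a..b}. g (plane_point i t y) \<partial>lborel)"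

lemma continuous_on_plane_point [continuous_intros]:
  assumes "continuous_on S f" "continuous_on S g"
  shows "continuous_on S (\<lambda>x. plane_point i (f x) (g x))"
  unfolding plane_point_def
proof (rule continuous_on_vec_lambda)
  fix k show "continuous_on S (\<lambda>x. if k = i then f x else g x)"
    using assms by (cases "k = i") auto
qed

lemma measurable_plane_point [measurable]:
  assumes [measurable]: "f \<in> borel_measurable M" "g \<in> borel_measurable M"
  shows "(\<lambda>x. plane_point i (f x) (g x)) \<in> borel_measurable M"
proof -
  have "(\<lambda>p :: real \<times> real. plane_point i (fst p) (snd p)) \<in> borel_measurable borel"
    by (intro borel_measurable_continuous_onI continuous_intros)
  from measurable_compose[OF _ this, of "\<lambda>x. (f x, g x)" M] show ?thesis by simp
qed

lemma lborel_plane: "lborel = distr (lborel \<Otimes>\<^sub>M lborel) borel (\<lambda>(t, y). plane_point i t y)"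
proof (rule lborel_eqI)
  fix l u :: "real ^ 2" assume le: "\<And>b. b \<in> Basis \<Longrightarrow> l \<bullet> b \<le> u \<bullet> b"
  have le': "l $ k \<le> u $ k" for k using le[of "axis k 1"] by (simp add: inner_axis)
  define j :: 2 where "j = (if i = 1 then 2 else 1)"
  have ij: "i \<noteq> j" "UNIV = {i, j}" using exhaust_2[of i] by (auto simp: j_def UNIV_2)
  have Basis: "(Basis :: (real ^ 2) set) = {axis i 1, axis j 1}" "axis i 1 \<noteq> (axis j 1 :: real ^ 2)"
    using ij by (auto simp: Basis_vec_def axis_eq_axis)
  have "emeasure (distr (lborel \<Otimes>\<^sub>M lborel) borel (\<lambda>(t, y). plane_point i t y)) (box l u)
      = emeasure (lborel \<Otimes>\<^sub>M lborel) ((\<lambda>(t, y). plane_point i t y) -` box l u \<inter> space (lborel \<Otimes>\<^sub>M lborel))"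
    by (rule emeasure_distr) auto
  also have "(\<lambda>(t, y). plane_point i t y) -` box l u \<inter> space (lborel \<Otimes>\<^sub>M lborel) = {l $ i<..<u $ i} \<times> {l $ j<..<u $ j}"
    using ij by (auto simp: mem_box space_pair_measure Basis inner_axis plane_point_nth)
  also have "emeasure (lborel \<Otimes>\<^sub>M lborel) \<dots> = ennreal (u $ i - l $ i) * ennreal (u $ j - l $ j)"
    using le' by (subst lborel.emeasure_pair_measure_Times) auto
  also have "\<dots> = (\<Prod>b\<in>Basis. (u - l) \<bullet> b)"
    using le' Basis(2) unfolding Basis(1) by (simp add: inner_axis ennreal_mult)
  finally show "emeasure (distr (lborel \<Otimes>\<^sub>M lborel) borel (\<lambda>(t, y). plane_point i t y)) (box l u) = (\<Prod>b\<in>Basis. (u - l) \<bullet> b)" .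
qed simp

lemma nn_integral_lines:
  assumes [measurable]: "F \<in> borel_measurable borel"
  shows "(\<integral>\<^sup>+x. F x \<partial>lborel) = (\<integral>\<^sup>+y. \<integral>\<^sup>+t. F (plane_point i t y) \<partial>lborel \<partial>lborel)"
proof -
  have "(\<integral>\<^sup>+x. F x \<partial>lborel) = (\<integral>\<^sup>+p. F (case p of (t, y) \<Rightarrow> plane_point i t y) \<partial>(lborel \<Otimes>\<^sub>M lborel))"
    by (subst lborel_plane[of i], subst nn_integral_distr) auto
  also have "\<dots> = (\<integral>\<^sup>+y. \<integral>\<^sup>+t. F (plane_point i t y) \<partial>lborel \<partial>lborel)"
    by (subst lborel_pair.nn_integral_snd[symmetric]) auto
  finally show ?thesis .
qed

lemma AE_lines:
  assumes "AE x in lborel. P x"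
  shows "AE y in lborel. AE t in lborel. P (plane_point i t y)"
proof -
  from assms obtain N where N: "N \<in> null_sets lborel" "{x. \<not> P x} \<subseteq> N"
    by (auto simp: eventually_ae_filter)
  have [measurable]: "N \<in> sets borel" using N(1) by (auto dest: null_setsD2)
  have "0 = (\<integral>\<^sup>+y. \<integral>\<^sup>+t. indicator N (plane_point i t y) \<partial>lborel \<partial>lborel)"
    using N(1) by (subst nn_integral_lines[symmetric]) auto
  then have "AE y in lborel. (\<integral>\<^sup>+t. indicator N (plane_point i t y) \<partial>lborel) = 0"
    by (subst (asm) eq_commute, subst (asm) nn_integral_0_iff_AE) auto
  then show ?thesis
  proof eventually_elim
    case (elim y)
    then have "AE t in lborel. indicator N (plane_point i t y) = (0::ennreal)"
      by (subst (asm) nn_integral_0_iff_AE) auto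
    then show ?case
    proof eventually_elim
      case (elim t)
      then show ?case using N(2) by (auto split: split_indicator_asm)
    qed
  qed
qed

text \<open>
  Sections of a Lebesgue measurable function need not be measurable, but by \<open>AE_lines\<close> almost every
  section agrees almost everywhere with the section of a Borel representative.
\<close>

lemma nn_integral_lines_lebesgue:
  assumes "F \<in> borel_measurable lebesgue"
  shows "(\<integral>\<^sup>+x. F x \<partial>lborel) = (\<integral>\<^sup>+y. \<integral>\<^sup>+t. F (plane_point i t y) \<partial>lborel \<partial>lborel)"
proof -
  obtain F' where F': "F' \<in> borel_measurable borel" and ae: "AE x in lborel. F x = F' x"
    using completion_ex_borel_measurable[OF assms] by auto
  have "(\<integral>\<^sup>+x. F x \<partial>lborel) = (\<integral>\<^sup>+y. \<integral>\<^sup>+t. F' (plane_point i t y) \<partial>lborel \<partial>lborel)"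
    using ae F' by (subst nn_integral_lines[symmetric]) (auto intro!: nn_integral_cong_AE)
  also have "\<dots> = (\<integral>\<^sup>+y. \<integral>\<^sup>+t. F (plane_point i t y) \<partial>lborel \<partial>lborel)"
  proof (rule nn_integral_cong_AE)
    show "AE y in lborel. (\<integral>\<^sup>+t. F' (plane_point i t y) \<partial>lborel) = (\<integral>\<^sup>+t. F (plane_point i t y) \<partial>lborel)"
      using AE_lines[OF ae, of i] by eventually_elim (rule nn_integral_cong_AE, auto)
  qed
  finally show ?thesis .
qed

lemma nn_integral_lines_mono:
  assumes "F \<in> borel_measurable lebesgue" "G \<in> borel_measurable lebesgue"
    and "AE y in lborel. (\<integral>\<^sup>+t. F (plane_point i t y) \<partial>lborel) \<le> (\<integral>\<^sup>+t. G (plane_point i t y) \<partial>lborel)"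
  shows "(\<integral>\<^sup>+x. F x \<partial>lborel) \<le> (\<integral>\<^sup>+x. G x \<partial>lborel)"
  unfolding nn_integral_lines_lebesgue[OF assms(1), of i] nn_integral_lines_lebesgue[OF assms(2), of i]
  using assms(3) by (rule nn_integral_mono_AE)


section \<open>Upper gradients along lines parallel to an axis\<close>

lemma ug_inequality_segment:
  assumes "ug_inequality u g (b - a, \<lambda>r. plane_point i (a + r) y)"
    and "\<bar>u (plane_point i a y)\<bar> \<noteq> \<infinity>" "\<bar>u (plane_point i b y)\<bar> \<noteq> \<infinity>"
  shows "ennreal \<bar>real_of_ereal (u (plane_point i a y)) - real_of_ereal (u (plane_point i b y))\<bar>
    \<le> curve_integral (b - a, \<lambda>r. plane_point i (a + r) y) g"
  using assms by (cases "u (plane_point i a y)"; cases "u (plane_point i b y)") (auto simp: ug_inequality_def)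

text \<open>Segments parallel to an axis are shortest paths, both for the Euclidean and the taxicab metric.\<close>

locale plane_domain = domain_space m \<Omega> q for m :: "(real ^ 2) metric" and \<Omega> q +
  assumes mdist_line: "mdist m (plane_point i s y) (plane_point i t y) = \<bar>s - t\<bar>" and q_gt_1: "1 < q"
begin

lemma segment_rect_curve:
  assumes "a < b" and "\<And>t. t \<in> {a..b} \<Longrightarrow> plane_point i t y \<in> \<Omega>"
  shows "(b - a, \<lambda>r. plane_point i (a + r) y) \<in> rect_curves m"
proof (rule geodesic_rect_curve)
  show "continuous_map (top_of_set {0..b - a}) (mtopology_of m) (\<lambda>r. plane_point i (a + r) y)"
    using assms(2) by (auto simp: mtopology continuous_map_in_subtopology intro!: continuous_intros)
qed (use assms in \<open>auto simp: mspace mdist_line\<close>)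

lemma segment_integral:
  assumes [measurable]: "g \<in> borel_measurable borel" and "a \<le> b"
  shows "curve_integral (b - a, \<lambda>r. plane_point i (a + r) y) g = line_integral i y a b g"
proof -
  have "line_integral i y a b g
      = (\<integral>\<^sup>+r. g (plane_point i (a + 1 * r) y) * indicator {a..b} (a + 1 * r) \<partial>lborel)"
    by (subst nn_integral_real_affine[of _ 1 a]) auto
  also have "\<dots> = curve_integral (b - a, \<lambda>r. plane_point i (a + r) y) g"
    unfolding curve_integral_eq by (intro nn_integral_cong) (auto split: split_indicator)
  finally show ?thesis by simp
qed

lemma line_integrable:
  assumes [measurable]: "G \<in> borel_measurable borel" and fin: "energy q lborel G < \<infinity>"
  shows "AE y in lborel. \<forall>a b. a \<le> b \<longrightarrow> line_integral i y a b G < \<infinity>"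
proof -
  have "(\<integral>\<^sup>+y. \<integral>\<^sup>+t. ennpowr (G (plane_point i t y)) q \<partial>lborel \<partial>lborel) \<noteq> \<infinity>"
    using fin by (subst nn_integral_lines[symmetric]) auto
  then have "AE y in lborel. (\<integral>\<^sup>+t. ennpowr (G (plane_point i t y)) q \<partial>lborel) \<noteq> \<infinity>"
    by (intro nn_integral_noteq_infinite) auto
  then show ?thesis
  proof (eventually_elim, intro allI impI)
    fix y a b :: real assume y: "(\<integral>\<^sup>+t. ennpowr (G (plane_point i t y)) q \<partial>lborel) \<noteq> \<infinity>" and "a \<le> b"
    have le: "G x \<le> ennpowr (G x) q + ennreal (q - 1)" for x
    proof -
      have "G x \<le> ennreal q * G x"
        using q_gt_1 mult_right_mono[of 1 "ennreal q" "G x"] by simp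
      also have "\<dots> \<le> ennpowr (G x) q + ennreal (q - 1)" using q_gt_1 by (rule ennpowr_bernoulli)
      finally show ?thesis .
    qed
    have "line_integral i y a b G
        \<le> (\<integral>\<^sup>+t. ennpowr (G (plane_point i t y)) q + ennreal (q - 1) * indicator {a..b} t \<partial>lborel)"
      using le by (intro nn_integral_mono) (auto split: split_indicator)
    also have "\<dots> = (\<integral>\<^sup>+t. ennpowr (G (plane_point i t y)) q \<partial>lborel) + ennreal (q - 1) * ennreal (b - a)"
      using \<open>a \<le> b\<close> by (subst nn_integral_add) (auto simp: nn_integral_cmult)
    also have "\<dots> < \<infinity>" using y by (simp add: less_top[symmetric] ennreal_mult_eq_top_iff)
    finally show "line_integral i y a b G < \<infinity>" .
  qed
qed

abbreviation gradient_on_line :: "(real ^ 2 \<Rightarrow> ereal) \<Rightarrow> (real ^ 2 \<Rightarrow> ennreal) \<Rightarrow> 2 \<Rightarrow> real \<Rightarrow> bool" where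
  "gradient_on_line u g i y \<equiv> (\<forall>a b. a \<le> b \<and> (\<forall>t\<in>{a..b}. plane_point i t y \<in> \<Omega>) \<and>
     \<bar>u (plane_point i a y)\<bar> \<noteq> \<infinity> \<and> \<bar>u (plane_point i b y)\<bar> \<noteq> \<infinity> \<longrightarrow>
     ennreal \<bar>real_of_ereal (u (plane_point i a y)) - real_of_ereal (u (plane_point i b y))\<bar> \<le> line_integral i y a b g)"

text \<open>
  By Fubini, a function with finite energy is locally integrable on almost every line parallel to an
  axis; hence no segment of such a line is exceptional.  The Borel representative \<open>g'\<close>, which does
  not depend on the direction of the lines, makes the integrals over lines measurable.
\<close>

lemma wug_on_lines:
  assumes wug: "weak_upper_gradient q m \<mu> u g"
  obtains g' where "g' \<in> borel_measurable borel" "AE x in lborel. x \<in> \<Omega> \<longrightarrow> g x = g' x"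
    "\<And>i. AE y in lborel. gradient_on_line u g' i y"
proof -
  from wug obtain \<rho>1 where g\<mu>: "g \<in> borel_measurable \<mu>" and \<rho>1: "density_function \<rho>1"
    and ug: "\<And>c. c\<in>rect_curves m \<Longrightarrow> curve_integral c \<rho>1 < \<infinity> \<Longrightarrow> ug_inequality u g c"
    unfolding weak_upper_gradient_iff by blast
  obtain h \<rho>2 where h: "h \<in> borel_measurable (metric_borel m)" and \<rho>2: "density_function \<rho>2"
    and ae: "AE x in \<mu>. g x = h x"
    and eq: "\<And>c. c \<in> rect_curves m \<Longrightarrow> curve_integral c \<rho>2 < \<infinity> \<Longrightarrow> curve_integral c g = curve_integral c h"
    using borel_representative[OF g\<mu>] by blast
  obtain \<rho> where \<rho>: "density_function \<rho>"
    "\<And>c. c \<in> rect_curves m \<Longrightarrow> curve_integral c \<rho> < \<infinity> \<Longrightarrow> curve_integral c \<rho>1 < \<infinity> \<and> curve_integral c \<rho>2 < \<infinity>"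
    using density_function_two[OF \<rho>1 \<rho>2] by blast
  define g' where "g' x = h x * indicator \<Omega> x" for x
  define R where "R x = \<rho> x * indicator \<Omega> x" for x
  have g'm [measurable]: "g' \<in> borel_measurable borel" and Rm [measurable]: "R \<in> borel_measurable borel"
    using h \<rho>(1) unfolding g'_def R_def by (auto simp: borel_iff density_function_def)
  have "energy q lborel R = energy q \<mu> \<rho>"
    unfolding \<mu>_integral R_def by (intro nn_integral_cong) (auto split: split_indicator)
  then have R_fin: "energy q lborel R < \<infinity>"
    using \<rho>(1) by (simp add: density_function_def)
  have "AE x in lborel. x \<in> \<Omega> \<longrightarrow> g x = h x"
    using ae by (simp add: AE_restrict_space_iff AE_completion_iff)
  then have "AE x in lborel. x \<in> \<Omega> \<longrightarrow> g x = g' x"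
    by eventually_elim (simp add: g'_def)
  moreover have "AE y in lborel. gradient_on_line u g' i y" for i
    using line_integrable[OF Rm R_fin, of i]
  proof (eventually_elim, intro allI impI, elim conjE)
    fix y a b :: real
    assume fin: "\<forall>a b. a \<le> b \<longrightarrow> line_integral i y a b R < \<infinity>"
      and ab: "a \<le> b" and in\<Omega>: "\<forall>t\<in>{a..b}. plane_point i t y \<in> \<Omega>"
      and u: "\<bar>u (plane_point i a y)\<bar> \<noteq> \<infinity>" "\<bar>u (plane_point i b y)\<bar> \<noteq> \<infinity>"
    show "ennreal \<bar>real_of_ereal (u (plane_point i a y)) - real_of_ereal (u (plane_point i b y))\<bar>
          \<le> line_integral i y a b g'"
    proof (cases "a = b")
      case False
      let ?c = "(b - a, \<lambda>r. plane_point i (a + r) y)"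
      have c: "?c \<in> rect_curves m" using False ab in\<Omega> by (intro segment_rect_curve) auto
      have on: "a + r \<in> {a..b}" if "r \<in> {0..b - a}" for r using that by auto
      have "curve_integral ?c \<rho> \<le> curve_integral ?c R"
        using in\<Omega> on by (intro curve_integral_mono) (auto simp: R_def)
      also have "\<dots> < \<infinity>"
        using fin ab by (simp add: segment_integral)
      finally have \<rho>_fin: "curve_integral ?c \<rho> < \<infinity>" .
      have c_ug: "ug_inequality u g ?c" and c_eq: "curve_integral ?c g = curve_integral ?c h"
        using \<rho>(2)[OF c \<rho>_fin] ug[OF c] eq[OF c] by auto
      have "ennreal \<bar>real_of_ereal (u (plane_point i a y)) - real_of_ereal (u (plane_point i b y))\<bar>
          \<le> curve_integral ?c h"
        using ug_inequality_segment[OF c_ug u] unfolding c_eq .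
      also have "\<dots> \<le> curve_integral ?c g'"
        using in\<Omega> on by (intro curve_integral_mono) (auto simp: g'_def)
      also have "\<dots> = line_integral i y a b g'"
        using ab by (simp add: segment_integral)
      finally show ?thesis .
    qed simp
  qed
  ultimately show ?thesis using that g'm by blast
qed

text \<open>
  If \<open>g\<close> has mean at least \<open>1\<close> over the sections of \<open>E\<close>, then it has mean at least \<open>1\<close> over \<open>E\<close> by
  Fubini, and so has its power by \<open>ennpowr_bernoulli\<close>.
\<close>

lemma measure_le_energy:
  assumes E: "E \<in> sets lebesgue" "E \<subseteq> \<Omega>" "emeasure lebesgue E < \<infinity>" and g: "g \<in> borel_measurable \<mu>"
    and g': "g' \<in> borel_measurable borel" "AE x in lborel. x \<in> \<Omega> \<longrightarrow> g x = g' x"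
    and lines: "AE y in lborel. (\<integral>\<^sup>+t. indicator E (plane_point i t y) \<partial>lborel)
       \<le> (\<integral>\<^sup>+t. g' (plane_point i t y) * indicator E (plane_point i t y) \<partial>lborel)"
  shows "emeasure lebesgue E \<le> (\<integral>\<^sup>+x\<in>E. ennpowr (g x) q \<partial>\<mu>)"
proof -
  have g'_leb [measurable]: "g' \<in> borel_measurable lebesgue"
    by (rule measurable_completion) (simp add: g'(1))
  note [measurable] = E(1)
  have leb: "(\<integral>\<^sup>+x. F x \<partial>lborel) = (\<integral>\<^sup>+x. F x \<partial>lebesgue)" for F :: "real ^ 2 \<Rightarrow> ennreal"
    by (simp add: nn_integral_completion)
  have 1: "emeasure lebesgue E \<le> (\<integral>\<^sup>+x. g' x * indicator E x \<partial>lebesgue)"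
    using nn_integral_lines_mono[of "indicator E" "\<lambda>x. g' x * indicator E x" i] lines by (simp add: leb)
  have "ennreal q * emeasure lebesgue E \<le> ennreal q * (\<integral>\<^sup>+x. g' x * indicator E x \<partial>lebesgue)"
    using 1 by (rule mult_left_mono) simp
  also have "\<dots> = (\<integral>\<^sup>+x. ennreal q * (g' x * indicator E x) \<partial>lebesgue)"
    by (rule nn_integral_cmult[symmetric]) measurable
  also have "\<dots> \<le> (\<integral>\<^sup>+x. ennpowr (g' x) q * indicator E x + ennreal (q - 1) * indicator E x \<partial>lebesgue)"
    using ennpowr_bernoulli[OF q_gt_1] by (intro nn_integral_mono) (auto split: split_indicator)
  also have "\<dots> = (\<integral>\<^sup>+x\<in>E. ennpowr (g' x) q \<partial>lebesgue) + ennreal (q - 1) * emeasure lebesgue E"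
    by (subst nn_integral_add) (auto simp: nn_integral_cmult_indicator)
  finally have "ennreal q * emeasure lebesgue E \<le> (\<integral>\<^sup>+x\<in>E. ennpowr (g' x) q \<partial>lebesgue) + ennreal (q - 1) * emeasure lebesgue E" .
  moreover have "ennreal q * emeasure lebesgue E = emeasure lebesgue E + ennreal (q - 1) * emeasure lebesgue E"
  proof -
    have "ennreal q = 1 + ennreal (q - 1)"
      using q_gt_1 by (simp flip: ennreal_1 ennreal_plus)
    then show ?thesis by (simp add: distrib_right)
  qed
  moreover have "ennreal (q - 1) * emeasure lebesgue E \<noteq> \<infinity>"
    using E(3) by (auto simp: ennreal_mult_eq_top_iff)
  ultimately have "emeasure lebesgue E \<le> (\<integral>\<^sup>+x\<in>E. ennpowr (g' x) q \<partial>lebesgue)"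
    using ennreal_add_left_cancel_le[of "ennreal (q - 1) * emeasure lebesgue E" "emeasure lebesgue E"]
    by (simp add: add.commute)
  also have "\<dots> = (\<integral>\<^sup>+x\<in>E. ennpowr (g x) q \<partial>\<mu>)"
    unfolding \<mu>_integral leb[symmetric]
  proof (rule nn_integral_cong_AE)
    show "AE x in lborel. ennpowr (g' x) q * indicator E x = ennpowr (g x) q * indicator E x * indicator \<Omega> x"
      using g'(2) by eventually_elim (use E(2) in \<open>auto split: split_indicator\<close>)
  qed
  finally show ?thesis .
qed

end


section \<open>The taxicab metric\<close>

definition taxicab :: "(real ^ 2) metric" where
  "taxicab = metric (UNIV, \<lambda>x y. \<bar>x $ 1 - y $ 1\<bar> + \<bar>x $ 2 - y $ 2\<bar>)"

lemma Metric_space_taxicab: "Metric_space UNIV (\<lambda>x y :: real ^ 2. \<bar>x $ 1 - y $ 1\<bar> + \<bar>x $ 2 - y $ 2\<bar>)"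
  by unfold_locales (auto simp: vec_eq_iff forall_2)

lemma mspace_taxicab [simp]: "mspace taxicab = UNIV"
  and mdist_taxicab: "mdist taxicab x y = \<bar>x $ 1 - y $ 1\<bar> + \<bar>x $ 2 - y $ 2\<bar>"
  unfolding taxicab_def
  by (simp_all add: Metric_space.mspace_metric[OF Metric_space_taxicab] Metric_space.mdist_metric[OF Metric_space_taxicab])

lemma norm_le_taxicab: "norm (x - y) \<le> mdist taxicab x y"
  using norm_le_l1_cart[of "x - y"] by (simp add: mdist_taxicab sum_2)

lemma taxicab_le_norm: "mdist taxicab x y \<le> 2 * norm (x - y)"
  using component_le_norm_cart[of "x - y" 1] component_le_norm_cart[of "x - y" 2] by (simp add: mdist_taxicab)

lemma biLipschitz_taxicab: "biLipschitz_euclidean taxicab"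
proof -
  have "norm (x - y) / 2 \<le> mdist taxicab x y" for x y :: "real ^ 2"
    using norm_le_taxicab[of x y] norm_ge_zero[of "x - y"] by linarith
  then show ?thesis
    unfolding biLipschitz_euclidean_def using taxicab_le_norm by (intro conjI exI[of _ 2]) auto
qed

lemma mtopology_taxicab: "mtopology_of taxicab = euclidean"
proof -
  interpret Metric_space UNIV "mdist taxicab"
    using Metric_space_mspace_mdist[of taxicab] by simp
  have "openin mtopology S \<longleftrightarrow> open S" for S
  proof
    assume S: "openin mtopology S"
    show "open S"
      unfolding open_contains_ball
    proof
      fix x assume "x \<in> S"
      then obtain r where r: "0 < r" "mball x r \<subseteq> S" using S openin_mtopology by blast
      have "ball x (r / 2) \<subseteq> mball x r"
        using taxicab_le_norm[of x] by (fastforce simp: dist_norm intro: le_less_trans)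
      then show "\<exists>e>0. ball x e \<subseteq> S" using r by (intro exI[of _ "r / 2"]) auto
    qed
  next
    assume S: "open S"
    show "openin mtopology S"
      unfolding openin_mtopology
    proof (intro conjI allI impI)
      fix x assume "x \<in> S"
      then obtain r where r: "0 < r" "ball x r \<subseteq> S" using S open_contains_ball by blast
      have "mball x r \<subseteq> ball x r"
        by (auto simp: dist_norm intro: le_less_trans[OF norm_le_taxicab])
      then show "\<exists>r>0. mball x r \<subseteq> S" using r by blast
    qed simp
  qed
  then show ?thesis
    by (simp add: topology_eq mtopology_of_def)
qed

lemma open_ball_taxicab: "open (mball_of taxicab x r)"
  using Metric_space.openin_mball[OF Metric_space_mspace_mdist, of taxicab x r] mtopology_taxicab
  by (simp add: mball_of_def mtopology_of_def)

lemma plane_domain_taxicab: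
  assumes "open \<Omega>" "1 < q"
  shows "plane_domain (submetric taxicab \<Omega>) \<Omega> q"
proof
  show "mdist (submetric taxicab \<Omega>) (plane_point i s y) (plane_point i t y) = \<bar>s - t\<bar>" for i s t y
    using exhaust_2[of i] by (auto simp: mdist_taxicab plane_point_nth)
qed (use assms in \<open>auto simp: mtopology_of_submetric mtopology_taxicab\<close>)

context domain_space
begin

lemma upper_gradient_Lipschitz:
  assumes "0 \<le> K" and "\<And>x y. x \<in> \<Omega> \<Longrightarrow> y \<in> \<Omega> \<Longrightarrow> \<bar>u x - u y\<bar> \<le> K * mdist m x y"
  shows "upper_gradient m (\<lambda>x. ereal (u x)) (\<lambda>_. ennreal K)"
  unfolding upper_gradient_def
proof (intro conjI ballI)
  fix c assume "c \<in> rect_curves m"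
  then obtain l \<gamma> where lg: "c = (l, \<gamma>)" "(l, \<gamma>) \<in> rect_curves m" by (cases c) auto
  have l: "0 < l" using rect_curvesD(1)[OF lg(2)] .
  have "\<bar>u (\<gamma> 0) - u (\<gamma> l)\<bar> \<le> K * mdist m (\<gamma> 0) (\<gamma> l)"
    using rect_curve_in[OF lg(2)] l by (intro assms) auto
  also have "\<dots> \<le> K * l"
    using rect_curve_Lipschitz[OF lg(2), of 0 l] l assms(1) by (intro mult_left_mono) auto
  finally have "\<bar>u (\<gamma> 0) - u (\<gamma> l)\<bar> \<le> K * l" .
  moreover have "curve_integral (l, \<gamma>) (\<lambda>_. ennreal K) = ennreal (K * l)"
    using l assms(1) by (simp add: curve_integral_eq nn_integral_cmult_indicator ennreal_mult)
  ultimately show "ug_inequality (\<lambda>x. ereal (u x)) (\<lambda>_. ennreal K) c"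
    unfolding lg(1) by (intro ug_inequalityI) (auto intro: ennreal_leI)
qed simp

lemma upper_gradient_imp_wug:
  assumes "upper_gradient m u g"
  shows "weak_upper_gradient q m \<mu> u g"
proof -
  have "density_function (\<lambda>_. 0)" by (simp add: density_function_def)
  then show ?thesis
    using assms borel_imp_\<mu>[of g] unfolding weak_upper_gradient_iff upper_gradient_def by blast
qed

lemma emeasure_\<mu>_finite: "bounded \<Omega> \<Longrightarrow> emeasure \<mu> \<Omega> < \<infinity>"
  using emeasure_bounded_finite[of \<Omega>] by (simp add: emeasure_restrict_space)

lemma const_integral_finite: "bounded \<Omega> \<Longrightarrow> (\<integral>\<^sup>+x. ennreal K \<partial>\<mu>) < \<infinity>"
  using emeasure_\<mu>_finite by (simp add: space_\<mu> ennreal_mult_less_top)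

lemma Lipschitz_newtonian:
  assumes "bounded \<Omega>" "0 \<le> K" and Lip: "\<And>x y. x \<in> \<Omega> \<Longrightarrow> y \<in> \<Omega> \<Longrightarrow> \<bar>u x - u y\<bar> \<le> K * mdist m x y"
    and cont: "continuous_on \<Omega> u" and C: "\<And>x. x \<in> \<Omega> \<Longrightarrow> \<bar>u x\<bar> \<le> C"
  shows "(\<lambda>x. ereal (u x)) \<in> newtonian q m \<mu>"
proof -
  have [measurable]: "u \<in> borel_measurable \<mu>"
    using cont by (intro continuous_imp_measurable_on_sets_lebesgue) auto
  have "(\<integral>\<^sup>+x. ennpowr (e2ennreal \<bar>ereal (u x)\<bar>) q \<partial>\<mu>) \<le> (\<integral>\<^sup>+x. ennreal (C powr q) \<partial>\<mu>)"
  proof (rule nn_integral_mono)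
    fix x assume "x \<in> space \<mu>"
    then have "\<bar>u x\<bar> \<le> C" using C by (simp add: space_\<mu>)
    then show "ennpowr (e2ennreal \<bar>ereal (u x)\<bar>) q \<le> ennreal (C powr q)"
      using q_pos by (simp add: ennpowr_ennreal ennreal_leI powr_mono2)
  qed
  also have "\<dots> < \<infinity>" using assms(1) by (rule const_integral_finite)
  finally have 1: "(\<integral>\<^sup>+x. ennpowr (e2ennreal \<bar>ereal (u x)\<bar>) q \<partial>\<mu>) < \<infinity>" .
  have "(INF g\<in>{g. upper_gradient m (\<lambda>x. ereal (u x)) g}. \<integral>\<^sup>+x. ennpowr (g x) q \<partial>\<mu>) \<le> (\<integral>\<^sup>+x. ennpowr (ennreal K) q \<partial>\<mu>)"
    using upper_gradient_Lipschitz[OF assms(2) Lip] by (intro INF_lower) auto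
  also have "\<dots> < \<infinity>" using const_integral_finite[OF assms(1), of "K powr q"] assms(2) by (simp add: ennpowr_ennreal)
  finally have "(INF g\<in>{g. upper_gradient m (\<lambda>x. ereal (u x)) g}. \<integral>\<^sup>+x. ennpowr (g x) q \<partial>\<mu>) < \<infinity>" .
  with 1 show ?thesis
    by (simp add: newtonian_def newtonian_norm_def)
qed

end


section \<open>A family of harmonic functions\<close>

lemma newtonian_upper_gradient:
  assumes "f \<in> newtonian q m \<mu>"
  obtains g where "upper_gradient m f g" "energy q \<mu> g < \<infinity>"
proof -
  have "(INF g\<in>{g. upper_gradient m f g}. \<integral>\<^sup>+x. ennpowr (g x) q \<partial>\<mu>) < \<infinity>"
    using assms by (simp add: newtonian_def newtonian_norm_def)
  then show ?thesis using that by (auto simp: INF_less_iff)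
qed

locale taxicab_domain =
  fixes \<Omega> :: "(real ^ 2) set" and q :: real
  assumes open_\<Omega>': "open \<Omega>" and bounded_\<Omega>: "bounded \<Omega>" and q_gt_1': "1 < q"
begin

sublocale plane_domain "submetric taxicab \<Omega>" \<Omega> q
  using open_\<Omega>' q_gt_1' by (rule plane_domain_taxicab)

abbreviation gradient :: "(real ^ 2 \<Rightarrow> ereal) \<Rightarrow> real ^ 2 \<Rightarrow> ennreal" where
  "gradient \<equiv> min_wug q (submetric taxicab \<Omega>) \<mu>"

abbreviation is_gradient :: "(real ^ 2 \<Rightarrow> ereal) \<Rightarrow> (real ^ 2 \<Rightarrow> ennreal) \<Rightarrow> bool" where
  "is_gradient \<equiv> is_minimal_wug q (submetric taxicab \<Omega>) \<mu>"

lemma Lipschitz_newtonian_loc: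
  assumes Lip: "\<And>x y. \<bar>u x - u y\<bar> \<le> K * mdist taxicab x y" and K: "0 \<le> K" and cont: "continuous_on UNIV u"
  shows "(\<lambda>x. ereal (u x)) \<in> newtonian_loc q taxicab lebesgue \<Omega>"
  unfolding newtonian_loc_def
proof (intro CollectI ballI)
  fix x assume x: "x \<in> \<Omega>"
  interpret X: Metric_space UNIV "mdist taxicab"
    using Metric_space_mspace_mdist[of taxicab] by simp
  have "openin X.mtopology \<Omega>"
    using open_\<Omega> mtopology_taxicab by (simp add: mtopology_of_def)
  then obtain r where r: "0 < r" "mball_of taxicab x r \<subseteq> \<Omega>"
    using x X.openin_mtopology unfolding mball_of_def by auto
  define B where "B = mball_of taxicab x r"
  interpret B: plane_domain "submetric taxicab B" B q
    using open_ball_taxicab q_gt_1 unfolding B_def by (rule plane_domain_taxicab)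
  have "(\<lambda>x. ereal (u x)) \<in> newtonian q (submetric taxicab B) (restrict_space lebesgue B)"
  proof (rule B.Lipschitz_newtonian)
    show "bounded B" using bounded_subset[OF bounded_\<Omega> r(2)] by (simp add: B_def)
    show "continuous_on B u" using cont by (rule continuous_on_subset) auto
    show "\<bar>u y\<bar> \<le> \<bar>u x\<bar> + K * r" if "y \<in> B" for y
    proof -
      have "\<bar>u x - u y\<bar> \<le> K * mdist taxicab x y" by (rule Lip)
      also have "\<dots> \<le> K * r" using that K by (intro mult_left_mono) (auto simp: B_def)
      finally show ?thesis by linarith
    qed
  qed (use Lip K in auto)
  then show "\<exists>r>0. mball_of taxicab x r \<subseteq> \<Omega> \<and>
    (\<lambda>x. ereal (u x)) \<in> newtonian q (submetric taxicab (mball_of taxicab x r)) (lebesgue_on (mball_of taxicab x r))"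
    using r unfolding B_def by blast
qed

lemma Lipschitz_min_wug:
  assumes Lip: "\<And>x y. \<bar>u x - u y\<bar> \<le> K * mdist taxicab x y" and K: "0 \<le> K"
  shows "is_gradient (\<lambda>x. ereal (u x)) (gradient (\<lambda>x. ereal (u x)))"
    and "AE x in \<mu>. gradient (\<lambda>x. ereal (u x)) x \<le> ennreal K"
proof -
  have wug: "weak_upper_gradient q (submetric taxicab \<Omega>) \<mu> (\<lambda>x. ereal (u x)) (\<lambda>_. ennreal K)"
    using Lip K by (intro upper_gradient_imp_wug upper_gradient_Lipschitz) auto
  have fin: "(\<integral>\<^sup>+x. ennpowr (ennreal K) q \<partial>\<mu>) < \<infinity>"
    using const_integral_finite[OF bounded_\<Omega>, of "K powr q"] K by (simp add: ennpowr_ennreal)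
  show min: "is_gradient (\<lambda>x. ereal (u x)) (gradient (\<lambda>x. ereal (u x)))"
    using min_wug_minimal[OF wug fin] .
  have "(\<integral>\<^sup>+y\<in>B. ennpowr (ennreal K) q \<partial>\<mu>) < \<infinity>" for B
  proof -
    have "(\<integral>\<^sup>+y\<in>B. ennpowr (ennreal K) q \<partial>\<mu>) \<le> (\<integral>\<^sup>+x. ennpowr (ennreal K) q \<partial>\<mu>)"
      by (intro nn_integral_mono) (auto split: split_indicator)
    then show ?thesis using fin by (rule le_less_trans)
  qed
  then have "(\<lambda>_. ennreal K) \<in> Lq_loc q (submetric taxicab \<Omega>) \<mu>"
    by (auto simp: Lq_loc_def intro: exI[of _ 1])
  then show "AE x in \<mu>. gradient (\<lambda>x. ereal (u x)) x \<le> ennreal K"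
    using min wug unfolding is_minimal_wug_def by blast
qed

text \<open>
  In contrast to \<open>wug_on_lines\<close>, the gradient itself is locally integrable on almost every line here,
  because its energy over the whole plane is finite.  So \<open>f\<close> is finite on such a line and, by
  \<open>variation_bound_continuous\<close>, continuous.
\<close>

lemma upper_gradient_on_lines:
  assumes ug: "upper_gradient taxicab f gf" and fin: "energy q lebesgue gf < \<infinity>"
  shows "gf \<in> borel_measurable borel"
    and "AE y in lborel. \<forall>a b. a < b \<longrightarrow>
      line_integral i y a b gf < \<infinity> \<and>
      (\<forall>t\<in>{a..b}. \<bar>f (plane_point i t y)\<bar> \<noteq> \<infinity>) \<and>
      variation_bound (\<lambda>t. real_of_ereal (f (plane_point i t y))) (\<lambda>t. gf (plane_point i t y)) {a..b}" (is "AE y in lborel. \<forall>a b. a < b \<longrightarrow> ?P y a b")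
proof -
  interpret U: plane_domain taxicab UNIV q
    using plane_domain_taxicab[OF open_UNIV q_gt_1] by simp
  have "gf \<in> borel_measurable (metric_borel taxicab)" using ug by (simp add: upper_gradient_def)
  then show gf [measurable]: "gf \<in> borel_measurable borel" by (simp add: U.borel_iff)
  have fin': "energy q lborel gf < \<infinity>"
    using fin by (simp add: nn_integral_completion)
  show "AE y in lborel. \<forall>a b. a < b \<longrightarrow> ?P y a b"
    using line_integrable[OF gf fin', of i]
  proof (eventually_elim, intro allI impI)
    fix y a b :: real
    assume int: "\<forall>a b. a \<le> b \<longrightarrow> line_integral i y a b gf < \<infinity>" and ab: "a < b"
    have seg: "\<bar>f (plane_point i s y)\<bar> \<noteq> \<infinity> \<and> \<bar>f (plane_point i t y)\<bar> \<noteq> \<infinity> \<and>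
        ennreal \<bar>real_of_ereal (f (plane_point i s y)) - real_of_ereal (f (plane_point i t y))\<bar>
        \<le> line_integral i y s t gf" if st: "s < t" for s t
    proof -
      let ?c = "(t - s, \<lambda>r. plane_point i (s + r) y)"
      have c: "?c \<in> rect_curves taxicab" using st by (intro U.segment_rect_curve) auto
      have c_int: "curve_integral ?c gf = line_integral i y s t gf"
        using st by (intro segment_integral) auto
      then have "curve_integral ?c gf < \<infinity>" using int st by simp
      moreover have "ug_inequality f gf ?c" using ug c by (simp add: upper_gradient_def)
      ultimately show ?thesis
        using ug_inequality_finite[of f gf "t - s" "\<lambda>r. plane_point i (s + r) y"] by (simp add: c_int)
    qed
    have "\<bar>f (plane_point i t y)\<bar> \<noteq> \<infinity>" for t
      using seg[of t "t + 1"] by simp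
    moreover have "variation_bound (\<lambda>t. real_of_ereal (f (plane_point i t y))) (\<lambda>t. gf (plane_point i t y)) {a..b}"
      unfolding variation_bound_def
    proof (intro allI impI, elim conjE)
      fix s t :: real assume "s \<le> t"
      then show "ennreal \<bar>real_of_ereal (f (plane_point i s y)) - real_of_ereal (f (plane_point i t y))\<bar>
        \<le> line_integral i y s t gf"
        using seg[of s t] by (cases "s = t") auto
    qed
    ultimately show "?P y a b"
      using int ab by auto
  qed
qed

text \<open>
  The constant \<open>K\<close> plus the gradient of the perturbation is an upper gradient of finite energy, which
  is what the existence of a minimal weak upper gradient requires.
\<close>

lemma min_wug_perturbation:
  assumes Lip: "\<And>x y. \<bar>u x - u y\<bar> \<le> K * mdist taxicab x y" and K: "0 \<le> K"
    and ug: "upper_gradient taxicab f gf" and fin: "energy q lebesgue gf < \<infinity>"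
    and \<phi>: "\<And>x. x \<in> \<Omega> \<Longrightarrow> \<phi> x = f x"
  shows "is_gradient (\<lambda>x. ereal (u x) + \<phi> x)
    (gradient (\<lambda>x. ereal (u x) + \<phi> x))"
proof (rule min_wug_minimal)
  have gf [measurable]: "gf \<in> borel_measurable borel" by (rule upper_gradient_on_lines(1)[OF ug fin])
  have gf': "gf \<in> borel_measurable (metric_borel (submetric taxicab \<Omega>))" by (simp add: borel_iff)
  note [measurable] = gf' borel_imp_\<mu>[OF gf']
  have u_ug: "upper_gradient (submetric taxicab \<Omega>) (\<lambda>x. ereal (u x)) (\<lambda>_. ennreal K)"
    using Lip K by (intro upper_gradient_Lipschitz) auto
  have "upper_gradient (submetric taxicab \<Omega>) (\<lambda>x. ereal (u x) + \<phi> x) (\<lambda>x. ennreal K + gf x)"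
    unfolding upper_gradient_def
  proof (intro conjI ballI)
    fix c assume c: "c \<in> rect_curves (submetric taxicab \<Omega>)"
    obtain l \<gamma> where lg: "c = (l, \<gamma>)" by (cases c)
    note cc = c[unfolded lg]
    have l: "0 < l" using rect_curvesD(1)[OF cc] .
    have ends: "\<gamma> 0 \<in> \<Omega>" "\<gamma> l \<in> \<Omega>" using rect_curve_in[OF cc] l by auto
    have sum: "curve_integral c (\<lambda>x. ennreal K + gf x) = curve_integral c (\<lambda>_. ennreal K) + curve_integral c gf"
      using trace_measurable[OF cc gf'] unfolding lg curve_integral_eq
      by (subst nn_integral_add[symmetric]) (auto simp: distrib_right)
    have f: "ug_inequality f gf c" using ug rect_curves_submetric[OF c] by (simp add: upper_gradient_def)
    have u: "ug_inequality (\<lambda>x. ereal (u x)) (\<lambda>_. ennreal K) c"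
      using u_ug c by (simp add: upper_gradient_def)
    show "ug_inequality (\<lambda>x. ereal (u x) + \<phi> x) (\<lambda>x. ennreal K + gf x) c"
    proof (cases "curve_integral c gf < \<infinity>")
      case False
      then have "curve_integral c (\<lambda>x. ennreal K + gf x) = top" unfolding sum by (simp add: less_top[symmetric])
      then show ?thesis unfolding ug_inequality_def lg by simp
    next
      case True
      note ff = ug_inequality_finite[OF f[unfolded lg] True[unfolded lg]]
      obtain p r where pr: "f (\<gamma> 0) = ereal p" "f (\<gamma> l) = ereal r"
        using ff(1,2) by (cases "f (\<gamma> 0)"; cases "f (\<gamma> l)") auto
      have "ennreal \<bar>u (\<gamma> 0) - u (\<gamma> l)\<bar> \<le> curve_integral c (\<lambda>_. ennreal K)"
        using u by (simp add: ug_inequality_def lg)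
      moreover have "ennreal \<bar>p - r\<bar> \<le> curve_integral c gf" using ff(3) pr lg by simp
      moreover have "ennreal \<bar>(u (\<gamma> 0) + p) - (u (\<gamma> l) + r)\<bar> \<le> ennreal \<bar>u (\<gamma> 0) - u (\<gamma> l)\<bar> + ennreal \<bar>p - r\<bar>"
        by (simp flip: ennreal_plus)
      ultimately have "ennreal \<bar>(u (\<gamma> 0) + p) - (u (\<gamma> l) + r)\<bar> \<le> curve_integral c (\<lambda>x. ennreal K + gf x)"
        unfolding sum by (meson add_mono order_trans)
      then show ?thesis unfolding lg using pr ends by (intro ug_inequalityI) (auto simp: \<phi>)
    qed
  qed simp
  then show "weak_upper_gradient q (submetric taxicab \<Omega>) \<mu> (\<lambda>x. ereal (u x) + \<phi> x) (\<lambda>x. ennreal K + gf x)"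
    by (rule upper_gradient_imp_wug)
  have "(\<integral>\<^sup>+x. ennpowr (ennreal K + gf x) q \<partial>\<mu>) \<le> (\<integral>\<^sup>+x. ennreal (2 powr q) * (ennpowr (ennreal K) q + ennpowr (gf x) q) \<partial>\<mu>)"
    using q_pos by (intro nn_integral_mono ennpowr_add_le)
  also have "\<dots> = ennreal (2 powr q) * ((\<integral>\<^sup>+x. ennpowr (ennreal K) q \<partial>\<mu>) + energy q \<mu> gf)"
    by (subst nn_integral_cmult, measurable) (subst nn_integral_add, auto)
  also have "\<dots> < \<infinity>"
  proof -
    have "energy q \<mu> gf \<le> energy q lebesgue gf"
      unfolding \<mu>_integral nn_integral_completion by (intro nn_integral_mono) (auto split: split_indicator)
    then have "energy q \<mu> gf < \<infinity>" using fin by (rule le_less_trans)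
    moreover have "(\<integral>\<^sup>+x. ennpowr (ennreal K) q \<partial>\<mu>) < \<infinity>"
      using const_integral_finite[OF bounded_\<Omega>, of "K powr q"] K by (simp add: ennpowr_ennreal)
    ultimately show ?thesis by (simp add: ennreal_mult_less_top)
  qed
  finally show "(\<integral>\<^sup>+x. ennpowr (ennreal K + gf x) q \<partial>\<mu>) < \<infinity>" .
qed

text \<open>
  The minimal upper gradient is at most \<open>1\<close>, so the energy of the function over the set \<open>E\<close> where the
  perturbation is not zero is at most the area of \<open>E\<close>.  On almost every horizontal line the
  perturbed function restricts to \<open>\<sigma> * t + F t\<close> up to a constant, where \<open>F\<close> vanishes off the domain,
  and \<open>length_le_integral_nonzero\<close> bounds the integral of its gradient over the section of \<open>E\<close> from
  below by the length of that section.  By \<open>measure_le_energy\<close> the perturbed energy over \<open>E\<close> is at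
  least the area of \<open>E\<close>.
\<close>

theorem harmonic_affine_plus_Lipschitz:
  fixes h :: "real \<Rightarrow> real"
  assumes \<sigma>: "\<bar>\<sigma>\<bar> = 1" and h: "\<And>s t. \<bar>h s - h t\<bar> \<le> \<bar>s - t\<bar>"
  shows "q_harmonic q taxicab lebesgue \<Omega> (\<lambda>x. \<sigma> * x $ 1 + h (x $ 2))"
proof -
  define u :: "real ^ 2 \<Rightarrow> real" where "u x = \<sigma> * x $ 1 + h (x $ 2)" for x
  have Lip: "\<bar>u x - u y\<bar> \<le> 1 * mdist taxicab x y" for x y
  proof -
    have "\<bar>u x - u y\<bar> \<le> \<bar>\<sigma> * (x $ 1 - y $ 1)\<bar> + \<bar>h (x $ 2) - h (y $ 2)\<bar>"
      by (simp add: u_def algebra_simps)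
    then show ?thesis using h[of "x $ 2" "y $ 2"] \<sigma> by (simp add: abs_mult mdist_taxicab)
  qed
  have cont: "continuous_on UNIV u"
  proof -
    have "1-lipschitz_on UNIV h"
      using h by (intro lipschitz_onI) (auto simp: dist_real_def)
    then have "continuous_on UNIV h" by (rule lipschitz_on_continuous_on)
    then have "continuous_on UNIV (\<lambda>x :: real ^ 2. h (x $ 2))"
      by (rule continuous_on_compose2) (auto intro!: continuous_intros)
    then show ?thesis unfolding u_def by (intro continuous_intros)
  qed
  have "q_harmonic q taxicab lebesgue \<Omega> u"
    unfolding q_harmonic_def
  proof (intro conjI ballI)
    show "continuous_map (subtopology (mtopology_of taxicab) \<Omega>) euclideanreal u"
      using continuous_on_subset[OF cont, of \<Omega>] by (simp add: mtopology_taxicab)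
    show "(\<lambda>x. ereal (u x)) \<in> newtonian_loc q taxicab lebesgue \<Omega>"
      using Lip cont by (intro Lipschitz_newtonian_loc[where K = 1]) auto
  next
    fix \<phi> assume "\<phi> \<in> newtonian_zero q taxicab lebesgue \<Omega>"
    then obtain f where f: "f \<in> newtonian q taxicab lebesgue" "\<And>x. x \<notin> \<Omega> \<Longrightarrow> f x = 0" "\<And>x. x \<in> \<Omega> \<Longrightarrow> \<phi> x = f x"
      by (auto simp: newtonian_zero_def)
    define E where "E = {x\<in>\<Omega>. \<phi> x \<noteq> 0}"
    have E_iff: "x \<in> E \<longleftrightarrow> f x \<noteq> 0" for x by (cases "x \<in> \<Omega>") (auto simp: E_def f(2,3))
    have [measurable]: "f \<in> borel_measurable lebesgue" using f(1) by (simp add: newtonian_def)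
    have E: "E \<in> sets lebesgue" "E \<subseteq> \<Omega>" "emeasure lebesgue E < \<infinity>"
    proof -
      have "E = {x\<in>space lebesgue. f x \<noteq> 0}" using E_iff by auto
      also have "\<dots> \<in> sets lebesgue" by measurable
      finally show "E \<in> sets lebesgue" .
      show "E \<subseteq> \<Omega>" by (auto simp: E_def)
      have "emeasure lebesgue E \<le> emeasure lebesgue \<Omega>" using \<open>E \<subseteq> \<Omega>\<close> by (intro emeasure_mono) auto
      also have "\<dots> < \<infinity>" using emeasure_bounded_finite[OF bounded_\<Omega>] by simp
      finally show "emeasure lebesgue E < \<infinity>" .
    qed
    obtain gf where ug: "upper_gradient taxicab f gf" and gf_fin: "energy q lebesgue gf < \<infinity>"
      using newtonian_upper_gradient[OF f(1)] .
    let ?gu = "gradient (\<lambda>x. ereal (u x))"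
    let ?g = "gradient (\<lambda>x. ereal (u x) + \<phi> x)"
    have "(\<integral>\<^sup>+x\<in>E. ennpowr (?gu x) q \<partial>\<mu>) \<le> (\<integral>\<^sup>+x\<in>E. 1 \<partial>\<mu>)"
    proof (rule nn_integral_mono_AE)
      show "AE x in \<mu>. ennpowr (?gu x) q * indicator E x \<le> 1 * indicator E x"
        using Lipschitz_min_wug(2)[where u = u and K = 1, OF Lip zero_le_one]
      proof eventually_elim
        case (elim x)
        then have "ennpowr (?gu x) q \<le> ennpowr 1 q" using q_pos by (intro ennpowr_mono) auto
        then show ?case by (simp split: split_indicator)
      qed
    qed
    also have "\<dots> = emeasure lebesgue E"
    proof -
      have "(\<integral>\<^sup>+x\<in>E. 1 \<partial>\<mu>) = (\<integral>\<^sup>+x. indicator E x \<partial>lebesgue)"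
        unfolding \<mu>_integral nn_integral_completion using E(2) by (intro nn_integral_cong) (auto split: split_indicator)
      then show ?thesis using E(1) by simp
    qed
    also have "\<dots> \<le> (\<integral>\<^sup>+x\<in>E. ennpowr (?g x) q \<partial>\<mu>)"
    proof -
      have wug: "weak_upper_gradient q (submetric taxicab \<Omega>) \<mu> (\<lambda>x. ereal (u x) + \<phi> x) ?g"
        using min_wug_perturbation[where u = u and K = 1, OF Lip _ ug gf_fin f(3)] by (auto simp: is_minimal_wug_def)
      have g\<mu>: "?g \<in> borel_measurable \<mu>" using wug by (simp add: weak_upper_gradient_def)
      obtain g' where g': "g' \<in> borel_measurable borel" "AE x in lborel. x \<in> \<Omega> \<longrightarrow> ?g x = g' x"
        and g'_lines: "\<And>i. AE y in lborel. gradient_on_line (\<lambda>x. ereal (u x) + \<phi> x) g' i y"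
        using wug_on_lines[OF wug] by blast
      \<comment> \<open>The segment from \<open>-R\<close> to \<open>R\<close> on a horizontal line ends outside the domain, where \<open>f\<close> is zero.\<close>
      obtain R where R: "0 < R" "\<And>x. x \<in> \<Omega> \<Longrightarrow> norm x < R"
        using bounded_\<Omega> bounded_pos_less by metis
      have in_R: "\<bar>t\<bar> < R" if "plane_point 1 t y \<in> \<Omega>" for t y
        using component_le_norm_cart[of "plane_point 1 t y" 1] R(2)[OF that] by (simp add: plane_point_nth)
      have [measurable]: "gf \<in> borel_measurable borel" by (rule upper_gradient_on_lines(1)[OF ug gf_fin])
      note [measurable] = g'(1)
      have "AE y in lborel. (\<integral>\<^sup>+t. indicator E (plane_point 1 t y) \<partial>lborel)
         \<le> (\<integral>\<^sup>+t. g' (plane_point 1 t y) * indicator E (plane_point 1 t y) \<partial>lborel)"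
        using g'_lines[of 1] upper_gradient_on_lines(2)[OF ug gf_fin, of 1]
      proof eventually_elim
        case (elim y)
        define F where "F t = real_of_ereal (f (plane_point 1 t y))" for t
        have gf_int: "line_integral 1 y (-R) R gf < \<infinity>"
          and finf: "\<And>t. t \<in> {-R..R} \<Longrightarrow> \<bar>f (plane_point 1 t y)\<bar> \<noteq> \<infinity>"
          and Fv: "variation_bound F (\<lambda>t. gf (plane_point 1 t y)) {-R..R}"
          using elim(2)[THEN spec, THEN spec, THEN mp, of "- R" R] R(1) unfolding F_def by auto
        have set_eq: "{t\<in>{-R..R}. F t \<noteq> 0} = {t. plane_point 1 t y \<in> E}"
        proof (intro set_eqI iffI)
          fix t assume "t \<in> {t\<in>{-R..R}. F t \<noteq> 0}"
          then show "t \<in> {t. plane_point 1 t y \<in> E}" by (auto simp: F_def E_iff)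
        next
          fix t assume t: "t \<in> {t. plane_point 1 t y \<in> E}"
          then have tR: "t \<in> {-R..R}" using in_R E(2) by fastforce
          then show "t \<in> {t\<in>{-R..R}. F t \<noteq> 0}"
            using t finf[OF tR] by (cases "f (plane_point 1 t y)") (auto simp: F_def E_iff)
        qed
        have "variation_bound (\<lambda>t. \<sigma> * t + F t) (\<lambda>t. g' (plane_point 1 t y)) {t\<in>{-R..R}. F t \<noteq> 0}"
          unfolding variation_bound_def
        proof (intro allI impI, elim conjE)
          fix s t assume st: "s \<le> t" "{s..t} \<subseteq> {t\<in>{-R..R}. F t \<noteq> 0}"
          have on: "plane_point 1 r y \<in> \<Omega> \<and> \<phi> (plane_point 1 r y) = ereal (F r)" if "r \<in> {s..t}" for r
          proof -
            have "r \<in> {-R..R}" "plane_point 1 r y \<in> \<Omega>" using st(2) that set_eq E(2) by blast+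
            then show ?thesis using finf[of r] f(3) by (auto simp: F_def ereal_real)
          qed
          have "ennreal \<bar>(\<sigma> * s + h y + F s) - (\<sigma> * t + h y + F t)\<bar> \<le> line_integral 1 y s t g'"
            using elim(1)[rule_format, of s t] on st(1) by (simp add: u_def plane_point_nth)
          then show "ennreal \<bar>\<sigma> * s + F s - (\<sigma> * t + F t)\<bar> \<le> line_integral 1 y s t g'"
            by (simp add: algebra_simps)
        qed
        moreover have "plane_point 1 R y \<notin> \<Omega>" "plane_point 1 (- R) y \<notin> \<Omega>"
          using in_R[of R y] in_R[of "- R" y] R(1) by auto
        then have "F (-R) = 0" "F R = 0"
          by (simp_all add: F_def f(2))
        moreover have "continuous_on {-R..R} F"
          using Fv gf_int by (rule variation_bound_continuous[rotated]) measurable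
        ultimately have "(\<integral>\<^sup>+x. indicator {t\<in>{-R..R}. F t \<noteq> 0} x \<partial>lborel)
            \<le> (\<integral>\<^sup>+x\<in>{t\<in>{-R..R}. F t \<noteq> 0}. g' (plane_point 1 x y) \<partial>lborel)"
          using R(1) Fv gf_int \<sigma> by (intro length_le_integral_nonzero) auto
        then show ?case unfolding set_eq by (simp add: indicator_def)
      qed
      then show ?thesis using measure_le_energy[OF E g\<mu> g'] by blast
    qed
    finally show "(\<integral>\<^sup>+x\<in>{x\<in>\<Omega>. \<phi> x \<noteq> 0}. ennpowr (?gu x) q \<partial>\<mu>) \<le> (\<integral>\<^sup>+x\<in>{x\<in>\<Omega>. \<phi> x \<noteq> 0}. ennpowr (?g x) q \<partial>\<mu>)"
      unfolding E_def .
  qed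
  then show ?thesis unfolding u_def .
qed

end


section \<open>Failure of harmonicity for the absolute value of a coordinate\<close>

context domain_space
begin

lemma variation_bound_Lipschitz:
  assumes c: "(l, \<gamma>) \<in> rect_curves m" and K: "0 \<le> K"
    and Lip: "\<And>s t. s \<in> I \<Longrightarrow> t \<in> I \<Longrightarrow> \<bar>u (\<gamma> s) - u (\<gamma> t)\<bar> \<le> K * mdist m (\<gamma> s) (\<gamma> t)" and I: "I \<subseteq> {0..l}"
  shows "variation_bound (\<lambda>t. u (\<gamma> t)) (\<lambda>_. ennreal K) I"
  unfolding variation_bound_def
proof (intro allI impI, elim conjE)
  fix s t :: real assume st: "s \<le> t" "{s..t} \<subseteq> I"
  then have st': "0 \<le> s" "t \<le> l" "s \<in> I" "t \<in> I" using I by (auto simp: subset_iff)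
  have "\<bar>u (\<gamma> s) - u (\<gamma> t)\<bar> \<le> K * mdist m (\<gamma> s) (\<gamma> t)" using st' by (intro Lip)
  also have "\<dots> \<le> K * (t - s)"
    using rect_curve_Lipschitz[OF c st'(1) st(1) st'(2)] K by (intro mult_left_mono)
  finally have "ennreal \<bar>u (\<gamma> s) - u (\<gamma> t)\<bar> \<le> ennreal (K * (t - s))" by (rule ennreal_leI)
  also have "\<dots> = (\<integral>\<^sup>+x\<in>{s..t}. ennreal K \<partial>lborel)"
    using st K by (simp add: nn_integral_cmult_indicator ennreal_mult)
  finally show "ennreal \<bar>u (\<gamma> s) - u (\<gamma> t)\<bar> \<le> (\<integral>\<^sup>+x\<in>{s..t}. ennreal K \<partial>lborel)" .
qed

text \<open>
  A smaller Lipschitz constant on an open set may be used on that set alone: this is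
  \<open>variation_bound_open\<close> along each curve.
\<close>

lemma upper_gradient_Lipschitz_open:
  assumes K: "0 \<le> K" and Lip: "\<And>x y. x \<in> \<Omega> \<Longrightarrow> y \<in> \<Omega> \<Longrightarrow> \<bar>u x - u y\<bar> \<le> K * mdist m x y"
    and A: "open A" and L: "0 \<le> L"
    and Lip': "\<And>x y. x \<in> \<Omega> \<inter> A \<Longrightarrow> y \<in> \<Omega> \<inter> A \<Longrightarrow> \<bar>u x - u y\<bar> \<le> L * mdist m x y"
  shows "upper_gradient m (\<lambda>x. ereal (u x)) (\<lambda>x. if x \<in> A then ennreal L else ennreal K)"
  unfolding upper_gradient_def
proof (intro conjI ballI)
  have [measurable]: "A \<in> sets borel" using A by (rule borel_open)
  show g: "(\<lambda>x. if x \<in> A then ennreal L else ennreal K) \<in> borel_measurable (metric_borel m)"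
    unfolding borel_iff by measurable
  fix c assume "c \<in> rect_curves m"
  then obtain l \<gamma> where lg: "c = (l, \<gamma>)" and cc: "(l, \<gamma>) \<in> rect_curves m" by (cases c) auto
  have l: "0 < l" using rect_curvesD(1)[OF cc] .
  have "openin (top_of_set {0..l}) ({0..l} \<inter> \<gamma> -` A)"
    using continuous_openin_preimage_gen[OF rect_curve_continuous[OF cc] A] .
  then obtain V where V: "open V" "{0..l} \<inter> \<gamma> -` A = {0..l} \<inter> V"
    by (auto simp: openin_open)
  have VA: "\<gamma> t \<in> A \<longleftrightarrow> t \<in> V" if "t \<in> {0..l}" for t
    using V(2) that by blast
  have "ennreal \<bar>u (\<gamma> 0) - u (\<gamma> l)\<bar> \<le> (\<integral>\<^sup>+t\<in>{0..l}. (if t \<in> V then ennreal L else ennreal K) \<partial>lborel)"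
  proof (rule variation_bound_open)
    show "variation_bound (\<lambda>t. u (\<gamma> t)) (\<lambda>_. ennreal K) {0..l}"
      using rect_curve_in[OF cc] by (intro variation_bound_Lipschitz[OF cc] K Lip) auto
    show "variation_bound (\<lambda>t. u (\<gamma> t)) (\<lambda>_. ennreal L) ({0..l} \<inter> V)"
      by (intro variation_bound_Lipschitz[OF cc] L Lip') (simp_all add: VA rect_curve_in[OF cc])
    show "(\<integral>\<^sup>+x\<in>{0..l}. ennreal K \<partial>lborel) < \<infinity>"
      using l by (simp add: nn_integral_cmult_indicator ennreal_mult_less_top)
  qed (use V l in auto)
  also have "\<dots> = curve_integral (l, \<gamma>) (\<lambda>x. if x \<in> A then ennreal L else ennreal K)"
    unfolding curve_integral_eq by (intro nn_integral_cong) (simp add: VA split: split_indicator)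
  finally show "ug_inequality (\<lambda>x. ereal (u x)) (\<lambda>x. if x \<in> A then ennreal L else ennreal K) c"
    unfolding lg by (intro ug_inequalityI) auto
qed

text \<open>
  The gradient may be replaced by \<open>0\<close> on the zero set, although that set is closed.  It makes the
  energy of a compactly supported Lipschitz function finite.
\<close>

lemma upper_gradient_Lipschitz_nonzero:
  assumes K: "0 \<le> K" and Lip: "\<And>x y. x \<in> \<Omega> \<Longrightarrow> y \<in> \<Omega> \<Longrightarrow> \<bar>u x - u y\<bar> \<le> K * mdist m x y"
    and cont: "continuous_on UNIV u"
  shows "upper_gradient m (\<lambda>x. ereal (u x)) (\<lambda>x. ennreal K * indicator {x. u x \<noteq> 0} x)"
  unfolding upper_gradient_def
proof (intro conjI ballI)
  have [measurable]: "u \<in> borel_measurable borel" using cont by (rule borel_measurable_continuous_onI)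
  show "(\<lambda>x. ennreal K * indicator {x. u x \<noteq> 0} x) \<in> borel_measurable (metric_borel m)"
    unfolding borel_iff by measurable
  fix c assume "c \<in> rect_curves m"
  then obtain l \<gamma> where lg: "c = (l, \<gamma>)" and cc: "(l, \<gamma>) \<in> rect_curves m" by (cases c) auto
  have l: "0 < l" using rect_curvesD(1)[OF cc] .
  have "continuous_on {0..l} (\<lambda>t. u (\<gamma> t))"
    using cont rect_curve_continuous[OF cc] by (rule continuous_on_compose2) auto
  moreover have "variation_bound (\<lambda>t. u (\<gamma> t)) (\<lambda>_. ennreal K) {0..l}"
    using rect_curve_in[OF cc] by (intro variation_bound_Lipschitz[OF cc] K Lip) auto
  ultimately have "variation_bound (\<lambda>t. u (\<gamma> t)) (\<lambda>t. ennreal K * indicator {t. u (\<gamma> t) \<noteq> 0} t) {0..l}"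
    by (intro variation_bound_nonzero) auto
  then have "ennreal \<bar>u (\<gamma> 0) - u (\<gamma> l)\<bar> \<le> (\<integral>\<^sup>+t\<in>{0..l}. ennreal K * indicator {t. u (\<gamma> t) \<noteq> 0} t \<partial>lborel)"
    using l by (intro variation_boundD) auto
  also have "\<dots> = curve_integral (l, \<gamma>) (\<lambda>x. ennreal K * indicator {x. u x \<noteq> 0} x)"
    unfolding curve_integral_eq by (intro nn_integral_cong) (auto split: split_indicator)
  finally show "ug_inequality (\<lambda>x. ereal (u x)) (\<lambda>x. ennreal K * indicator {x. u x \<noteq> 0} x) c"
    unfolding lg by (intro ug_inequalityI) auto
qed

end

lemma emeasure_rectangle:
  assumes "a \<le> b" "c \<le> d"
  shows "emeasure lborel {x :: real ^ 2. a \<le> x $ 1 \<and> x $ 1 \<le> b \<and> c \<le> x $ 2 \<and> x $ 2 \<le> d} = ennreal ((b - a) * (d - c))"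
    (is "emeasure lborel ?R = _")
proof -
  have [measurable]: "?R \<in> sets borel" by measurable
  have "emeasure lborel ?R = (\<integral>\<^sup>+y. \<integral>\<^sup>+t. indicator ?R (plane_point 1 t y) \<partial>lborel \<partial>lborel)"
    by (subst nn_integral_lines[symmetric]) auto
  also have "\<dots> = (\<integral>\<^sup>+y. \<integral>\<^sup>+t. indicator {c..d} y * indicator {a..b} t \<partial>lborel \<partial>lborel)"
    by (intro nn_integral_cong) (auto simp: plane_point_nth split: split_indicator)
  also have "\<dots> = ennreal ((b - a) * (d - c))"
    using assms by (simp add: nn_integral_cmult nn_integral_multc ennreal_mult mult.commute)
  finally show ?thesis .
qed

lemma open_punctured_disc: "open punctured_disc"
proof -
  have "punctured_disc = ball 0 1 - {0}" by (auto simp: punctured_disc_def)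
  then show ?thesis by (metis open_ball open_delete)
qed

lemma bounded_punctured_disc: "bounded punctured_disc"
  by (rule bounded_subset[of "ball 0 1"]) (auto simp: punctured_disc_def)

lemma taxicab_domain_punctured_disc: "1 < q \<Longrightarrow> taxicab_domain punctured_disc q"
  by unfold_locales (auto simp: open_punctured_disc bounded_punctured_disc)

text \<open>
  The valley of \<open>|x\<^sub>2|\<close> is filled up around the point \<open>(1/2, 0)\<close> to the function
  \<open>max |x\<^sub>2| (1/128 - |x\<^sub>1 - 1/2| / 32)\<close>.  On the set \<open>A\<close> where this is a change, the gradient drops from
  \<open>1\<close> to \<open>1/32\<close>.  The new energy over \<open>A\<close> is at most \<open>1/32\<close> of the area of \<open>A\<close>, hence at most \<open>1/4096\<close>, as
  \<open>A\<close> lies in the rectangle \<open>Q\<close> of area \<open>1/128\<close>.  The old energy is at least \<open>1/2048\<close>, since \<open>A\<close>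
  contains the rectangle \<open>R\<close> of that area, on whose vertical sections \<open>|x\<^sub>2|\<close> has slope \<open>1\<close>.
\<close>

theorem abs_second_coordinate_not_harmonic:
  assumes q: "1 < q"
  shows "\<not> q_harmonic q taxicab lebesgue punctured_disc (\<lambda>x. \<bar>x $ 2\<bar>)"
proof
  assume harm: "q_harmonic q taxicab lebesgue punctured_disc (\<lambda>x. \<bar>x $ 2\<bar>)"
  interpret taxicab_domain punctured_disc q using q by (rule taxicab_domain_punctured_disc)
  interpret U: plane_domain taxicab UNIV q using plane_domain_taxicab[OF open_UNIV q] by simp
  define s :: "real ^ 2 \<Rightarrow> real" where "s x = \<bar>x $ 2\<bar>" for x
  define \<psi> :: "real ^ 2 \<Rightarrow> real" where "\<psi> x = 1 / 128 - \<bar>x $ 1 - 1 / 2\<bar> / 32 - \<bar>x $ 2\<bar>" for x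
  define f :: "real ^ 2 \<Rightarrow> real" where "f x = max 0 (\<psi> x)" for x
  define A where "A = {x. 0 < \<psi> x}"
  define R :: "(real ^ 2) set" where "R = {x. 3 / 8 \<le> x $ 1 \<and> x $ 1 \<le> 5 / 8 \<and> 0 \<le> x $ 2 \<and> x $ 2 \<le> 1 / 512}"
  define Q :: "(real ^ 2) set" where "Q = {x. 1 / 4 \<le> x $ 1 \<and> x $ 1 \<le> 3 / 4 \<and> - 1 / 128 \<le> x $ 2 \<and> x $ 2 \<le> 1 / 128}"
  have A_eq: "A = {x. f x \<noteq> 0}" by (auto simp: A_def f_def)
  have cont_f: "continuous_on UNIV f"
    unfolding f_def \<psi>_def divide_inverse by (intro continuous_intros)
  have "open A"
    unfolding A_def \<psi>_def divide_inverse by (intro open_Collect_less continuous_intros)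
  then have A_borel [measurable]: "A \<in> sets borel" by (rule borel_open)
  have [measurable]: "R \<in> sets borel" "Q \<in> sets borel" unfolding R_def Q_def by measurable
  have "R \<subseteq> A"
  proof
    fix x assume "x \<in> R"
    then have "\<bar>x $ 1 - 1 / 2\<bar> \<le> 1 / 8" "\<bar>x $ 2\<bar> \<le> 1 / 512" unfolding R_def mem_Collect_eq by linarith+
    then show "x \<in> A" unfolding A_def \<psi>_def by simp
  qed
  have "A \<subseteq> Q"
  proof
    fix x assume "x \<in> A"
    then have "\<bar>x $ 1 - 1 / 2\<bar> / 32 + \<bar>x $ 2\<bar> < 1 / 128" unfolding A_def \<psi>_def by simp
    moreover have "a \<le> 1 / 4 \<and> b \<le> 1 / 128" if "a / 32 + b < 1 / 128" "0 \<le> a" "0 \<le> b" for a b :: real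
      using that by linarith
    ultimately have "\<bar>x $ 1 - 1 / 2\<bar> \<le> 1 / 4" "\<bar>x $ 2\<bar> \<le> 1 / 128"
      using abs_ge_zero by blast+
    then show "x \<in> Q" unfolding Q_def mem_Collect_eq by linarith
  qed
  have "A \<subseteq> punctured_disc"
  proof
    fix x assume x: "x \<in> A"
    then have "x \<in> Q" using \<open>A \<subseteq> Q\<close> by blast
    then have "0 < \<bar>x $ 1\<bar>" "\<bar>x $ 1\<bar> + \<bar>x $ 2\<bar> < 1" unfolding Q_def mem_Collect_eq by linarith+
    then show "x \<in> punctured_disc"
      using component_le_norm_cart[of x 1] norm_le_l1_cart[of x] by (auto simp: punctured_disc_def sum_2)
  qed
  have A_fin: "emeasure lborel A \<le> ennreal (1 / 128)"
  proof -
    have "emeasure lborel A \<le> emeasure lborel Q" using \<open>A \<subseteq> Q\<close> by (intro emeasure_mono) auto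
    also have "\<dots> = ennreal (1 / 128)"
      unfolding Q_def using emeasure_rectangle[of "1 / 4" "3 / 4" "- 1 / 128" "1 / 128"] by simp
    finally show ?thesis .
  qed
  have R_meas: "emeasure lborel R = ennreal (1 / 2048)"
    unfolding R_def using emeasure_rectangle[of "3 / 8" "5 / 8" "0" "1 / 512"] by simp

  have s_Lip: "\<bar>s x - s y\<bar> \<le> 1 * mdist taxicab x y" for x y
    by (auto simp: s_def mdist_taxicab)
  have f_Lip: "\<bar>f x - f y\<bar> \<le> 1 * mdist taxicab x y" for x y
  proof -
    have "\<bar>f x - f y\<bar> \<le> \<bar>\<psi> x - \<psi> y\<bar>" by (auto simp: f_def)
    also have "\<dots> \<le> \<bar>x $ 1 - y $ 1\<bar> / 32 + \<bar>x $ 2 - y $ 2\<bar>"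
    proof -
      have "\<bar>\<bar>x $ 1 - 1 / 2\<bar> - \<bar>y $ 1 - 1 / 2\<bar>\<bar> \<le> \<bar>x $ 1 - y $ 1\<bar>" "\<bar>\<bar>x $ 2\<bar> - \<bar>y $ 2\<bar>\<bar> \<le> \<bar>x $ 2 - y $ 2\<bar>"
        by linarith+
      then show ?thesis unfolding \<psi>_def by (simp add: abs_le_iff)
    qed
    also have "\<dots> \<le> mdist taxicab x y"
      using abs_ge_zero[of "x $ 1 - y $ 1"] unfolding mdist_taxicab by (simp add: field_simps)
    finally show ?thesis by simp
  qed
  have f_ug: "upper_gradient taxicab (\<lambda>x. ereal (f x)) (indicator A)"
    using U.upper_gradient_Lipschitz_nonzero[where u = f and K = 1, OF _ f_Lip cont_f] by (simp add: A_eq)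
  have ind: "ennpowr (indicator A x) q = indicator A x" for x
    by (auto split: split_indicator)
  have A_int: "(\<integral>\<^sup>+x. indicator A x \<partial>lebesgue) < \<infinity>"
    using A_fin unfolding nn_integral_completion by (simp add: le_less_trans)
  have f_newt: "(\<lambda>x. ereal (f x)) \<in> newtonian q taxicab lebesgue"
  proof -
    have "(\<integral>\<^sup>+x. ennpowr (e2ennreal \<bar>ereal (f x)\<bar>) q \<partial>lebesgue) \<le> (\<integral>\<^sup>+x. indicator A x \<partial>lebesgue)"
    proof (rule nn_integral_mono)
      fix x
      have "1 / 128 - a / 32 - b \<le> 1" if "0 \<le> a" "0 \<le> b" for a b :: real using that by linarith
      then have "\<psi> x \<le> 1" unfolding \<psi>_def by (metis abs_ge_zero)
      then have "\<bar>f x\<bar> \<le> 1" by (simp add: f_def)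
      then have "ennpowr (ennreal \<bar>f x\<bar>) q \<le> ennpowr 1 q"
        using q by (intro ennpowr_mono) (auto simp: ennreal_le_1)
      then show "ennpowr (e2ennreal \<bar>ereal (f x)\<bar>) q \<le> indicator A x"
        by (auto simp: A_eq split: split_indicator)
    qed
    also note A_int
    finally have 1: "(\<integral>\<^sup>+x. ennpowr (e2ennreal \<bar>ereal (f x)\<bar>) q \<partial>lebesgue) < \<infinity>" .
    have "(INF g\<in>{g. upper_gradient taxicab (\<lambda>x. ereal (f x)) g}. \<integral>\<^sup>+x. ennpowr (g x) q \<partial>lebesgue)
        \<le> (\<integral>\<^sup>+x. ennpowr (indicator A x) q \<partial>lebesgue)"
      using f_ug by (intro INF_lower) auto
    also have "\<dots> < \<infinity>" unfolding ind by (rule A_int)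
    finally have 2: "(INF g\<in>{g. upper_gradient taxicab (\<lambda>x. ereal (f x)) g}. \<integral>\<^sup>+x. ennpowr (g x) q \<partial>lebesgue) < \<infinity>" .
    have "f \<in> borel_measurable lebesgue"
      using borel_measurable_continuous_onI[OF cont_f] by (intro measurable_completion) simp
    then show ?thesis using 1 2 by (simp add: newtonian_def newtonian_norm_def)
  qed
  have f_int: "(\<integral>\<^sup>+x. ennpowr (indicator A x) q \<partial>lebesgue) < \<infinity>" unfolding ind by (rule A_int)
  have "(\<lambda>x. ereal (f x)) \<in> newtonian_zero q taxicab lebesgue punctured_disc"
    unfolding newtonian_zero_def using \<open>A \<subseteq> punctured_disc\<close> A_eq
    by (intro CollectI bexI[OF _ f_newt]) auto
  moreover have "{x\<in>punctured_disc. ereal (f x) \<noteq> 0} = A"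
    using \<open>A \<subseteq> punctured_disc\<close> A_eq by auto
  moreover define gs where "gs = gradient (\<lambda>x. ereal (s x))"
  moreover define gF where "gF = gradient (\<lambda>x. ereal (s x) + ereal (f x))"
  ultimately have energy: "(\<integral>\<^sup>+x\<in>A. ennpowr (gs x) q \<partial>\<mu>) \<le> (\<integral>\<^sup>+x\<in>A. ennpowr (gF x) q \<partial>\<mu>)"
    using harm unfolding q_harmonic_def s_def by fastforce

  have "ennreal (1 / 2048) \<le> (\<integral>\<^sup>+x\<in>R. ennpowr (gs x) q \<partial>\<mu>)"
  proof -
    have wug: "weak_upper_gradient q (submetric taxicab punctured_disc) \<mu> (\<lambda>x. ereal (s x)) gs"
      using Lipschitz_min_wug(1)[where u = s and K = 1, OF s_Lip] by (auto simp: is_minimal_wug_def gs_def)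
    have gs\<mu>: "gs \<in> borel_measurable \<mu>" using wug by (simp add: weak_upper_gradient_def)
    obtain g' where g': "g' \<in> borel_measurable borel" "AE x in lborel. x \<in> punctured_disc \<longrightarrow> gs x = g' x"
      and lines: "\<And>i. AE y in lborel. gradient_on_line (\<lambda>x. ereal (s x)) g' i y"
      using wug_on_lines[OF wug] by blast
    have "AE y in lborel. (\<integral>\<^sup>+t. indicator R (plane_point 2 t y) \<partial>lborel)
         \<le> (\<integral>\<^sup>+t. g' (plane_point 2 t y) * indicator R (plane_point 2 t y) \<partial>lborel)"
      using lines[of 2]
    proof eventually_elim
      case (elim y)
      show ?case
      proof (cases "3 / 8 \<le> y \<and> y \<le> 5 / 8")
        case True
        have eq: "indicator R (plane_point 2 t y) = (indicator {0..1 / 512} t :: ennreal)" for t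
          using True by (auto simp: R_def plane_point_nth split: split_indicator)
        have "plane_point 2 t y \<in> punctured_disc" if "t \<in> {0..1 / 512}" for t
        proof -
          have "plane_point 2 t y \<in> R" using True that by (auto simp: R_def plane_point_nth)
          then show ?thesis using \<open>R \<subseteq> A\<close> \<open>A \<subseteq> punctured_disc\<close> by blast
        qed
        then show ?thesis
          using elim[THEN spec, THEN spec, THEN mp, of 0 "1 / 512"] by (simp add: eq s_def plane_point_nth)
      next
        case False
        then have "indicator R (plane_point 2 t y) = (0 :: ennreal)" for t
          by (auto simp: R_def plane_point_nth split: split_indicator)
        then show ?thesis by simp
      qed
    qed
    moreover have "R \<in> sets lebesgue" "R \<subseteq> punctured_disc" "emeasure lebesgue R = ennreal (1 / 2048)"
      using \<open>R \<subseteq> A\<close> \<open>A \<subseteq> punctured_disc\<close> R_meas by auto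
    ultimately show ?thesis
      using measure_le_energy[of R gs g' 2] gs\<mu> g' by auto
  qed
  also have "\<dots> \<le> (\<integral>\<^sup>+x\<in>A. ennpowr (gs x) q \<partial>\<mu>)"
    using \<open>R \<subseteq> A\<close> by (intro nn_integral_mono) (auto split: split_indicator)
  also note energy
  also have "(\<integral>\<^sup>+x\<in>A. ennpowr (gF x) q \<partial>\<mu>) \<le> (\<integral>\<^sup>+x. ennreal (1 / 32) * indicator A x \<partial>\<mu>)"
  proof -
    define g2 :: "real ^ 2 \<Rightarrow> ennreal" where "g2 x = (if x \<in> A then ennreal (1 / 32) else ennreal 1)" for x
    have "upper_gradient (submetric taxicab punctured_disc) (\<lambda>x. ereal (s x + f x)) g2"
      unfolding g2_def
    proof (rule upper_gradient_Lipschitz_open[OF _ _ \<open>open A\<close>])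
      have eq: "s x + f x = max \<bar>x $ 2\<bar> (1 / 128 - \<bar>x $ 1 - 1 / 2\<bar> / 32)" for x
        by (auto simp: s_def f_def \<psi>_def)
      have cone: "\<bar>1 / 128 - \<bar>x $ 1 - 1 / 2\<bar> / 32 - (1 / 128 - \<bar>y $ 1 - 1 / 2\<bar> / 32)\<bar> \<le> \<bar>x $ 1 - y $ 1\<bar> / 32"
        for x y :: "real ^ 2"
      proof -
        have "\<bar>P / 32 - R / 32\<bar> = \<bar>R - P\<bar> / 32" for P R :: real
          by (simp add: abs_minus_commute flip: diff_divide_distrib)
        moreover have "\<bar>\<bar>y $ 1 - 1 / 2\<bar> - \<bar>x $ 1 - 1 / 2\<bar>\<bar> \<le> \<bar>x $ 1 - y $ 1\<bar>" by linarith
        ultimately show ?thesis by simp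
      qed
      have max: "\<bar>max a b - max c d\<bar> \<le> e" if "\<bar>a - c\<bar> \<le> e" "\<bar>b - d\<bar> \<le> e" for a b c d e :: real
        using that by linarith
      show "\<bar>s x + f x - (s y + f y)\<bar> \<le> 1 * mdist (submetric taxicab punctured_disc) x y" for x y
        unfolding eq mdist_submetric mdist_taxicab mult_1
      proof (rule max)
        show "\<bar>\<bar>x $ 2\<bar> - \<bar>y $ 2\<bar>\<bar> \<le> \<bar>x $ 1 - y $ 1\<bar> + \<bar>x $ 2 - y $ 2\<bar>" by linarith
        have "\<bar>x $ 1 - y $ 1\<bar> / 32 \<le> \<bar>x $ 1 - y $ 1\<bar> + \<bar>x $ 2 - y $ 2\<bar>" by (simp add: field_simps)
        with cone[of x y] show "\<bar>1 / 128 - \<bar>x $ 1 - 1 / 2\<bar> / 32 - (1 / 128 - \<bar>y $ 1 - 1 / 2\<bar> / 32)\<bar>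
            \<le> \<bar>x $ 1 - y $ 1\<bar> + \<bar>x $ 2 - y $ 2\<bar>"
          by (rule order_trans)
      qed
      show "\<bar>s x + f x - (s y + f y)\<bar> \<le> (1 / 32) * mdist (submetric taxicab punctured_disc) x y"
        if "x \<in> punctured_disc \<inter> A" "y \<in> punctured_disc \<inter> A" for x y
      proof -
        have "s z + f z = 1 / 128 - \<bar>z $ 1 - 1 / 2\<bar> / 32" if "z \<in> A" for z
          using that by (auto simp: s_def f_def A_def \<psi>_def)
        then have "\<bar>s x + f x - (s y + f y)\<bar> \<le> \<bar>x $ 1 - y $ 1\<bar> / 32"
          using that cone[of x y] by simp
        also have "\<dots> \<le> (1 / 32) * mdist (submetric taxicab punctured_disc) x y"
          by (simp add: mdist_taxicab)
        finally show ?thesis .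
      qed
    qed auto
    then have wug: "weak_upper_gradient q (submetric taxicab punctured_disc) \<mu> (\<lambda>x. ereal (s x) + ereal (f x)) g2"
      using upper_gradient_imp_wug by simp
    have "(\<integral>\<^sup>+y\<in>B. ennpowr (g2 y) q \<partial>\<mu>) < \<infinity>" for B
    proof -
      have "ennpowr (g2 y) q \<le> ennpowr 1 q" for y
        using q by (intro ennpowr_mono) (auto simp: g2_def)
      then have "(\<integral>\<^sup>+y\<in>B. ennpowr (g2 y) q \<partial>\<mu>) \<le> (\<integral>\<^sup>+y. ennreal 1 \<partial>\<mu>)"
        by (intro nn_integral_mono) (auto split: split_indicator)
      also have "\<dots> < \<infinity>" using bounded_\<Omega> by (rule const_integral_finite)
      finally show ?thesis .
    qed
    then have "g2 \<in> Lq_loc q (submetric taxicab punctured_disc) \<mu>"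
      using wug by (auto simp: Lq_loc_def weak_upper_gradient_def intro: exI[of _ 1])
    then have "AE x in \<mu>. gF x \<le> g2 x"
      using min_wug_perturbation[where u = s and K = 1 and \<phi> = "\<lambda>x. ereal (f x)", OF s_Lip _ f_ug f_int] wug
      unfolding is_minimal_wug_def gF_def by auto
    then show ?thesis
    proof (intro nn_integral_mono_AE, eventually_elim)
      case (elim x)
      show ?case
      proof (cases "x \<in> A")
        case True
        then have "ennpowr (gF x) q \<le> ennpowr (ennreal (1 / 32)) q"
          using elim q by (intro ennpowr_mono) (auto simp: g2_def)
        also have "\<dots> = ennreal ((1 / 32) powr q)"
          by (rule ennpowr_ennreal) simp
        also have "\<dots> \<le> ennreal (1 / 32)"
          using q powr_mono'[of 1 q "1 / 32"] by (intro ennreal_leI) simp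
        finally show ?thesis using True by simp
      qed simp
    qed
  qed
  also have "\<dots> = ennreal (1 / 32) * emeasure lborel A"
  proof -
    have "(\<integral>\<^sup>+x. ennreal (1 / 32) * indicator A x \<partial>\<mu>) = (\<integral>\<^sup>+x. ennreal (1 / 32) * indicator A x \<partial>lborel)"
      unfolding \<mu>_integral using \<open>A \<subseteq> punctured_disc\<close> by (intro nn_integral_cong) (auto split: split_indicator)
    then show ?thesis by (simp add: nn_integral_cmult_indicator)
  qed
  also have "\<dots> \<le> ennreal (1 / 32) * ennreal (1 / 128)"
    using A_fin by (rule mult_left_mono) simp
  also have "\<dots> = ennreal (1 / 4096)"
    by (simp flip: ennreal_mult)
  finally show False by simp
qed


section \<open>Lebesgue measure on the plane is admissible\<close>

lemma weighted_measure_1: "weighted_measure (\<lambda>_. 1) = lebesgue"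
  by (simp add: weighted_measure_def density_1)

lemma weight_1: "weight (\<lambda>_ :: 'a::euclidean_space. 1)"
proof -
  have "integrable lebesgue (indicator K :: 'a \<Rightarrow> real)" if "compact K" for K
    using lmeasurable_compact[OF that] by (intro integrable_real_indicator) (auto simp: fmeasurable_def)
  then show ?thesis by (simp add: weight_def set_integrable_def)
qed

lemma mball_of_euclidean: "mball_of euclidean_metric x r = ball x r"
  by auto

lemma emeasure_ball_scale:
  fixes x :: "real ^ 2"
  assumes "0 < r" "0 < k"
  shows "emeasure lborel (ball x (k * r)) = ennreal (k\<^sup>2) * emeasure lborel (ball x r)"
  using assms by (simp add: emeasure_ball power_mult_distrib mult_ac flip: ennreal_mult)

lemma emeasure_ball_plane_pos:
  fixes x :: "real ^ 2"
  assumes "0 < r"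
  shows "0 < emeasure lborel (ball x r)" "emeasure lborel (ball x r) < \<infinity>"
  using assms by (simp_all add: emeasure_ball)

lemma doubling_lebesgue: "doubling (euclidean_metric :: (real ^ 2) metric) lebesgue"
  unfolding doubling_def mball_of_euclidean
  using emeasure_ball_plane_pos emeasure_ball_scale[of _ 2]
  by (auto intro!: exI[of _ 4])

text \<open>
  Jensen's inequality for powers.  After scaling \<open>g\<close> by \<open>k\<close> so that the mean of its \<open>p\<close>-th power
  becomes \<open>1\<close>, it is \<open>ennpowr_bernoulli\<close> integrated over \<open>S\<close>.
\<close>

lemma nn_integral_average_le:
  assumes p: "1 < p" and [measurable]: "g \<in> borel_measurable M" "S \<in> sets M"
    and S: "0 < emeasure M S" "emeasure M S < \<infinity>"
  shows "(\<integral>\<^sup>+x\<in>S. g x \<partial>M) / emeasure M S \<le> ennpowr ((\<integral>\<^sup>+x\<in>S. ennpowr (g x) p \<partial>M) / emeasure M S) (1 / p)"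
proof -
  \<comment> \<open>Division by the measure of \<open>S\<close> is multiplication by a constant, which integrals respect.\<close>
  define c where "c = inverse (emeasure M S)"
  have cS: "emeasure M S * c = 1"
    using S unfolding c_def by (metis divide_ennreal_def ennreal_divide_self less_irrefl infinity_ennreal_def)
  define A where "A = (\<integral>\<^sup>+x\<in>S. ennpowr (g x) p \<partial>M) * c"
  have "(\<integral>\<^sup>+x\<in>S. g x \<partial>M) * c \<le> ennpowr A (1 / p)"
  proof (cases A)
    case top
    then show ?thesis by simp
  next
    case (real a)
    show ?thesis
    proof (cases "a = 0")
      case True
      have "c \<noteq> 0" using cS by auto
      then have "(\<integral>\<^sup>+x\<in>S. ennpowr (g x) p \<partial>M) = 0" using True real by (simp add: A_def)
      then have "AE x in M. ennpowr (g x) p * indicator S x = 0"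
        by (subst (asm) nn_integral_0_iff_AE) auto
      then have "(\<integral>\<^sup>+x\<in>S. g x \<partial>M) = (\<integral>\<^sup>+x. 0 \<partial>M)"
        by (intro nn_integral_cong_AE) (auto elim!: eventually_mono)
      then show ?thesis by simp
    next
      case False
      define t where "t = a powr (1 / p)"
      have t: "0 < t" "0 < a" using False real by (auto simp: t_def)
      \<comment> \<open>The mean of the \<open>p\<close>-th power of \<open>k * g\<close> is \<open>1\<close>.\<close>
      define k where "k = 1 / t"
      have k: "0 < k" using t by (simp add: k_def)
      have kp: "k powr p * a = 1"
        using t p by (simp add: k_def t_def powr_divide powr_powr)
      have "ennreal p * (ennreal k * ((\<integral>\<^sup>+x\<in>S. g x \<partial>M) * c)) = (\<integral>\<^sup>+x. ennreal p * (ennreal k * g x) * indicator S x \<partial>M) * c"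
        using p k by (simp add: nn_integral_cmult mult.assoc)
      also have "\<dots> \<le> (\<integral>\<^sup>+x. (ennreal (k powr p) * ennpowr (g x) p) * indicator S x + ennreal (p - 1) * indicator S x \<partial>M) * c"
        using ennpowr_bernoulli[OF p, of "ennreal k * _"] unfolding ennpowr_mult[OF k]
        by (intro mult_right_mono nn_integral_mono) (auto split: split_indicator)
      also have "\<dots> = ennreal (k powr p) * A + ennreal (p - 1) * (emeasure M S * c)"
        by (subst nn_integral_add) (auto simp: A_def nn_integral_cmult mult.assoc distrib_right)
      also have "\<dots> = ennreal p"
        using kp real p by (simp add: cS flip: ennreal_mult ennreal_plus ennreal_1)
      finally have "ennreal p * (ennreal k * ((\<integral>\<^sup>+x\<in>S. g x \<partial>M) * c)) \<le> ennreal p * 1" by simp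
      then have "ennreal k * ((\<integral>\<^sup>+x\<in>S. g x \<partial>M) * c) \<le> 1"
        using p by (subst (asm) ennreal_mult_le_mult_iff) auto
      then have "ennreal t * (ennreal k * ((\<integral>\<^sup>+x\<in>S. g x \<partial>M) * c)) \<le> ennreal t * 1"
        by (rule mult_left_mono) simp
      moreover have "ennreal t * ennreal k = 1" using t by (simp add: k_def flip: ennreal_mult)
      ultimately have "(\<integral>\<^sup>+x\<in>S. g x \<partial>M) * c \<le> ennreal t" by (simp add: mult.assoc[symmetric])
      also have "\<dots> = ennpowr A (1 / p)" using real by (simp add: t_def ennpowr_ennreal)
      finally show ?thesis .
    qed
  qed
  then show ?thesis by (simp add: A_def c_def divide_ennreal_def)
qed

lemma plane_point_swap: "plane_point 1 a b = plane_point 2 b a"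
  by (simp add: vec_eq_iff forall_2 plane_point_nth)

lemma plane_point_self: "plane_point 1 (y $ 1) (y $ 2) = y"
  by (simp add: vec_eq_iff forall_2 plane_point_nth)

lemma norm_axis_real: "norm (axis i t :: real ^ 'n) = \<bar>t\<bar>" for t :: real
  by (simp add: norm_eq_sqrt_inner inner_axis_axis)

text \<open>Makes the lemmas about segments available for the Euclidean metric.\<close>

lemma plane_domain_euclidean: "plane_domain euclidean_metric UNIV 2"
proof
  fix i :: 2 and s t y :: real
  have "plane_point i s y - plane_point i t y = axis i (s - t)"
    by (simp add: vec_eq_iff plane_point_nth axis_def)
  then show "mdist euclidean_metric (plane_point i s y) (plane_point i t y) = \<bar>s - t\<bar>"
    by (simp add: dist_norm norm_axis_real)
qed auto

lemma upper_gradient_segment: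
  fixes u :: "real ^ 2 \<Rightarrow> ereal"
  assumes ug: "upper_gradient euclidean_metric u g" and [measurable]: "g \<in> borel_measurable borel"
    and ab: "a \<in> {c..d}" "b \<in> {c..d}" and fin: "\<bar>u (plane_point i a y)\<bar> \<noteq> \<infinity>"
    and int: "line_integral i y c d g < \<infinity>"
  shows "\<bar>u (plane_point i b y)\<bar> \<noteq> \<infinity>" (is ?fin)
    and "ennreal \<bar>real_of_ereal (u (plane_point i a y)) - real_of_ereal (u (plane_point i b y))\<bar>
      \<le> line_integral i y c d g" (is ?le)
proof -
  interpret plane_domain euclidean_metric UNIV 2 by (rule plane_domain_euclidean)
  have *: "\<bar>u (plane_point i s y)\<bar> \<noteq> \<infinity> \<and> \<bar>u (plane_point i t y)\<bar> \<noteq> \<infinity> \<and>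
      ennreal \<bar>real_of_ereal (u (plane_point i s y)) - real_of_ereal (u (plane_point i t y))\<bar>
      \<le> line_integral i y c d g" if st: "s < t" "c \<le> s" "t \<le> d" for s t
  proof -
    let ?c = "(t - s, \<lambda>r. plane_point i (s + r) y)"
    have "?c \<in> rect_curves euclidean_metric" using st(1) by (intro segment_rect_curve) auto
    then have ugc: "ug_inequality u g ?c" using ug by (simp add: upper_gradient_def)
    have "curve_integral ?c g = line_integral i y s t g"
      using st by (intro segment_integral) auto
    also have "\<dots> \<le> line_integral i y c d g"
      using st by (intro nn_integral_mono) (auto split: split_indicator)
    finally have le: "curve_integral ?c g \<le> line_integral i y c d g" .
    show ?thesis
      using ug_inequality_finite[OF ugc le_less_trans[OF le int]] le by (auto intro: order_trans)
  qed
  consider "a = b" | "a < b" | "b < a" by linarith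
  then have "?fin \<and> ?le"
  proof cases
    case 1
    then show ?thesis using fin by simp
  next
    case 2
    then show ?thesis using *[of a b] ab by auto
  next
    case 3
    then show ?thesis using *[of b a] ab by (auto simp: abs_minus_commute)
  qed
  then show ?fin ?le by auto
qed

text \<open>
  The inner integral is constant in the \<open>i\<close>-th coordinate, so integrating over that coordinate only
  multiplies by the side of the square.
\<close>

lemma square_line_integrals:
  fixes x :: "real ^ 2" and g :: "real ^ 2 \<Rightarrow> ennreal"
  assumes [measurable]: "g \<in> borel_measurable borel" and "i \<noteq> j" "0 \<le> r"
  defines "Q \<equiv> {y. \<forall>k. \<bar>y $ k - x $ k\<bar> \<le> r}"
  shows "(\<integral>\<^sup>+y\<in>Q. line_integral i (y $ j) (x $ i - r) (x $ i + r) g \<partial>lborel)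
      = ennreal (2 * r) * (\<integral>\<^sup>+y\<in>Q. g y \<partial>lborel)"
proof -
  have "k = i \<or> k = j" for k
    using exhaust_2[of k] exhaust_2[of i] exhaust_2[of j] \<open>i \<noteq> j\<close> by auto
  then have all_k: "(\<forall>k. P k) \<longleftrightarrow> P i \<and> P j" for P
    by metis
  have ji: "j \<noteq> i" using \<open>i \<noteq> j\<close> by simp
  have [measurable]: "Q \<in> sets borel" unfolding Q_def all_k by measurable
  have Q_iff: "plane_point i t s \<in> Q \<longleftrightarrow> t \<in> {x $ i - r..x $ i + r} \<and> s \<in> {x $ j - r..x $ j + r}" for t s
    unfolding Q_def mem_Collect_eq all_k plane_point_nth using ji by (auto simp: abs_le_iff)
  have Q: "indicator Q (plane_point i t s) = (indicator {x $ i - r..x $ i + r} t * indicator {x $ j - r..x $ j + r} s :: ennreal)" for t s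
    by (simp add: indicator_def Q_iff)
  define L where "L s = line_integral i s (x $ i - r) (x $ i + r) g" for s
  have [measurable]: "L \<in> borel_measurable borel" unfolding L_def by measurable
  have "(\<integral>\<^sup>+y\<in>Q. L (y $ j) \<partial>lborel) = (\<integral>\<^sup>+s. \<integral>\<^sup>+t. (L s * indicator {x $ j - r..x $ j + r} s) * indicator {x $ i - r..x $ i + r} t \<partial>lborel \<partial>lborel)"
    by (subst nn_integral_lines[of _ i], measurable) (simp add: Q plane_point_nth ji mult_ac)
  also have "\<dots> = (\<integral>\<^sup>+s. (L s * indicator {x $ j - r..x $ j + r} s) * ennreal (2 * r) \<partial>lborel)"
    using \<open>0 \<le> r\<close> by (subst nn_integral_cmult) auto
  also have "\<dots> = ennreal (2 * r) * (\<integral>\<^sup>+s. L s * indicator {x $ j - r..x $ j + r} s \<partial>lborel)"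
    by (subst nn_integral_multc) (auto simp: mult.commute)
  also have "(\<integral>\<^sup>+s. L s * indicator {x $ j - r..x $ j + r} s \<partial>lborel) = (\<integral>\<^sup>+s. \<integral>\<^sup>+t. g (plane_point i t s) * indicator Q (plane_point i t s) \<partial>lborel \<partial>lborel)"
    unfolding L_def by (subst nn_integral_multc[symmetric]) (auto simp: Q mult.assoc)
  also have "\<dots> = (\<integral>\<^sup>+y\<in>Q. g y \<partial>lborel)"
    by (subst nn_integral_lines[of _ i]) auto
  finally show ?thesis unfolding L_def .
qed

text \<open>
  Two points \<open>y\<close> and \<open>z\<close> of the ball are joined inside the circumscribed square \<open>Q\<close> by a horizontal
  segment at height \<open>y $ 2\<close> followed by a vertical one above \<open>z $ 1\<close>.  The bound for \<open>|u y - u z|\<close> is thus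
  the sum of a function of \<open>y\<close> and a function of \<open>z\<close>, and \<open>square_line_integrals\<close> evaluates the mean of
  each of them.
\<close>

lemma poincare_ball:
  fixes x :: "real ^ 2" and u :: "real ^ 2 \<Rightarrow> ereal"
  assumes r: "0 < r" and [measurable]: "u \<in> borel_measurable lebesgue" and u_fin: "(\<integral>\<^sup>+y. e2ennreal \<bar>u y\<bar> \<partial>lebesgue) < \<infinity>"
    and ug: "upper_gradient euclidean_metric u g"
  shows "(\<integral>\<^sup>+y\<in>ball x r. e2ennreal \<bar>u y - ereal (mean_value lebesgue (ball x r) u)\<bar> \<partial>lebesgue)
    \<le> ennreal (4 * r) * (\<integral>\<^sup>+y\<in>ball x (3 * r). g y \<partial>lborel)"
proof -
  interpret plane_domain euclidean_metric UNIV 2 by (rule plane_domain_euclidean)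
  have [measurable]: "g \<in> borel_measurable borel"
    using ug by (simp add: upper_gradient_def borel_iff)
  define B where "B = ball x r"
  have [measurable]: "B \<in> sets lborel" "B \<in> sets lebesgue" by (auto simp: B_def)
  define v where "v y = real_of_ereal (u y)" for y
  define V where "V = measure lebesgue B"
  have em: "0 < emeasure lebesgue B" "emeasure lebesgue B < \<infinity>"
    using emeasure_ball_plane_pos[OF r, of x] by (simp_all add: B_def)
  have V_em: "emeasure lebesgue B = ennreal V"
    unfolding V_def using em by (intro emeasure_eq_ennreal_measure) auto
  then have V: "0 < V" and V_lb: "emeasure lborel B = ennreal V"
    using em by (simp_all add: B_def)
  have B_const: "(\<integral>\<^sup>+z\<in>B. k \<partial>lborel) = k * ennreal V" for k
    by (subst nn_integral_cmult_indicator) (simp_all add: V_lb[unfolded B_def] B_def)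
  define Q where "Q = {y :: real ^ 2. \<forall>k. \<bar>y $ k - x $ k\<bar> \<le> r}"
  have [measurable]: "Q \<in> sets borel" unfolding Q_def forall_2 by measurable
  have "B \<subseteq> Q"
  proof
    fix y assume "y \<in> B"
    then have "norm (y - x) \<le> r" by (auto simp: B_def dist_norm norm_minus_commute)
    then show "y \<in> Q" using component_le_norm_cart[of "y - x"] by (auto simp: Q_def intro: order_trans)
  qed
  have "Q \<subseteq> ball x (3 * r)"
  proof
    fix y assume "y \<in> Q"
    then have "\<bar>(y - x) $ 1\<bar> \<le> r" "\<bar>(y - x) $ 2\<bar> \<le> r" by (auto simp: Q_def)
    then show "y \<in> ball x (3 * r)"
      using norm_le_l1_cart[of "y - x"] r by (simp add: sum_2 dist_norm norm_minus_commute)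
  qed
  define Hor where "Hor s = line_integral 1 s (x $ 1 - r) (x $ 1 + r) g" for s
  define Ver where "Ver s = line_integral 2 s (x $ 2 - r) (x $ 2 + r) g" for s
  have [measurable]: "Hor \<in> borel_measurable borel" "Ver \<in> borel_measurable borel"
    unfolding Hor_def Ver_def by measurable
  define G where "G = ennreal (2 * r) * (\<integral>\<^sup>+y\<in>Q. g y \<partial>lborel)"
  have Hor_int: "(\<integral>\<^sup>+y\<in>B. Hor (y $ 2) \<partial>lborel) \<le> G"
  proof -
    have "(\<integral>\<^sup>+y\<in>B. Hor (y $ 2) \<partial>lborel) \<le> (\<integral>\<^sup>+y\<in>Q. Hor (y $ 2) \<partial>lborel)"
      using \<open>B \<subseteq> Q\<close> by (intro nn_integral_mono) (auto split: split_indicator)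
    also have "\<dots> = G"
      unfolding Hor_def G_def Q_def using r by (intro square_line_integrals) auto
    finally show ?thesis .
  qed
  have Ver_int: "(\<integral>\<^sup>+y\<in>B. Ver (y $ 1) \<partial>lborel) \<le> G"
  proof -
    have "(\<integral>\<^sup>+y\<in>B. Ver (y $ 1) \<partial>lborel) \<le> (\<integral>\<^sup>+y\<in>Q. Ver (y $ 1) \<partial>lborel)"
      using \<open>B \<subseteq> Q\<close> by (intro nn_integral_mono) (auto split: split_indicator)
    also have "\<dots> = G"
      unfolding Ver_def G_def Q_def using r by (intro square_line_integrals) auto
    finally show ?thesis .
  qed
  have path: "ennreal \<bar>v y - v z\<bar> \<le> Hor (y $ 2) + Ver (z $ 1)"
    if yz: "y \<in> B" "z \<in> B" and fin: "\<bar>u y\<bar> \<noteq> \<infinity>" "\<bar>u z\<bar> \<noteq> \<infinity>" for y z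
  proof (cases "Hor (y $ 2) < \<infinity> \<and> Ver (z $ 1) < \<infinity>")
    case True
    \<comment> \<open>The corner of the path from \<open>y\<close> to \<open>z\<close>.\<close>
    define w where "w = plane_point 1 (z $ 1) (y $ 2)"
    have w2: "w = plane_point 2 (y $ 2) (z $ 1)" unfolding w_def by (rule plane_point_swap)
    have z2: "plane_point 2 (z $ 2) (z $ 1) = z" using plane_point_self[of z] plane_point_swap by metis
    have in_I: "y $ 1 \<in> {x $ 1 - r..x $ 1 + r}" "z $ 1 \<in> {x $ 1 - r..x $ 1 + r}"
      "y $ 2 \<in> {x $ 2 - r..x $ 2 + r}" "z $ 2 \<in> {x $ 2 - r..x $ 2 + r}"
      using yz \<open>B \<subseteq> Q\<close> by (auto simp: Q_def abs_le_iff subset_iff algebra_simps)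
    have "ennreal \<bar>v y - v w\<bar> \<le> Hor (y $ 2)"
      using upper_gradient_segment(2)[OF ug _ in_I(1,2), of 1 "y $ 2"] fin(1) True
      by (simp add: plane_point_self v_def w_def Hor_def)
    moreover have "ennreal \<bar>v z - v w\<bar> \<le> Ver (z $ 1)"
      using upper_gradient_segment(2)[OF ug _ in_I(4,3), of 2 "z $ 1"] fin(2) True
      by (simp add: z2 v_def w2 Ver_def)
    moreover have "ennreal \<bar>v y - v z\<bar> \<le> ennreal \<bar>v y - v w\<bar> + ennreal \<bar>v z - v w\<bar>"
      by (simp flip: ennreal_plus)
    ultimately show ?thesis by (meson add_mono order_trans)
  qed (auto simp: less_top[symmetric])
  have [measurable]: "v \<in> borel_measurable lebesgue" unfolding v_def by measurable
  have ae_fin: "AE y in lebesgue. \<bar>u y\<bar> \<noteq> \<infinity>"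
  proof -
    have "AE y in lebesgue. e2ennreal \<bar>u y\<bar> \<noteq> \<infinity>"
      using u_fin by (intro nn_integral_noteq_infinite) auto
    then show ?thesis by eventually_elim auto
  qed
  have v_int: "integrable lebesgue v"
  proof (rule integrableI_bounded)
    have "(\<integral>\<^sup>+y. ennreal (norm (v y)) \<partial>lebesgue) \<le> (\<integral>\<^sup>+y. e2ennreal \<bar>u y\<bar> \<partial>lebesgue)"
    proof (rule nn_integral_mono)
      fix y show "ennreal (norm (v y)) \<le> e2ennreal \<bar>u y\<bar>" by (cases "u y") (auto simp: v_def)
    qed
    also note u_fin
    finally show "(\<integral>\<^sup>+y. ennreal (norm (v y)) \<partial>lebesgue) < \<infinity>" .
  qed measurable
  define M where "M = mean_value lebesgue B u"
  have M: "M = (LINT z|lebesgue. indicator B z * v z) / V"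
    by (simp add: M_def mean_value_def V_def v_def set_lebesgue_integral_def)
  have B_int: "integrable lebesgue (indicator B :: _ \<Rightarrow> real)"
    using V_em by (intro integrable_real_indicator) auto
  have Bv_int: "integrable lebesgue (\<lambda>z. indicator B z * v z)"
    using integrable_mult_indicator[OF _ v_int, of B] by simp
  have point: "ennreal \<bar>v y - M\<bar> \<le> Hor (y $ 2) + G / ennreal V" if y: "y \<in> B" "\<bar>u y\<bar> \<noteq> \<infinity>" for y
  proof -
    have "V * (v y - M) = (LINT z|lebesgue. indicator B z * v y) - (LINT z|lebesgue. indicator B z * v z)"
      using V by (simp add: M V_def right_diff_distrib)
    also have "\<dots> = (LINT z|lebesgue. indicator B z * v y - indicator B z * v z)"
      using B_int Bv_int by (subst Bochner_Integration.integral_diff) auto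
    finally have eq: "V * (v y - M) = (LINT z|lebesgue. indicator B z * v y - indicator B z * v z)" .
    have "ennreal V * ennreal \<bar>v y - M\<bar> = ennreal (norm (V * (v y - M)))"
      using V by (simp add: abs_mult ennreal_mult)
    also have "\<dots> \<le> (\<integral>\<^sup>+z. ennreal (norm (indicator B z * v y - indicator B z * v z)) \<partial>lebesgue)"
      unfolding eq using B_int Bv_int by (intro integral_norm_bound_ennreal) auto
    also have "\<dots> \<le> (\<integral>\<^sup>+z. (Hor (y $ 2) + Ver (z $ 1)) * indicator B z \<partial>lebesgue)"
      using ae_fin
    proof (intro nn_integral_mono_AE, eventually_elim)
      case (elim z)
      then show ?case using path[OF y(1) _ y(2), of z] by (auto split: split_indicator)
    qed
    also have "\<dots> = (\<integral>\<^sup>+z. Hor (y $ 2) * indicator B z + Ver (z $ 1) * indicator B z \<partial>lborel)"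
      by (simp add: nn_integral_completion distrib_right)
    also have "\<dots> = Hor (y $ 2) * ennreal V + (\<integral>\<^sup>+z\<in>B. Ver (z $ 1) \<partial>lborel)"
      by (subst nn_integral_add) (auto simp: B_const)
    also have "\<dots> \<le> Hor (y $ 2) * ennreal V + G"
      using Ver_int by (rule add_left_mono)
    finally have le: "ennreal V * ennreal \<bar>v y - M\<bar> \<le> Hor (y $ 2) * ennreal V + G" .
    have inv: "ennreal V * ennreal (1 / V) = 1" using V by (simp flip: ennreal_mult)
    have "ennreal \<bar>v y - M\<bar> = (ennreal V * ennreal \<bar>v y - M\<bar>) * ennreal (1 / V)"
      using inv by (metis mult.commute mult.left_commute mult_1)
    also have "\<dots> \<le> (Hor (y $ 2) * ennreal V + G) * ennreal (1 / V)"
      using le by (rule mult_right_mono) simp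
    also have "\<dots> = Hor (y $ 2) + G * ennreal (1 / V)"
      using inv by (simp add: distrib_right mult.assoc)
    also have "G * ennreal (1 / V) = G / ennreal V"
      using V by (simp add: divide_ennreal_def inverse_ennreal inverse_eq_divide)
    finally show ?thesis .
  qed
  have "(\<integral>\<^sup>+y\<in>B. e2ennreal \<bar>u y - ereal M\<bar> \<partial>lebesgue) \<le> (\<integral>\<^sup>+y. Hor (y $ 2) * indicator B y + G / ennreal V * indicator B y \<partial>lebesgue)"
    using ae_fin
  proof (intro nn_integral_mono_AE, eventually_elim)
    case (elim y)
    then have "e2ennreal \<bar>u y - ereal M\<bar> = ennreal \<bar>v y - M\<bar>" by (cases "u y") (auto simp: v_def)
    then show ?case using point[of y] elim by (auto split: split_indicator)
  qed
  also have "\<dots> = (\<integral>\<^sup>+y\<in>B. Hor (y $ 2) \<partial>lborel) + G / ennreal V * ennreal V"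
    unfolding nn_integral_completion
    by (subst nn_integral_add) (auto simp: B_const)
  also have "G / ennreal V * ennreal V = G"
    using V by (simp add: ennreal_divide_times ennreal_divide_self ennreal_times_divide mult_divide_eq_ennreal)
  also have "(\<integral>\<^sup>+y\<in>B. Hor (y $ 2) \<partial>lborel) + G \<le> G + G"
    using Hor_int by (rule add_right_mono)
  also have "\<dots> = ennreal (4 * r) * (\<integral>\<^sup>+y\<in>Q. g y \<partial>lborel)"
    using r by (simp add: G_def flip: distrib_right ennreal_plus)
  also have "\<dots> \<le> ennreal (4 * r) * (\<integral>\<^sup>+y\<in>ball x (3 * r). g y \<partial>lborel)"
    using \<open>Q \<subseteq> ball x (3 * r)\<close> by (intro mult_left_mono nn_integral_mono) (auto split: split_indicator)
  finally show ?thesis unfolding M_def B_def .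
qed

text \<open>
  The constant is \<open>36 = 4 * 9\<close>: the factor \<open>4\<close> comes from \<open>poincare_ball\<close>, and \<open>9\<close> is the ratio of the
  areas of the two balls, whose radii are \<open>r\<close> and \<open>3 * r\<close>.
\<close>

lemma supports_poincare_lebesgue:
  assumes p: "1 < p"
  shows "supports_poincare p (euclidean_metric :: (real ^ 2) metric) lebesgue"
  unfolding supports_poincare_def mball_of_euclidean
proof (rule exI[of _ "36 :: real"], rule conjI, simp, rule exI[of _ "3 :: real"], intro conjI ballI allI impI, goal_cases)
  case (2 x r u g)
  interpret plane_domain euclidean_metric UNIV 2 by (rule plane_domain_euclidean)
  have g [measurable]: "g \<in> borel_measurable borel"
    using 2 by (simp add: upper_gradient_def borel_iff)
  have r: "0 < r" using 2 by simp
  define V where "V = emeasure lborel (ball x r)"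
  have V: "0 < V" "V < \<infinity>" and V3: "emeasure lborel (ball x (3 * r)) = 9 * V"
    unfolding V_def using emeasure_ball_plane_pos[OF r] emeasure_ball_scale[OF r, of 3] by auto
  define I where "I = (\<integral>\<^sup>+y\<in>ball x (3 * r). g y \<partial>lborel)"
  have "(\<integral>\<^sup>+y\<in>ball x r. e2ennreal \<bar>u y - ereal (mean_value lebesgue (ball x r) u)\<bar> \<partial>lebesgue) / V
      \<le> ennreal (4 * r) * I / V"
    unfolding I_def using poincare_ball[OF r, of u g x] 2 by (intro divide_right_mono_ennreal) auto
  also have "\<dots> = ennreal (36 * r) * (I / (9 * V))"
  proof -
    obtain s where s: "V = ennreal s" "0 < s" using V by (cases V) auto
    show ?thesis
    proof (cases I)
      case (real k)
      then show ?thesis using s r by (simp add: divide_ennreal field_simps flip: ennreal_mult ennreal_numeral)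
    next
      case top
      then show ?thesis using s r by (simp add: ennreal_mult_top ennreal_top_divide flip: ennreal_mult ennreal_numeral)
    qed
  qed
  also have "I / (9 * V) \<le> ennpowr ((\<integral>\<^sup>+y\<in>ball x (3 * r). ennpowr (g y) p \<partial>lborel) / (9 * V)) (1 / p)"
    unfolding V3[symmetric] I_def using emeasure_ball_plane_pos[of "3 * r" x] r by (intro nn_integral_average_le p) auto
  finally show ?case
    by (simp add: V_def[symmetric] V3 nn_integral_completion mult_left_mono)
qed auto

lemma p_admissible_1: "1 < p \<Longrightarrow> p_admissible p (\<lambda>_ :: real ^ 2. 1)"
  unfolding p_admissible_def weighted_measure_1
  using weight_1 doubling_lebesgue supports_poincare_lebesgue by blast


section \<open>Failure of strong comparison and of linearity\<close>

theorem corollary1p4: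
  fixes p :: real
  assumes "1 < p"
  shows "\<exists>(m :: (real ^ 2) metric) (w :: real ^ 2 \<Rightarrow> real).
    biLipschitz_euclidean m \<and> p_admissible p w \<and>
    (\<exists>u v. q_harmonic p m (weighted_measure w) punctured_disc u \<and>
           q_harmonic p m (weighted_measure w) punctured_disc v \<and>
           (\<forall>x\<in>punctured_disc. v x \<le> u x) \<and>
           \<not> (\<forall>x\<in>punctured_disc. v x < u x) \<and>
           \<not> (\<forall>x\<in>punctured_disc. u x = v x)) \<and>
    (\<exists>u v. q_harmonic 2 m (weighted_measure w) punctured_disc u \<and>
           q_harmonic 2 m (weighted_measure w) punctured_disc v \<and>
           \<not> q_harmonic 2 m (weighted_measure w) punctured_disc (\<lambda>x. u x + v x))"
proof -
  have harm: "q_harmonic q taxicab lebesgue punctured_disc (\<lambda>x. x $ 1 + \<bar>x $ 2\<bar>)"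
    "q_harmonic q taxicab lebesgue punctured_disc (\<lambda>x. x $ 1)"
    "q_harmonic q taxicab lebesgue punctured_disc (\<lambda>x. - x $ 1)" if "1 < q" for q
  proof -
    interpret taxicab_domain punctured_disc q using that by (rule taxicab_domain_punctured_disc)
    show "q_harmonic q taxicab lebesgue punctured_disc (\<lambda>x. x $ 1 + \<bar>x $ 2\<bar>)"
      using harmonic_affine_plus_Lipschitz[of 1 abs] by simp
    show "q_harmonic q taxicab lebesgue punctured_disc (\<lambda>x. x $ 1)"
      using harmonic_affine_plus_Lipschitz[of 1 "\<lambda>_. 0"] by simp
    show "q_harmonic q taxicab lebesgue punctured_disc (\<lambda>x. - x $ 1)"
      using harmonic_affine_plus_Lipschitz[of "- 1" "\<lambda>_. 0"] by simp
  qed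
  define a :: "real ^ 2" where "a = axis 1 (1 / 2)"
  define b :: "real ^ 2" where "b = axis 2 (1 / 2)"
  have ab: "a \<in> punctured_disc" "b \<in> punctured_disc"
    by (simp_all add: a_def b_def punctured_disc_def norm_axis_real)
  have a2: "a $ 2 = 0" and b2: "b $ 2 = 1 / 2" by (simp_all add: a_def b_def axis_def)
  show ?thesis
  proof (rule exI[of _ taxicab], rule exI[of _ "\<lambda>_. 1"], unfold weighted_measure_1, intro conjI exI)
    show "biLipschitz_euclidean taxicab" by (rule biLipschitz_taxicab)
    show "p_admissible p (\<lambda>_ :: real ^ 2. 1)" using assms by (rule p_admissible_1)
    show "q_harmonic p taxicab lebesgue punctured_disc (\<lambda>x. x $ 1 + \<bar>x $ 2\<bar>)"
      "q_harmonic p taxicab lebesgue punctured_disc (\<lambda>x. x $ 1)" using harm[OF assms] by auto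
    show "\<forall>x\<in>punctured_disc. x $ 1 \<le> x $ 1 + \<bar>x $ 2\<bar>" by simp
    show "\<not> (\<forall>x\<in>punctured_disc. x $ 1 < x $ 1 + \<bar>x $ 2\<bar>)" using ab(1) a2 by force
    show "\<not> (\<forall>x\<in>punctured_disc. x $ 1 + \<bar>x $ 2\<bar> = x $ 1)" using ab(2) b2 by force
    show "q_harmonic 2 taxicab lebesgue punctured_disc (\<lambda>x. x $ 1 + \<bar>x $ 2\<bar>)"
      "q_harmonic 2 taxicab lebesgue punctured_disc (\<lambda>x. - x $ 1)" using harm[of 2] by auto
    show "\<not> q_harmonic 2 taxicab lebesgue punctured_disc (\<lambda>x. (x $ 1 + \<bar>x $ 2\<bar>) + - x $ 1)"
      using abs_second_coordinate_not_harmonic[of 2] by simp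
  qed
qed

end
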